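(* Let $B$ be a finite dimensional hereditary basic algebra over $\mathbb F_q$. Then there is an ad-quiver $(Q,\sigma)$ such that $B$ is isomorphic to the fixed-point algebra $(kQ)^{F_{Q,\sigma}}$, where $k=\overline{\mathbb F}_q$.
   Context: Let $q$ be a prime power and $k=\overline{\mathbb F}_q$. An ad-quiver is a pair $(Q,\sigma)$, where $Q=(Q_0,Q_1)$ is a finite quiver without loops and $\sigma$ is a quiver automorphism of $Q$ (a permutation of vertices and of arrows compatible with heads and tails) which is admissible, i.e. no arrow connects two vertices in the same $\sigma$-orbit. On the path algebra $kQ$ define $F_{Q,\sigma}(\sum_sx_sp_s)=\sum_sx_s^q\sigma(p_s)$ for $x_s\in k$ and paths $p_s$, where $\sigma(\rho_t\cdots\rho_1)=\sigma(\rho_t)\cdots\sigma(\rho_1)$ for a path $\rho_t\cdots\rho_1$ and $\sigma(e_i)=e_{\sigma(i)}$ for the trivial paths $e_i$. Then $(kQ)^{F_{Q,\sigma}}=\{a\in kQ: F_{Q,\sigma}(a)=a\}$, an $\mathbb F_q$-algebra. *)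

theory Defs
  imports
    "HOL-Library.Cardinality"
    "HOL-Library.Poly_Mapping"
    "HOL-Combinatorics.Orbits"
    "HOL-Algebra.Algebraic_Closure_Type"
    "Graph_Theory.Arc_Walk"
begin

section \<open>Finite dimensional hereditary basic algebras\<close>

text \<open>
  The sort \<open>{ring, monoid_mult}\<close> is that of associative unital rings in which \<open>0 = 1\<close> is not
  excluded (unlike in \<open>ring_1\<close>).
\<close>

locale fd_algebra = vector_space scale
  for scale :: "'f::field \<Rightarrow> 'b::{ring, monoid_mult} \<Rightarrow> 'b" +
  assumes scale_mult_left: "scale c x * y = scale c (x * y)"
    and scale_mult_right: "x * scale c y = scale c (x * y)"
    and finite_dim: "\<exists>S. finite S \<and> span S = UNIV"

text \<open>
  \<open>left_linear_on M s t f\<close>: on the submodule \<open>M\<close>, \<open>f\<close> is linear with respect to the left actions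
  \<open>s\<close> (on its domain) and \<open>t\<close> (on its codomain). The library's modules are over commutative rings.
\<close>

definition left_linear_on ::
    "'m::ab_group_add set \<Rightarrow> ('b \<Rightarrow> 'm \<Rightarrow> 'm) \<Rightarrow> ('b \<Rightarrow> 'n::ab_group_add \<Rightarrow> 'n) \<Rightarrow> ('m \<Rightarrow> 'n) \<Rightarrow> bool"
  where "left_linear_on M s t f \<longleftrightarrow>
    (\<forall>x\<in>M. \<forall>y\<in>M. f (x + y) = f x + f y) \<and> (\<forall>r. \<forall>x\<in>M. f (s r x) = t r (f x))"

definition left_ideal :: "'b::{ring, monoid_mult} set \<Rightarrow> bool"
  where "left_ideal I \<longleftrightarrow> 0 \<in> I \<and> (\<forall>x\<in>I. \<forall>y\<in>I. x + y \<in> I) \<and> (\<forall>r. \<forall>x\<in>I. r * x \<in> I)"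

definition free_scale :: "'b::{ring, monoid_mult} \<Rightarrow> ('x \<Rightarrow>\<^sub>0 'b) \<Rightarrow> ('x \<Rightarrow>\<^sub>0 'b)"
  where "free_scale r f = Poly_Mapping.map (\<lambda>c. r * c) f"

text \<open>
  A left ideal is projective if it is, up to isomorphism, a direct summand (with inclusion \<open>i\<close> and
  projection \<open>p\<close>) of a free left module. Indexing the basis of the free module by the type \<open>'b\<close>
  loses nothing, since \<open>I\<close> is generated by its own elements.
\<close>

definition projective_left_ideal :: "'b::{ring, monoid_mult} set \<Rightarrow> bool"
  where "projective_left_ideal I \<longleftrightarrow> left_ideal I \<and>
    (\<exists>(i :: 'b \<Rightarrow> ('b \<Rightarrow>\<^sub>0 'b)) (p :: ('b \<Rightarrow>\<^sub>0 'b) \<Rightarrow> 'b).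
       left_linear_on I (*) free_scale i \<and>
       left_linear_on UNIV free_scale (*) p \<and> range p \<subseteq> I \<and>
       (\<forall>x\<in>I. p (i x) = x))"

text \<open>
  For finite dimensional algebras the left and the right version of this notion agree.
\<close>

definition hereditary :: "'b::{ring, monoid_mult} itself \<Rightarrow> bool"
  where "hereditary _ \<longleftrightarrow> (\<forall>I :: 'b set. left_ideal I \<longrightarrow> projective_left_ideal I)"

definition idempotent :: "'b::{ring, monoid_mult} \<Rightarrow> bool"
  where "idempotent e \<longleftrightarrow> e * e = e"

definition orthogonal :: "'b::{ring, monoid_mult} \<Rightarrow> 'b \<Rightarrow> bool"
  where "orthogonal e f \<longleftrightarrow> e * f = 0 \<and> f * e = 0"

definition primitive_idempotent :: "'b::{ring, monoid_mult} \<Rightarrow> bool"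
  where "primitive_idempotent e \<longleftrightarrow> idempotent e \<and> e \<noteq> 0 \<and>
    (\<forall>e1 e2. idempotent e1 \<and> idempotent e2 \<and> orthogonal e1 e2 \<and> e = e1 + e2 \<longrightarrow> e1 = 0 \<or> e2 = 0)"

definition complete_primitive_orthogonal :: "'b::{ring, monoid_mult} set \<Rightarrow> bool"
  where "complete_primitive_orthogonal E \<longleftrightarrow> finite E \<and>
    (\<forall>e\<in>E. primitive_idempotent e) \<and> (\<forall>e\<in>E. \<forall>f\<in>E. e \<noteq> f \<longrightarrow> orthogonal e f) \<and> \<Sum>E = 1"

definition principal_left_ideal :: "'b::{ring, monoid_mult} \<Rightarrow> 'b set"
  where "principal_left_ideal e = range (\<lambda>r. r * e)"

definition left_ideals_isomorphic :: "'b::{ring, monoid_mult} set \<Rightarrow> 'b set \<Rightarrow> bool"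
  where "left_ideals_isomorphic I J \<longleftrightarrow> (\<exists>f. left_linear_on I (*) (*) f \<and> bij_betw f I J)"

text \<open>
  The indecomposable projective summands of the regular module are pairwise non-isomorphic
  (by Krull-Schmidt the choice of \<open>E\<close> is irrelevant for finite dimensional algebras).
\<close>

definition basic :: "'b::{ring, monoid_mult} itself \<Rightarrow> bool"
  where "basic _ \<longleftrightarrow> (\<exists>E :: 'b set. complete_primitive_orthogonal E \<and>
    (\<forall>e\<in>E. \<forall>f\<in>E. e \<noteq> f \<longrightarrow>
       \<not> left_ideals_isomorphic (principal_left_ideal e) (principal_left_ideal f)))"


section \<open>Quivers with automorphism\<close>

text \<open>
  A finite quiver without loops is a finite loopfree multi-digraph. The automorphism is given by
  its actions \<open>sv\<close> on vertices and \<open>sa\<close> on arrows; \<open>permutes\<close> makes them the identity off the quiver.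
\<close>

locale ad_quiver = fin_digraph Q + loopfree_digraph Q
  for Q :: "('v, 'a) pre_digraph" +
  fixes sv :: "'v \<Rightarrow> 'v" and sa :: "'a \<Rightarrow> 'a"
  assumes permutes_verts: "sv permutes verts Q"
    and permutes_arcs: "sa permutes arcs Q"
    and tail_sa: "a \<in> arcs Q \<Longrightarrow> tail Q (sa a) = sv (tail Q a)"
    and head_sa: "a \<in> arcs Q \<Longrightarrow> head Q (sa a) = sv (head Q a)"
    and admissible: "a \<in> arcs Q \<Longrightarrow> head Q a \<notin> orbit sv (tail Q a)"


section \<open>Path algebras\<close>

text \<open>
  The path \<open>\<rho>\<^sub>t \<cdots> \<rho>\<^sub>1\<close> with source \<open>u\<close> is the pair \<open>(u, [\<rho>\<^sub>1, \<dots>, \<rho>\<^sub>t])\<close>, arrows listed in order of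
  traversal; the trivial path at \<open>u\<close> is \<open>(u, [])\<close>.
\<close>

type_synonym ('v, 'a) path = "'v \<times> 'a list"

definition paths :: "('v, 'a) pre_digraph \<Rightarrow> ('v, 'a) path set"
  where "paths Q = {(u, p). \<exists>v. pre_digraph.awalk Q u p v}"

definition path_source :: "('v, 'a) path \<Rightarrow> 'v"
  where "path_source x = fst x"

definition path_target :: "('v, 'a) pre_digraph \<Rightarrow> ('v, 'a) path \<Rightarrow> 'v"
  where "path_target Q x = last (pre_digraph.awalk_verts Q (fst x) (snd x))"

definition path_algebra :: "('v, 'a) pre_digraph \<Rightarrow> (('v, 'a) path \<Rightarrow>\<^sub>0 'k::field) set"
  where "path_algebra Q = {f. Poly_Mapping.keys f \<subseteq> paths Q}"

text \<open>
  The product \<open>x y\<close> of two paths means: first \<open>y\<close>, then \<open>x\<close>.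
\<close>

definition path_mult :: "('v, 'a) pre_digraph \<Rightarrow> (('v, 'a) path \<Rightarrow>\<^sub>0 'k::field) \<Rightarrow>
    (('v, 'a) path \<Rightarrow>\<^sub>0 'k) \<Rightarrow> (('v, 'a) path \<Rightarrow>\<^sub>0 'k)"
  where "path_mult Q f g = (\<Sum>x\<in>Poly_Mapping.keys f. \<Sum>y\<in>Poly_Mapping.keys g.
    if path_source x = path_target Q y
    then Poly_Mapping.single (path_source y, snd y @ snd x)
           (Poly_Mapping.lookup f x * Poly_Mapping.lookup g y)
    else 0)"

definition path_one :: "('v, 'a) pre_digraph \<Rightarrow> (('v, 'a) path \<Rightarrow>\<^sub>0 'k::field)"
  where "path_one Q = (\<Sum>v\<in>verts Q. Poly_Mapping.single (v, []) 1)"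

definition path_scale :: "'k::field \<Rightarrow> (('v, 'a) path \<Rightarrow>\<^sub>0 'k) \<Rightarrow> (('v, 'a) path \<Rightarrow>\<^sub>0 'k)"
  where "path_scale c f = Poly_Mapping.map (\<lambda>x. c * x) f"

definition path_image :: "('v \<Rightarrow> 'v) \<Rightarrow> ('a \<Rightarrow> 'a) \<Rightarrow> ('v, 'a) path \<Rightarrow> ('v, 'a) path"
  where "path_image sv sa x = (sv (fst x), map sa (snd x))"


section \<open>Frobenius fixed points\<close>

text \<open>
  The finite field with \<open>q = CARD('f)\<close> elements is \<open>'f\<close>, with algebraic closure \<open>'f alg_closure\<close>.
\<close>

definition frobenius :: "('v \<Rightarrow> 'v) \<Rightarrow> ('a \<Rightarrow> 'a) \<Rightarrow>
    (('v, 'a) path \<Rightarrow>\<^sub>0 'f::{field, finite} alg_closure) \<Rightarrow> (('v, 'a) path \<Rightarrow>\<^sub>0 'f alg_closure)"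
  where "frobenius sv sa f = (\<Sum>x\<in>Poly_Mapping.keys f.
    Poly_Mapping.single (path_image sv sa x) (Poly_Mapping.lookup f x ^ CARD('f)))"

definition fixed_point_algebra :: "('v, 'a) pre_digraph \<Rightarrow> ('v \<Rightarrow> 'v) \<Rightarrow> ('a \<Rightarrow> 'a) \<Rightarrow>
    (('v, 'a) path \<Rightarrow>\<^sub>0 'f::{field, finite} alg_closure) set"
  where "fixed_point_algebra Q sv sa = {f \<in> path_algebra Q. frobenius sv sa f = f}"

text \<open>
  Isomorphism of algebras over \<open>'f\<close> from \<open>'b\<close> onto the fixed-point algebra, whose operations are
  those of the path algebra and on which \<open>'f\<close> acts through its embedding \<open>to_ac\<close> in the closure.
\<close>

definition isomorphic_to_fixed_point_algebra ::
    "('f::{field, finite} \<Rightarrow> 'b::{ring, monoid_mult} \<Rightarrow> 'b) \<Rightarrow>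
     ('v, 'a) pre_digraph \<Rightarrow> ('v \<Rightarrow> 'v) \<Rightarrow> ('a \<Rightarrow> 'a) \<Rightarrow> bool"
  where "isomorphic_to_fixed_point_algebra scale Q sv sa \<longleftrightarrow>
    (\<exists>\<phi> :: 'b \<Rightarrow> (('v, 'a) path \<Rightarrow>\<^sub>0 'f alg_closure).
       bij_betw \<phi> UNIV (fixed_point_algebra Q sv sa) \<and>
       (\<forall>x y. \<phi> (x + y) = \<phi> x + \<phi> y) \<and>
       (\<forall>x y. \<phi> (x * y) = path_mult Q (\<phi> x) (\<phi> y)) \<and>
       \<phi> 1 = path_one Q \<and>
       (\<forall>c x. \<phi> (scale c x) = path_scale (to_ac c) (\<phi> x)))"

end

theory Submission
  imports Defs "HOL-Computational_Algebra.Fundamental_Theorem_Algebra"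
begin

text \<open>
  Let \<open>e\<^sub>1, \<dots>, e\<^sub>n\<close> be the given orthogonal idempotents of \<open>B\<close>. Hereditariness makes every nonzero
  map between the projectives \<open>B e\<^sub>i\<close> injective. So the \<open>e\<^sub>i B e\<^sub>i\<close> are finite division rings, hence
  fields, and since the \<open>B e\<^sub>i\<close> are pairwise non-isomorphic, the \<open>e\<^sub>i B e\<^sub>j\<close> with \<open>i \<noteq> j\<close> span the
  radical \<open>J\<close>, with complement the semisimple subring \<open>S = \<Prod> e\<^sub>i B e\<^sub>i\<close>. Averaging over the units of the
  fields splits \<open>J = M \<oplus> J\<^sup>2\<close> as \<open>S\<close>-bimodules, and projectivity of \<open>J\<close> gives \<open>J \<cong> B \<otimes>\<^sub>S M\<close>.

  No scalar extension is needed. The vertices of the quiver are the \<open>\<F>\<^sub>q\<close>-algebra homomorphisms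
  \<open>v : B \<rightarrow> k\<close>, with \<open>\<sigma> v = v\<^sup>q\<close>. The arrows \<open>w \<rightarrow> v\<close> form a \<open>k\<close>-basis of the functionals \<open>\<mu>\<close> on \<open>J/J\<^sup>2\<close>
  with \<open>\<mu> (x m y) = v x \<cdot> \<mu> m \<cdot> w y\<close>. It is made of projections of \<open>\<F>\<^sub>q\<close>-valued functionals, and
  the same functionals serve for \<open>(v, w)\<close> and \<open>(\<sigma> v, \<sigma> w)\<close>; so \<open>\<sigma>\<close> permutes the arrows. The
  coefficient at a path of the image of \<open>b\<close> is defined by recursion through \<open>J \<cong> B \<otimes>\<^sub>S M\<close>.
\<close>

section \<open>Wedderburn's little theorem\<close>

text \<open>The usual route extends scalars to k, applies Gabriel's theorem, and must then choose a
  basis of arrows that Frobenius permutes. The difficulty sits at a pair (v, w) fixed by a power of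
  Frobenius: that power acts semilinearly on the functionals for (v, w), and a basis fixed by it is
  wanted. Functionals with values in F_q settle this, because Frobenius takes their (v, w)-component
  to the component of the same functional for the conjugate pair.

  Components are taken by averaging over the units of the fields e B e. The number of these units is
  -1 modulo the characteristic, hence invertible; this replaces a separability argument and is the
  origin of the minus signs.

  Hereditariness enters twice: through principal left ideals, for cancellation, and through J, whose
  projectivity makes coordinates in J unique, so that coefficients along paths can be prescribed
  freely up to Frobenius. The function \<open>height\<close> on idempotents is constant along
  Frobenius orbits of vertices and drops along arrows. It gives admissibility, bounds the paths, and
  stands in for nilpotency of J in the Nakayama-type inductions.\<close>

lemma common_divisor_of_cyclotomic_quotients:
  fixes q :: int and n :: nat
  assumes q: "q \<ge> 2" and n: "n \<ge> 2"
  shows "\<exists>P::int. \<bar>P\<bar> > q - 1 \<and> P dvd q ^ n - 1 \<and>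
    (\<forall>d. d dvd n \<and> d < n \<longrightarrow> P * (q ^ d - 1) dvd q ^ n - 1)"
proof -
  define xp :: "nat \<Rightarrow> int poly" where "xp = (\<lambda>d. [:0, 1:] ^ d - (1 :: int poly))"
  define A where "A = {d. d dvd n \<and> d < n}"
  have finA: "finite A" unfolding A_def by simp
  \<comment> \<open>Dividing \<open>xp n\<close> by the lcm of the \<open>xp d\<close>, d a proper
    divisor of n, leaves the n-th cyclotomic polynomial up to sign, and makes the required
    divisibilities immediate. The bound on its value P at q holds since its complex roots are n-th
    roots of unity other than 1, each at distance more than q - 1 from q.\<close>
  define L where "L = semiring_gcd_class.Lcm_fin (xp ` A)"
  have xp_dvd_L: "xp d dvd L" if "d \<in> A" for d
    unfolding L_def using that by (intro dvd_Lcm_fin) simp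
  have xp_dvd: "xp d dvd xp n" if d: "d dvd n" for d
  proof -
    obtain m where m: "n = d * m" using d by blast
    have "([:0, 1:] ^ d) ^ m - 1 ^ m = (([:0, 1:] ^ d :: int poly) - 1) * (\<Sum>i<m. 1 ^ (m - Suc i) * ([:0, 1:] ^ d) ^ i)"
      by (rule power_diff_sumr2)
    thus ?thesis by (simp add: xp_def m power_mult)
  qed
  have "L dvd xp n"
    unfolding L_def by (rule Lcm_fin_least) (auto simp: A_def xp_dvd finA)
  then obtain Phi where Phi: "xp n = L * Phi" by (elim dvdE)
  have deg_x: "Polynomial.degree ([:0, 1:] ^ n :: int poly) = n"
    by (subst degree_power_eq) auto
  have deg_xp: "Polynomial.degree (xp n) = n"
  proof -
    have "Polynomial.degree (- 1 + [:0, 1:] ^ n :: int poly) = n"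
      using n deg_x by (subst degree_add_eq_right) auto
    thus ?thesis by (simp add: xp_def)
  qed
  have lc_xp: "Polynomial.lead_coeff (xp n) = 1"
  proof -
    have "Polynomial.coeff ([:0, 1:] ^ n :: int poly) n = 1"
      using lead_coeff_power[of "[:0, 1::int:]" n] unfolding deg_x by simp
    thus ?thesis unfolding deg_xp unfolding xp_def using n by simp
  qed
  define c :: "int poly \<Rightarrow> complex poly" where "c = map_poly of_int"
  have c_pCons: "c (pCons a p) = pCons (of_int a) (c p)" for a p
    unfolding c_def by (simp add: map_poly_pCons)
  have c_0: "c 0 = 0" and c_1: "c 1 = 1" unfolding c_def by simp_all
  have c_add: "c (p + r) = c p + c r" for p r unfolding c_def by (rule poly_eqI) (simp add: coeff_map_poly)
  have c_diff: "c (p - r) = c p - c r" for p r unfolding c_def by (rule poly_eqI) (simp add: coeff_map_poly)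
  have c_smult: "c (Polynomial.smult a p) = Polynomial.smult (of_int a) (c p)" for a p
    unfolding c_def by (rule poly_eqI) (simp add: coeff_map_poly)
  have c_mult: "c (p * r) = c p * c r" for p r
    by (induction p) (simp_all add: c_0 c_pCons c_add c_smult)
  have c_xp: "c (xp d) = [:0, 1:] ^ d - 1" for d
  proof -
    have "c ([:0, 1:] ^ d) = [:0, 1:] ^ d"
      by (induction d) (simp_all only: power_0 power_Suc c_1 c_mult, simp add: c_pCons c_0)
    thus ?thesis unfolding xp_def by (simp add: c_diff c_1)
  qed
  have c_degree: "Polynomial.degree (c p) = Polynomial.degree p" for p
    unfolding c_def by (rule degree_map_poly) simp
  have c_coeff: "Polynomial.coeff (c p) i = of_int (Polynomial.coeff p i)" for p i
    unfolding c_def by (simp add: coeff_map_poly)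
  have poly_c: "poly (c p) (of_int a) = of_int (poly p a)" for p a
    by (induction p) (simp_all add: c_0 c_pCons)
  have poly_cxp: "poly (c (xp d)) z = z ^ d - 1" for d z
    by (simp add: c_xp)
  have lc: "Polynomial.lead_coeff L * Polynomial.lead_coeff Phi = 1"
    using lc_xp unfolding Phi lead_coeff_mult .
  have lcPhi: "norm (Polynomial.lead_coeff (c Phi)) = 1"
  proof -
    have "\<bar>Polynomial.lead_coeff Phi\<bar> = 1"
      by (rule abs_zmult_eq_1[of _ "Polynomial.lead_coeff L"]) (metis lc mult.commute abs_1)
    hence "\<bar>real_of_int (Polynomial.lead_coeff Phi)\<bar> = 1" by (metis of_int_abs of_int_1)
    thus ?thesis by (simp only: c_degree c_coeff norm_of_int)
  qed
  hence cPhi0: "c Phi \<noteq> 0" by auto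
  \<comment> \<open>A primitive n-th root of unity is a root of x^n - 1 but of no
    \<open>xp d\<close> with d in A, hence not of L, which divides their product. So Phi is not
    constant.\<close>
  have "\<exists>z. poly (c Phi) z = 0"
  proof -
    define z where "z = cis (2 * pi / n)"
    have zn: "z ^ n = 1" using n by (simp add: z_def DeMoivre)
    have "poly (c L) z \<noteq> 0"
    proof
      assume *: "poly (c L) z = 0"
      have "L dvd (\<Prod>d\<in>A. xp d)"
        unfolding L_def by (rule Lcm_fin_least) (auto simp: finA)
      then obtain r where r: "(\<Prod>d\<in>A. xp d) = L * r" by (elim dvdE)
      have "c (\<Prod>d\<in>A. xp d) = (\<Prod>d\<in>A. c (xp d))"
        using finA by (induction rule: finite_induct) (simp_all add: c_1 c_mult)
      hence "(\<Prod>d\<in>A. poly (c (xp d)) z) = 0"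
        using arg_cong[OF r, of "\<lambda>p. poly (c p) z"] * by (simp add: c_mult poly_prod)
      then obtain d where d: "d \<in> A" "z ^ d = 1" using finA by (auto simp: poly_cxp)
      have "0 < d" "d < n" using d n by (auto simp: A_def intro!: Nat.gr0I)
      have "cis (2 * pi * d / n) = 1" using d(2) by (simp add: z_def DeMoivre mult_ac)
      hence "cos (2 * pi * d / n) = 1" by (simp add: complex_eq_iff)
      then obtain k :: int where k: "2 * pi * d / n = real_of_int k * 2 * pi"
        using iffD1[OF cos_one_2pi_int] by blast
      hence "real d = k * real n" using n by (simp add: field_simps)
      hence "int d = k * int n" by (metis of_int_eq_iff of_int_mult of_int_of_nat_eq)
      hence "int n dvd int d" by simp
      thus False using \<open>0 < d\<close> \<open>d < n\<close> by (simp add: nat_dvd_not_less)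
    qed
    moreover have "poly (c (xp n)) z = 0" by (simp add: poly_cxp zn)
    ultimately show ?thesis unfolding Phi c_mult by auto
  qed
  hence degPhi: "Polynomial.degree (c Phi) > 0"
    using cPhi0 by (auto elim!: degree_eq_zeroE intro!: gr0I)
  have roots: "norm (of_int q - z) > of_int q - 1" if z: "poly (c Phi) z = 0" for z
  proof -
    have "z ^ n = 1" using z poly_cxp[of n z] unfolding Phi c_mult by simp
    hence nz: "norm z = 1" using n power_eq_imp_eq_base[of "norm z" n 1] by (simp add: norm_power[symmetric])
    \<comment> \<open>Since \<open>xp 1\<close> divides L, a root 1 of Phi would be a double root of
      x^n - 1, whose derivative at 1 is n.\<close>
    have "z \<noteq> 1"
    proof
      assume z1: "z = 1"
      have "1 \<in> A" using n by (auto simp: A_def)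
      then obtain r where r: "L = xp 1 * r" using xp_dvd_L by blast
      have eq: "c (xp n) = c (xp 1) * (c r * c Phi)" unfolding Phi r c_mult by (simp add: mult_ac)
      have "poly (pderiv (c (xp n))) 1 = 0"
        unfolding eq pderiv_mult using z z1 by (simp add: poly_cxp)
      moreover have "pderiv (c (xp n)) = of_nat n * [:0, 1:] ^ (n - 1)"
        by (simp add: c_xp pderiv_diff pderiv_power pderiv_pCons of_nat_poly)
      ultimately show False using n by simp
    qed
    have "Re z < 1"
    proof (rule ccontr)
      assume "\<not> Re z < 1"
      hence "Re z = 1" using complex_Re_le_cmod[of z] nz by simp
      moreover have "(Re z)\<^sup>2 + (Im z)\<^sup>2 = 1" using cmod_power2[of z] nz by simp
      ultimately have "z = 1" by (intro complex_eqI) auto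
      thus False using \<open>z \<noteq> 1\<close> by simp
    qed
    hence "of_int q - 1 < Re (of_int q - z)" by simp
    thus ?thesis using complex_Re_le_cmod[of "of_int q - z"] by linarith
  qed
  define P where "P = poly Phi q"
  have P_c: "poly (c Phi) (of_int q) = of_int P"
    unfolding P_def by (rule poly_c)
  have "norm (poly (c Phi) (of_int q)) > of_int q - 1"
  proof -
    obtain S where S: "c Phi = Polynomial.smult (Polynomial.lead_coeff (c Phi)) (\<Prod>z\<in>#S. [:-z, 1:])" "size S = Polynomial.degree (c Phi)"
      using alg_closed_imp_factorization[OF cPhi0] by blast
    have Sr: "poly (c Phi) z = 0" if "z \<in># S" for z
      using that by (subst S(1)) (auto simp: poly_prod_mset prod_mset_zero_iff)
    have "norm (poly (c Phi) (of_int q)) = (\<Prod>z\<in>#S. norm (of_int q - z))"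
      by (subst S(1)) (simp add: norm_mult lcPhi poly_prod_mset image_mset.compositionality comp_def, induction S, auto simp: norm_mult)
    moreover have "S \<noteq> {#}" using S(2) degPhi by auto
    moreover have "(\<Prod>z\<in>#T. norm (of_int q - z)) \<ge> 1 \<and> (T \<noteq> {#} \<longrightarrow> (\<Prod>z\<in>#T. norm (of_int q - z)) > of_int q - 1)"
      if "set_mset T \<subseteq> set_mset S" for T
      using that
    proof (induction T)
      case (add z T)
      have 1: "norm (of_int q - z) > of_int q - 1" using add.prems by (intro roots Sr) auto
      have 2: "(\<Prod>z\<in>#T. norm (of_int q - z)) \<ge> 1" using add by simp
      have "norm (of_int q - z) * 1 \<le> norm (of_int q - z) * (\<Prod>z\<in>#T. norm (of_int q - z))"
        by (rule mult_left_mono[OF 2]) simp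
      moreover have "(of_int q :: real) \<ge> 2" using q by simp
      ultimately show ?case using 1 2 by (simp)
    qed simp
    ultimately show ?thesis by (metis subset_refl)
  qed
  hence "real_of_int \<bar>P\<bar> > real_of_int (q - 1)" unfolding P_c by simp
  hence 1: "\<bar>P\<bar> > q - 1" by (simp only: of_int_less_iff)
  have ev: "poly (xp d) q = q ^ d - 1" for d unfolding xp_def by simp
  have 2: "P * (q ^ d - 1) dvd q ^ n - 1" if d: "d dvd n" "d < n" for d
  proof -
    have "xp d dvd L" using xp_dvd_L[of d] d unfolding A_def by blast
    then obtain r where r: "L = xp d * r" by (elim dvdE)
    have "q ^ n - 1 = poly (xp n) q" by (simp add: ev)
    also have "\<dots> = P * (q ^ d - 1) * poly r q" unfolding Phi r by (simp add: ev P_def)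
    finally show ?thesis by simp
  qed
  have "P dvd q ^ n - 1" unfolding ev[symmetric] Phi P_def by simp
  with 1 2 show ?thesis by blast
qed

text \<open>The unit e is a parameter because the division rings of interest are corners e B e,
  whose unit differs from that of B. The locale also serves centralizers and prime fields.\<close>

locale division_subring =
  fixes D :: "'b::{ring, monoid_mult} set" and e :: 'b
  assumes one_mem: "e \<in> D"
    and diff_mem: "x \<in> D \<Longrightarrow> y \<in> D \<Longrightarrow> x - y \<in> D"
    and mult_mem: "x \<in> D \<Longrightarrow> y \<in> D \<Longrightarrow> x * y \<in> D"
    and one_mult: "x \<in> D \<Longrightarrow> e * x = x"
    and mult_one: "x \<in> D \<Longrightarrow> x * e = x"
    and one_neq_0: "e \<noteq> 0"
    and inverse_ex: "x \<in> D \<Longrightarrow> x \<noteq> 0 \<Longrightarrow> \<exists>y\<in>D. y * x = e \<and> x * y = e"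
begin

lemma zero_mem: "0 \<in> D" using diff_mem[OF one_mem one_mem] by simp
lemma uminus_mem: "x \<in> D \<Longrightarrow> - x \<in> D" using diff_mem[OF zero_mem, of x] by simp
lemma add_mem: "x \<in> D \<Longrightarrow> y \<in> D \<Longrightarrow> x + y \<in> D" using diff_mem[OF _ uminus_mem, of x y] by simp

lemma mult_eq_0: "x \<in> D \<Longrightarrow> y \<in> D \<Longrightarrow> x * y = 0 \<Longrightarrow> x = 0 \<or> y = 0"
  by (metis inverse_ex mult.assoc mult_zero_right one_mult)

text \<open>A submodule N other than M grows by some x outside it; n + c * x determines n and c,
  since otherwise an invertible difference would put x into N. Each step multiplies the size by
  \<open>card D\<close>.\<close>

lemma card_module_eq_power:
  assumes "finite M" "finite D" "0 \<in> M"
    and diff: "\<And>x y. x \<in> M \<Longrightarrow> y \<in> M \<Longrightarrow> x - y \<in> M"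
    and smult: "\<And>c x. c \<in> D \<Longrightarrow> x \<in> M \<Longrightarrow> c * x \<in> M"
    and unit: "\<And>x. x \<in> M \<Longrightarrow> e * x = x"
  shows "\<exists>m. card M = card D ^ m"
proof -
  have "\<exists>m. card M = card D ^ m"
    if "N \<subseteq> M" "0 \<in> N" "\<And>x y. x \<in> N \<Longrightarrow> y \<in> N \<Longrightarrow> x - y \<in> N"
      "\<And>c x. c \<in> D \<Longrightarrow> x \<in> N \<Longrightarrow> c * x \<in> N" "card N = card D ^ k" for N k
    using that
  proof (induction "card (M - N)" arbitrary: N k rule: less_induct)
    case less
    show ?case
    proof (cases "N = M")
      case True
      with less.prems show ?thesis by blast
    next
      case False
      then obtain x where x: "x \<in> M" "x \<notin> N" using less.prems by blast
      define g where "g = (\<lambda>(n, c). n + c * x)"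
      define N' where "N' = g ` (N \<times> D)"
      have inj: "inj_on g (N \<times> D)"
      proof (rule inj_onI, clarsimp simp: g_def)
        fix n c n' c' assume a: "n \<in> N" "c \<in> D" "n' \<in> N" "c' \<in> D" "n + c * x = n' + c' * x"
        have eq: "(c - c') * x = n' - n" using a(5) by (simp add: algebra_simps)
        have "c = c'"
        proof (rule ccontr)
          assume "c \<noteq> c'"
          then obtain y where y: "y \<in> D" "y * (c - c') = e"
            using inverse_ex[of "c - c'"] diff_mem a by auto
          have "y * (n' - n) = x" unfolding eq[symmetric] mult.assoc[symmetric] y(2) using unit x by simp
          thus False using less.prems(3,4) a y x by metis
        qed
        thus "n = n' \<and> c = c'" using a by simp
      qed
      have N'M: "N' \<subseteq> M"
      proof -
        have add: "a + b \<in> M" if "a \<in> M" "b \<in> M" for a b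
          using diff[OF that(1) diff[OF \<open>0 \<in> M\<close> that(2)]] by simp
        show ?thesis using less.prems(1) x smult add by (auto simp: N'_def g_def)
      qed
      have "x \<in> N'" unfolding N'_def
        using x one_mem less.prems(2) unit by (intro image_eqI[of _ _ "(0, e)"]) (auto simp: g_def)
      moreover have NN': "N \<subseteq> N'" unfolding N'_def
        using zero_mem by (force simp: g_def image_iff)
      ultimately have "card (M - N') < card (M - N)"
        using x N'M \<open>finite M\<close> by (intro psubset_card_mono) auto
      moreover have "card N' = card D ^ Suc k"
        unfolding N'_def card_image[OF inj] by (simp add: card_cartesian_product less.prems(5))
      moreover have "a - b \<in> N'" if ab: "a \<in> N'" "b \<in> N'" for a b
      proof -
        obtain n c n' c' where "n \<in> N" "c \<in> D" "n' \<in> N" "c' \<in> D" "a = n + c * x" "b = n' + c' * x"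
          using ab by (auto simp: N'_def g_def)
        thus ?thesis unfolding N'_def
          using less.prems(3) diff_mem by (intro image_eqI[of _ _ "(n - n', c - c')"]) (auto simp: g_def algebra_simps)
      qed
      moreover have "d * a \<in> N'" if ad: "a \<in> N'" "d \<in> D" for a d
      proof -
        obtain n c where "n \<in> N" "c \<in> D" "a = n + c * x"
          using ad by (auto simp: N'_def g_def)
        thus ?thesis unfolding N'_def
          using less.prems(4) mult_mem that by (intro image_eqI[of _ _ "(d * n, d * c)"]) (auto simp: g_def algebra_simps)
      qed
      ultimately show ?thesis
        using less.hyps[of N' "Suc k"] N'M NN' less.prems(2) by blast
    qed
  qed
  from this[of "{0}" 0] show ?thesis using \<open>0 \<in> M\<close> by auto
qed

lemma card_ge_2: "finite D \<Longrightarrow> card D \<ge> 2"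
  using card_mono[of D "{0, e}"] zero_mem one_mem one_neq_0 by auto

definition centralizer :: "'b set \<Rightarrow> 'b set" where
  "centralizer T = {y \<in> D. \<forall>x\<in>T. x * y = y * x}"

lemma division_subring_centralizer:
  assumes T: "T \<subseteq> D"
  shows "division_subring (centralizer T) e"
proof
  show "e \<in> centralizer T" using T one_mem one_mult mult_one by (auto simp: centralizer_def)
  fix y z assume "y \<in> centralizer T" "z \<in> centralizer T"
  hence yz: "y \<in> D" "z \<in> D" "\<And>x. x \<in> T \<Longrightarrow> x * y = y * x" "\<And>x. x \<in> T \<Longrightarrow> x * z = z * x"
    unfolding centralizer_def by blast+
  have "x * (y * z) = y * z * x" "x * (y - z) = (y - z) * x" if "x \<in> T" for x
    using yz(3,4)[OF that] by (metis mult.assoc, simp only: right_diff_distrib left_diff_distrib)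
  thus "y - z \<in> centralizer T" "y * z \<in> centralizer T"
    unfolding centralizer_def using yz(1,2) diff_mem mult_mem by blast+
next
  fix y assume "y \<in> centralizer T" "y \<noteq> 0"
  hence y: "y \<in> D" "\<And>x. x \<in> T \<Longrightarrow> x * y = y * x" "y \<noteq> 0" unfolding centralizer_def by blast+
  then obtain w where w: "w \<in> D" "w * y = e" "y * w = e" using inverse_ex by blast
  have "x * w = w * x" if x: "x \<in> T" for x
  proof -
    have xD: "x \<in> D" using x T by blast
    have "x * w = (w * y) * x * w" using w xD by (simp add: one_mult)
    also have "\<dots> = w * (y * x) * w" by (simp only: mult.assoc)
    also have "\<dots> = w * (x * y) * w" by (simp only: y(2)[OF x])
    also have "\<dots> = w * x * (y * w)" by (simp only: mult.assoc)
    also have "\<dots> = w * x" using w xD by (simp add: mult_one mult_mem)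
    finally show ?thesis .
  qed
  thus "\<exists>w\<in>centralizer T. w * y = e \<and> y * w = e" using w unfolding centralizer_def by blast
qed (use one_mult mult_one one_neq_0 in \<open>auto simp: centralizer_def\<close>)

text \<open>Witt's proof by the class equation. A conjugacy class outside the centre has (q^n - 1) /
  (q^d - 1) elements with d a proper divisor of n, hence a size divisible by P. Then P divides q^n -
  q as well as q^n - 1, thus q - 1, which is too small.\<close>

theorem wedderburn_little:
  assumes fin: "finite D" and "x \<in> D" "y \<in> D"
  shows "x * y = y * x"
proof -
  define Z where "Z = centralizer D"
  define C where "C = (\<lambda>x. centralizer {x})"
  have Z_eq: "Z = {z \<in> D. \<forall>y\<in>D. z * y = y * z}" unfolding Z_def centralizer_def by (intro Collect_cong) metis
  have C_eq: "C = (\<lambda>x. {y \<in> D. x * y = y * x})" by (simp add: C_def centralizer_def)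
  interpret Z: division_subring Z e unfolding Z_def by (rule division_subring_centralizer) simp
  have finZ: "finite Z" using fin by (simp add: Z_eq)
  have finC: "finite (C x)" for x using fin by (simp add: C_eq)
  define q where "q = card Z"
  have q: "q \<ge> 2" unfolding q_def using Z.card_ge_2 finZ by simp
  have "\<exists>n. card D = card Z ^ n"
    by (rule Z.card_module_eq_power[OF fin finZ zero_mem]) (simp_all add: diff_mem mult_mem one_mult, simp add: Z_eq mult_mem)
  then obtain n where n: "card D = q ^ n" by (auto simp: q_def)
  show ?thesis
  proof (cases "n \<ge> 2")
    case False
    have "n \<noteq> 0" using n card_ge_2[OF fin] by (intro notI) simp
    hence "card D = card Z" using False n q_def by (simp add: not_le less_Suc_eq numeral_2_eq_2)
    hence "Z = D" using fin by (intro card_subset_eq) (auto simp: Z_eq)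
    thus ?thesis using assms by (auto simp: Z_eq)
  next
    case True
    obtain P :: int where P: "\<bar>P\<bar> > int q - 1" "P dvd int q ^ n - 1"
      "\<And>d. d dvd n \<Longrightarrow> d < n \<Longrightarrow> P * (int q ^ d - 1) dvd int q ^ n - 1"
      using common_divisor_of_cyclotomic_quotients[of "int q" n] q True by auto
    define cl where "cl = (\<lambda>x. {z \<in> D. \<exists>u\<in>D. u \<noteq> 0 \<and> z * u = u * x})"
    have dvd_cl: "P dvd int (card (cl x))" if x: "x \<in> D - Z" for x
    proof -
      interpret C: division_subring "C x" e unfolding C_def by (rule division_subring_centralizer) (use x in simp)
      have CD: "y \<in> D" if "y \<in> C x" for y using that by (simp add: C_eq)
      have ZC: "y \<in> C x" if "y \<in> Z" for y using that x by (simp add: C_eq Z_eq)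
      have "\<exists>d. card (C x) = card Z ^ d"
        by (rule Z.card_module_eq_power[OF finC finZ C.zero_mem]) (simp_all add: C.diff_mem C.mult_mem ZC C.one_mult)
      then obtain d where d: "card (C x) = q ^ d" by (auto simp: q_def)
      have "\<exists>r. card D = card (C x) ^ r"
        by (rule C.card_module_eq_power[OF fin finC zero_mem]) (simp_all add: diff_mem mult_mem CD one_mult)
      then obtain r where r: "card D = card (C x) ^ r" by blast
      have "q ^ n = q ^ (d * r)" using n r d by (simp add: power_mult)
      hence "n = d * r" using q by simp
      hence dn: "d dvd n" by simp
      have "C x \<noteq> D" using x by (auto simp: C_eq Z_eq)
      hence "card (C x) < card D" using fin by (intro psubset_card_mono) (auto simp: C_eq)
      hence "d < n" using d n q by simp
      obtain iv where iv: "\<And>u. u \<in> D - {0} \<Longrightarrow> iv u \<in> D \<and> iv u * u = e \<and> u * iv u = e"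
        using inverse_ex by (metis Diff_iff singletonI)
      define h where "h = (\<lambda>u. u * x * iv u)"
      have hx: "h u \<in> D" "h u * u = u * x" if "u \<in> D - {0}" for u
        using iv[OF that] that x by (auto simp: h_def mult.assoc mult_mem mult_one)
      have img: "h ` (D - {0}) = cl x"
      proof (intro equalityI subsetI)
        fix z assume "z \<in> h ` (D - {0})"
        thus "z \<in> cl x" using hx by (auto simp: cl_def)
      next
        fix z assume "z \<in> cl x"
        then obtain u where u: "z \<in> D" "u \<in> D - {0}" "z * u = u * x" by (auto simp: cl_def)
        have "h u = z * u * iv u" by (simp add: h_def u(3))
        also have "\<dots> = z * (u * iv u)" by (rule mult.assoc)
        also have "\<dots> = z" using iv[OF u(2)] u by (simp add: mult_one)
        finally show "z \<in> h ` (D - {0})" using u by blast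
      qed
      \<comment> \<open>The fibre of h through u is the coset u C(x) without 0; counting the nonzero
        elements fibrewise gives the orbit formula.\<close>
      have fib: "card {v \<in> D - {0}. h v = h u} = card (C x - {0})" if u: "u \<in> D - {0}" for u
      proof -
        have "bij_betw (\<lambda>c. u * c) (C x - {0}) {v \<in> D - {0}. h v = h u}"
        proof (rule bij_betwI[where g = "\<lambda>v. iv u * v"])
          show "(\<lambda>c. u * c) \<in> C x - {0} \<rightarrow> {v \<in> D - {0}. h v = h u}"
          proof
            fix c assume c: "c \<in> C x - {0}"
            have uc: "u * c \<in> D - {0}" using c u mult_mem mult_eq_0 by (auto simp: C_eq)
            have "h (u * c) * (u * c) = u * c * x" using hx(2)[OF uc] .
            also have "\<dots> = u * (x * c)" using c by (simp add: C_eq mult.assoc)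
            also have "\<dots> = h u * (u * c)" by (simp only: mult.assoc[symmetric] hx(2)[OF u])
            finally have "(h (u * c) - h u) * (u * c) = 0" by (simp add: algebra_simps)
            hence "h (u * c) - h u = 0 \<or> u * c = 0" using uc hx u by (intro mult_eq_0) (auto simp: diff_mem)
            thus "u * c \<in> {v \<in> D - {0}. h v = h u}" using uc by auto
          qed
          show "(\<lambda>v. iv u * v) \<in> {v \<in> D - {0}. h v = h u} \<rightarrow> C x - {0}"
          proof
            fix v assume v: "v \<in> {v \<in> D - {0}. h v = h u}"
            have "x * (iv u * v) = iv u * (u * x) * (iv u * v)"
              using iv[OF u] x by (simp add: mult.assoc[symmetric] one_mult)
            also have "\<dots> = iv u * (h u * (u * (iv u * v)))"
              using hx(2)[OF u] by (simp add: mult.assoc[symmetric])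
            also have "u * (iv u * v) = v" using iv[OF u] v by (simp add: mult.assoc[symmetric] one_mult)
            also have "iv u * (h u * v) = iv u * v * x" using hx(2)[of v] v by (simp add: mult.assoc)
            finally have "x * (iv u * v) = iv u * v * x" .
            moreover have "iv u \<noteq> 0" using iv[OF u] one_neq_0 by auto
            hence "iv u * v \<noteq> 0" using mult_eq_0[of "iv u" v] iv[OF u] v by auto
            ultimately show "iv u * v \<in> C x - {0}"
              using iv[OF u] v by (simp add: C_eq mult_mem)
          qed
        next
          fix c assume "c \<in> C x - {0}"
          thus "iv u * (u * c) = c" using iv[OF u] CD by (simp add: mult.assoc[symmetric] one_mult)
        next
          fix v assume "v \<in> {v \<in> D - {0}. h v = h u}"
          thus "u * (iv u * v) = v" using iv[OF u] by (simp add: mult.assoc[symmetric] one_mult)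
        qed
        thus ?thesis by (simp add: bij_betw_same_card)
      qed
      have "card (D - {0}) = (\<Sum>z\<in>h ` (D - {0}). \<Sum>v | v \<in> D - {0} \<and> h v = z. 1)"
        using sum.image_gen[of "D - {0}" "\<lambda>_. 1::nat" h] fin by simp
      also have "\<dots> = (\<Sum>z\<in>h ` (D - {0}). card (C x - {0}))"
      proof (rule sum.cong)
        fix z assume "z \<in> h ` (D - {0})"
        thus "(\<Sum>v | v \<in> D - {0} \<and> h v = z. 1) = card (C x - {0})" using fib by auto
      qed simp
      also have "\<dots> = card (cl x) * card (C x - {0})" by (simp add: img)
      finally have eq: "card D - 1 = card (cl x) * (card (C x) - 1)"
        using fin finC zero_mem C.zero_mem by simp
      have "int q ^ n - 1 = int (card (cl x)) * (int q ^ d - 1)"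
      proof -
        have "card D \<ge> 1" "card (C x) \<ge> 1" using card_ge_2[OF fin] C.card_ge_2[OF finC] by auto
        hence "int (card D) - 1 = int (card (cl x)) * (int (card (C x)) - 1)"
          using eq by (metis of_nat_1 of_nat_diff of_nat_mult)
        thus ?thesis using n d by simp
      qed
      hence "P * (int q ^ d - 1) dvd int (card (cl x)) * (int q ^ d - 1)"
        using P(3)[OF dn \<open>d < n\<close>] by simp
      moreover have "int q ^ d - 1 \<noteq> 0"
      proof -
        have "int 2 \<le> int (q ^ d)" using C.card_ge_2[OF finC] d by (intro of_nat_mono) simp
        thus ?thesis by simp
      qed
      ultimately show ?thesis by simp
    qed
    have cl_refl: "x \<in> cl x" if "x \<in> D" for x
      using that one_mem one_neq_0 by (auto simp: cl_def one_mult mult_one)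
    have cl_sym: "x \<in> cl y" if y: "y \<in> cl x" and x: "x \<in> D" for x y
    proof -
      obtain u where u: "y \<in> D" "u \<in> D" "u \<noteq> 0" "y * u = u * x" using y by (auto simp: cl_def)
      obtain w where w: "w \<in> D" "w * u = e" "u * w = e" using inverse_ex u by blast
      have "x * w = (w * u) * x * w" using w x by (simp add: one_mult)
      also have "\<dots> = w * (u * x) * w" by (simp add: mult.assoc)
      also have "\<dots> = w * (y * u) * w" by (simp only: u(4))
      also have "\<dots> = w * (y * (u * w))" by (simp only: mult.assoc)
      also have "\<dots> = w * y" using w u by (simp add: mult_one)
      finally have "x * w = w * y" .
      moreover have "w \<noteq> 0" using w one_neq_0 by auto
      ultimately show ?thesis using w x by (auto simp: cl_def)
    qed
    have cl_trans: "z \<in> cl x" if "y \<in> cl x" "z \<in> cl y" for x y z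
    proof -
      obtain u where u: "u \<in> D" "u \<noteq> 0" "y * u = u * x" using \<open>y \<in> cl x\<close> by (auto simp: cl_def)
      obtain v where v: "z \<in> D" "v \<in> D" "v \<noteq> 0" "z * v = v * y" using \<open>z \<in> cl y\<close> by (auto simp: cl_def)
      have "z * (v * u) = (v * u) * x" using v u by (metis mult.assoc)
      moreover have "v * u \<in> D" "v * u \<noteq> 0" using v u mult_mem mult_eq_0 by auto
      ultimately show ?thesis using v by (auto simp: cl_def)
    qed
    have cl_eq: "cl y = cl x" if y: "y \<in> cl x" and x: "x \<in> D" for x y
      using cl_trans[OF y] cl_trans[OF cl_sym[OF y x]] by blast
    have cl_Z: "cl x \<subseteq> D - Z" if x: "x \<in> D - Z" for x
    proof
      fix y assume y: "y \<in> cl x"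
      hence yD: "y \<in> D" by (simp add: cl_def)
      moreover have "y \<notin> Z"
      proof
        assume yZ: "y \<in> Z"
        have "x \<in> cl y" using cl_sym[OF y] x by blast
        then obtain u where u: "u \<in> D" "u \<noteq> 0" "x * u = u * y" by (auto simp: cl_def)
        hence "(x - y) * u = 0" using yZ by (auto simp: algebra_simps Z_eq)
        hence "x = y" using mult_eq_0[of "x - y" u] u x yD diff_mem by auto
        thus False using yZ x by simp
      qed
      ultimately show "y \<in> D - Z" by simp
    qed
    have "int (card (D - Z)) = (\<Sum>c\<in>cl ` (D - Z). \<Sum>x | x \<in> D - Z \<and> cl x = c. 1)"
      using sum.image_gen[of "D - Z" "\<lambda>_. 1::int" cl] fin by simp
    also have "\<dots> = (\<Sum>c\<in>cl ` (D - Z). int (card c))"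
    proof (rule sum.cong)
      fix c assume "c \<in> cl ` (D - Z)"
      then obtain x where x: "x \<in> D - Z" "c = cl x" by blast
      have "{y. y \<in> D - Z \<and> cl y = c} = c"
      proof (intro equalityI subsetI)
        fix y assume "y \<in> {y. y \<in> D - Z \<and> cl y = c}"
        thus "y \<in> c" using cl_refl[of y] by blast
      next
        fix y assume "y \<in> c"
        thus "y \<in> {y. y \<in> D - Z \<and> cl y = c}" using cl_eq[of y x] cl_Z[OF x(1)] x by blast
      qed
      thus "(\<Sum>x | x \<in> D - Z \<and> cl x = c. 1) = int (card c)" by simp
    qed simp
    finally have "P dvd int (card (D - Z))"
      using dvd_cl by (auto intro!: dvd_sum)
    moreover have "int (card (D - Z)) = int q ^ n - int q"
    proof -
      have "Z \<subseteq> D" by (auto simp: Z_eq)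
      hence "card (D - Z) = card D - card Z" "card Z \<le> card D"
        using fin finZ by (auto intro: card_Diff_subset card_mono)
      thus ?thesis using n q_def by (simp add: of_nat_diff)
    qed
    ultimately have "P dvd (int q ^ n - 1) - (int q ^ n - int q)" using P(2) by (metis dvd_diff)
    hence "P dvd int q - 1" by simp
    hence "\<bar>P\<bar> \<le> int q - 1" using q by (intro zdvd_imp_le) simp_all
    thus ?thesis using P(1) by simp
  qed
qed

end

section \<open>Frobenius and finite division rings\<close>

lemma power_card_eq_same:
  fixes x :: "'f::{field, finite}"
  shows "x ^ CARD('f) = x"
proof (cases "x = 0")
  case False
  have "(\<Prod>y\<in>UNIV - {0}. x * y) = (\<Prod>y\<in>UNIV - {0}. y)"
    by (rule prod.reindex_bij_witness[of _ "\<lambda>y. y / x" "\<lambda>y. x * y"]) (use False in auto)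
  hence "x ^ (CARD('f) - 1) * \<Prod>(UNIV - {0}) = \<Prod>(UNIV - {0})"
    by (simp add: prod.distrib)
  hence "x ^ (CARD('f) - 1) = 1" by simp
  moreover have "CARD('f) = Suc (CARD('f) - 1)" using finite_UNIV_card_ge_0[where ?'a = 'f] by simp
  ultimately show ?thesis by (metis power_Suc mult.right_neutral)
qed simp

lemma prime_CHAR_finite: "prime CHAR('f::{field, finite})"
  by (rule prime_CHAR_semidom) (simp add: finite_imp_CHAR_pos)

text \<open>The image of the naturals is the prime field, and the whole field is a module over
  it.\<close>

lemma card_eq_CHAR_power: "\<exists>n. CARD('f::{field, finite}) = CHAR('f) ^ n"
proof -
  define D where "D = range (of_nat :: nat \<Rightarrow> 'f)"
  have p: "CHAR('f) > 0" using prime_CHAR_finite prime_gt_0_nat by blast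
  have mult: "x * y \<in> D" if "x \<in> D" "y \<in> D" for x y
    using that unfolding D_def by (auto simp flip: of_nat_mult)
  have "division_subring D 1"
  proof
    fix x y assume xy: "x \<in> D" "y \<in> D"
    show "x * y \<in> D" using mult xy .
    obtain a b where ab: "x = of_nat a" "y = of_nat b" using xy unfolding D_def by blast
    have "of_nat (CHAR('f) - 1) = (-1 :: 'f)" using p by (simp add: of_nat_diff)
    hence "x - y = of_nat (a + (CHAR('f) - 1) * b)" by (simp add: ab)
    thus "x - y \<in> D" unfolding D_def by blast
  next
    show "1 \<in> D" unfolding D_def by (metis of_nat_1 rangeI)
    fix x assume x: "x \<in> D" "x \<noteq> 0"
    have "inj_on (\<lambda>y. y * x) D" using x(2) by (auto intro: inj_onI)
    moreover have "(\<lambda>y. y * x) ` D \<subseteq> D" using mult x(1) by blast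
    ultimately have "(\<lambda>y. y * x) ` D = D" by (intro endo_inj_surj) simp_all
    moreover have "1 \<in> D" unfolding D_def by (metis of_nat_1 rangeI)
    ultimately obtain y where "y \<in> D" "y * x = 1" by (metis imageE)
    thus "\<exists>y\<in>D. y * x = 1 \<and> x * y = 1" by (auto simp: mult.commute)
  qed auto
  then interpret division_subring D 1 .
  have "card D = CHAR('f)"
  proof -
    have "D = of_nat ` {..<CHAR('f)}"
    proof (intro equalityI subsetI)
      fix x assume "x \<in> D"
      then obtain a where a: "x = of_nat a" unfolding D_def by blast
      have "(of_nat a :: 'f) = of_nat (a div CHAR('f) * CHAR('f) + a mod CHAR('f))" by (simp only: div_mult_mod_eq)
      also have "\<dots> = of_nat (a mod CHAR('f))" by (simp only: of_nat_add of_nat_mult of_nat_CHAR) simp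
      finally have "x = of_nat (a mod CHAR('f))" by (simp add: a)
      thus "x \<in> of_nat ` {..<CHAR('f)}" using p by auto
    qed (auto simp: D_def)
    moreover have "inj_on (of_nat :: nat \<Rightarrow> 'f) {..<CHAR('f)}"
    proof (rule linorder_inj_onI')
      fix a b assume ab: "a \<in> {..<CHAR('f)}" "b \<in> {..<CHAR('f)}" "a < b"
      show "of_nat a \<noteq> (of_nat b :: 'f)"
      proof
        assume "of_nat a = (of_nat b :: 'f)"
        hence "of_nat (b - a) = (0 :: 'f)" using ab by (simp add: of_nat_diff)
        hence "CHAR('f) dvd b - a" by (simp only: of_nat_eq_0_iff_char_dvd)
        thus False using ab by (auto dest: dvd_imp_le)
      qed
    qed
    ultimately show ?thesis by (simp add: card_image)
  qed
  moreover have "\<exists>m. card (UNIV :: 'f set) = card D ^ m"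
    by (rule card_module_eq_power) simp_all
  ultimately show ?thesis by simp
qed

lemma frobenius_sum:
  fixes g :: "'a \<Rightarrow> 'f::{field, finite} alg_closure"
  shows "sum g A ^ CARD('f) = (\<Sum>a\<in>A. g a ^ CARD('f))"
proof -
  obtain n where "CARD('f) = CHAR('f alg_closure) ^ n" using card_eq_CHAR_power[where ?'f = 'f] by auto
  thus ?thesis using prime_CHAR_finite[where ?'f = 'f] by (intro freshmans_dream_sum') simp_all
qed

lemma frobenius_add:
  fixes x y :: "'f::{field, finite} alg_closure"
  shows "(x + y) ^ CARD('f) = x ^ CARD('f) + y ^ CARD('f)"
  using frobenius_sum[of "\<lambda>b. if b then x else y" UNIV] by (simp add: UNIV_bool add.commute)

lemma frobenius_eq_0_iff [simp]:
  fixes x :: "'f::{field, finite} alg_closure"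
  shows "x ^ CARD('f) = 0 \<longleftrightarrow> x = 0"
  by (simp add: zero_less_card_finite)

lemma frobenius_inj:
  fixes x y :: "'f::{field, finite} alg_closure"
  assumes "x ^ CARD('f) = y ^ CARD('f)"
  shows "x = y"
proof -
  have "x ^ CARD('f) = (x - y) ^ CARD('f) + y ^ CARD('f)" by (simp flip: frobenius_add)
  thus ?thesis using assms by simp
qed

lemma frobenius_surj: "\<exists>y. y ^ CARD('f::{field, finite}) = (x :: 'f alg_closure)"
  by (rule nth_root_exists) simp

lemma frobenius_to_ac: "to_ac (c :: 'f::{field, finite}) ^ CARD('f) = to_ac c"
  by (metis power_card_eq_same to_ac_power)

text \<open>x^q - x has at most q roots, and the q elements of the embedded finite field are already
  roots.\<close>

lemma frobenius_fixed_imp_to_ac: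
  fixes x :: "'f::{field, finite} alg_closure"
  assumes "x ^ CARD('f) = x"
  shows "\<exists>c. x = to_ac c"
proof -
  define p :: "'f alg_closure poly" where "p = [:0, 1:] ^ CARD('f) - [:0, 1:]"
  have q: "CARD('f) \<ge> 2"
    using card_mono[of UNIV "{0, 1 :: 'f}"] by simp
  have "Polynomial.degree ([:0, 1:] ^ CARD('f) :: 'f alg_closure poly) = CARD('f)"
    by (subst degree_power_eq) auto
  hence deg: "Polynomial.degree p = CARD('f)"
    unfolding p_def diff_conv_add_uminus using q by (subst degree_add_eq_left) auto
  hence p0: "p \<noteq> 0" using q by auto
  have roots: "{x. poly p x = 0} = {x. x ^ CARD('f) = x}" by (simp add: p_def)
  have "card {x :: 'f alg_closure. x ^ CARD('f) = x} \<le> CARD('f)"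
    using card_poly_roots_bound[OF p0] deg roots by simp
  moreover have "card (range (to_ac :: 'f \<Rightarrow> _)) = CARD('f)" by (rule card_image) (rule inj_to_ac)
  moreover have "range (to_ac :: 'f \<Rightarrow> _) \<subseteq> {x. x ^ CARD('f) = x}" using frobenius_to_ac by blast
  moreover have "finite {x :: 'f alg_closure. x ^ CARD('f) = x}" using poly_roots_finite[OF p0] roots by simp
  ultimately have "range (to_ac :: 'f \<Rightarrow> _) = {x. x ^ CARD('f) = x}"
    by (intro card_seteq) simp_all
  thus ?thesis using assms by blast
qed

text \<open>
  A nonzero element of minimal degree in the annihilator of a functional \<open>s\<close> has a root \<open>\<zeta>\<close>, and
  the complementary factor maps \<open>s\<close> to an eigenfunctional for \<open>\<zeta>\<close>.
\<close>

lemma eigenfunctional: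
  fixes s :: "'b \<Rightarrow> 'k::alg_closed_field" and t :: "'b \<Rightarrow> 'b"
  assumes period: "\<And>m. m \<in> D \<Longrightarrow> (t ^^ N) m = m" "N > 0" and t: "\<And>m. m \<in> D \<Longrightarrow> t m \<in> D"
    and m0: "m0 \<in> D" "s m0 \<noteq> 0"
  shows "\<exists>c n z. (\<forall>m\<in>D. (\<Sum>i\<le>n. c i * s ((t ^^ i) (t m))) = z * (\<Sum>i\<le>n. c i * s ((t ^^ i) m))) \<and>
    (\<exists>m\<in>D. (\<Sum>i\<le>n::nat. c i * s ((t ^^ i) m)) \<noteq> 0)"
proof -
  \<comment> \<open>\<open>Lam p\<close> is the action of p on s when x acts on functions by
    composition with t; so multiplying p by x amounts to applying t to the argument.\<close>
  define Lam where "Lam = (\<lambda>(p :: 'k poly) m. \<Sum>i\<le>Polynomial.degree p. Polynomial.coeff p i * s ((t ^^ i) m))"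
  have Lam: "Lam p m = (\<Sum>i\<le>n. Polynomial.coeff p i * s ((t ^^ i) m))" if "Polynomial.degree p \<le> n" for p n m
    unfolding Lam_def by (rule sum.mono_neutral_left) (use that in \<open>auto simp: coeff_eq_0\<close>)
  define A where "A = (\<lambda>p. p \<noteq> 0 \<and> (\<forall>m\<in>D. Lam p m = 0))"
  define p0 :: "'k poly" where "p0 = Polynomial.monom 1 N - 1"
  have "A p0"
  proof -
    have "Polynomial.coeff p0 N = 1" using period(2) by (simp add: p0_def)
    hence "p0 \<noteq> 0" by auto
    moreover have "Lam p0 m = 0" if m: "m \<in> D" for m
    proof -
      have "Polynomial.degree p0 \<le> N"
        unfolding p0_def by (rule degree_diff_le) (simp_all add: degree_monom_le)
      hence "Lam p0 m = (\<Sum>i\<le>N. Polynomial.coeff p0 i * s ((t ^^ i) m))" by (rule Lam)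
      also have "\<dots> = (\<Sum>i\<le>N. (if i = N then s ((t ^^ N) m) else 0) - (if i = 0 then s m else 0))"
        by (rule sum.cong) (use period(2) in \<open>auto simp: p0_def\<close>)
      also have "\<dots> = 0" using period(1)[OF m] by (simp add: sum_subtractf)
      finally show ?thesis .
    qed
    ultimately show ?thesis by (simp add: A_def)
  qed
  then obtain p where p: "A p" and min: "\<And>r. A r \<Longrightarrow> Polynomial.degree p \<le> Polynomial.degree r"
    using ex_has_least_nat[of A p0 Polynomial.degree] by blast
  have "Polynomial.degree p > 0"
  proof (rule ccontr)
    assume "\<not> Polynomial.degree p > 0"
    then obtain a where a: "p = [:a:]" using degree_eq_zeroE by blast
    have "Lam p m0 = a * s m0" by (simp add: a Lam_def)
    thus False using p m0 a by (auto simp: A_def)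
  qed
  then obtain z where "poly p z = 0" using alg_closed_imp_poly_has_root by blast
  then obtain r where r: "p = [:- z, 1:] * r" by (auto simp: poly_eq_0_iff_dvd elim: dvdE)
  have r0: "r \<noteq> 0" using p r by (auto simp: A_def)
  define n where "n = Polynomial.degree r"
  have deg: "Polynomial.degree p = Suc n" using r0 unfolding r n_def by (subst degree_mult_eq) auto
  have "\<not> A r" using min[of r] deg by (auto simp: n_def)
  then obtain m1 where m1: "m1 \<in> D" "Lam r m1 \<noteq> 0" using r0 by (auto simp: A_def)
  have eigen: "Lam r (t m) = z * Lam r m" if m: "m \<in> D" for m
  proof -
    have "0 = Lam p m" using p m by (simp add: A_def)
    also have "\<dots> = (\<Sum>i\<le>Suc n. Polynomial.coeff p i * s ((t ^^ i) m))" by (rule Lam) (simp add: deg)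
    also have "\<dots> = (\<Sum>i\<le>Suc n. Polynomial.coeff (pCons 0 r) i * s ((t ^^ i) m)) - z * (\<Sum>i\<le>Suc n. Polynomial.coeff r i * s ((t ^^ i) m))"
      unfolding sum_distrib_left sum_subtractf[symmetric]
      by (rule sum.cong) (simp_all add: r algebra_simps)
    also have "(\<Sum>i\<le>Suc n. Polynomial.coeff (pCons 0 r) i * s ((t ^^ i) m)) = (\<Sum>i\<le>n. Polynomial.coeff r i * s ((t ^^ Suc i) m))"
      by (simp only: sum.atMost_Suc_shift coeff_pCons_0 coeff_pCons_Suc) simp
    also have "\<dots> = Lam r (t m)"
      unfolding Lam_def n_def by (intro sum.cong) (simp_all add: funpow_swap1)
    also have "(\<Sum>i\<le>Suc n. Polynomial.coeff r i * s ((t ^^ i) m)) = Lam r m"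
      by (rule Lam[symmetric]) (simp add: n_def)
    finally show ?thesis by simp
  qed
  show ?thesis
    using eigen m1 unfolding Lam_def n_def[symmetric] by (intro exI[of _ "Polynomial.coeff r"] exI[of _ n] exI[of _ z]) blast
qed

section \<open>Embeddings of finite division rings into the algebraic closure\<close>

context division_subring begin

text \<open>Wedderburn's theorem makes D a field, so its multiplicative group is cyclic. Powers are
  written as iterated multiplication applied to e, since the power notation of B would start from 1
  instead of e.\<close>

lemma cyclic_generator:
  assumes fin: "finite D"
  obtains g where "g \<in> D" "g \<noteq> 0" "\<And>x. x \<in> D \<Longrightarrow> x \<noteq> 0 \<Longrightarrow> \<exists>i. x = (((*) g) ^^ i) e"
proof -
  have comm: "x * y = y * x" if "x \<in> D" "y \<in> D" for x y using wedderburn_little[OF fin that] .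
  define R :: "'b ring" where "R = \<lparr>carrier = D, monoid.mult = (*), one = e, ring.zero = 0, add = (+)\<rparr>"
  have "cring R"
  proof (rule cringI)
    show "abelian_group R"
    proof (rule abelian_groupI)
      fix x assume "x \<in> carrier R"
      thus "\<exists>y\<in>carrier R. y \<oplus>\<^bsub>R\<^esub> x = \<zero>\<^bsub>R\<^esub>"
        by (intro bexI[of _ "- x"]) (simp_all add: R_def uminus_mem)
    qed (simp_all add: R_def add_mem zero_mem add.assoc add.commute)
    show "comm_monoid R"
      by (rule comm_monoidI) (simp_all add: R_def mult_mem one_mem one_mult mult_one mult.assoc comm)
  qed (simp add: R_def distrib_right)
  then interpret cring R .
  interpret R: field R
  proof (rule cring_fieldI2)
    show "\<zero>\<^bsub>R\<^esub> \<noteq> \<one>\<^bsub>R\<^esub>" using one_neq_0 by (simp add: R_def)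
    fix a assume "a \<in> carrier R" "a \<noteq> \<zero>\<^bsub>R\<^esub>"
    thus "\<exists>b\<in>carrier R. a \<otimes>\<^bsub>R\<^esub> b = \<one>\<^bsub>R\<^esub>"
      using inverse_ex[of a] by (simp add: R_def) blast
  qed
  have car: "carrier (Multiplicative_Group.mult_of R) = D - {0}"
    unfolding Multiplicative_Group.carrier_mult_of by (simp add: R_def)
  have "finite (carrier R)" using fin by (simp add: R_def)
  from R.finite_field_mult_group_has_gen[OF this, unfolded car]
  obtain g where g: "g \<in> D - {0}" "D - {0} = {g [^]\<^bsub>R\<^esub> i | i::nat. i \<in> UNIV}" by blast
  have pow: "(((*) g) ^^ i) e \<in> D \<and> g [^]\<^bsub>R\<^esub> i = (((*) g) ^^ i) e" for i :: nat
  proof (induction i)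
    case 0
    show ?case by (simp add: one_mem) (simp add: R_def)
  next
    case (Suc i)
    have "g [^]\<^bsub>R\<^esub> Suc i = (g [^]\<^bsub>R\<^esub> i) * g" by (simp add: R_def)
    also have "\<dots> = g * (((*) g) ^^ i) e" using Suc comm[of g "(((*) g) ^^ i) e"] g(1) by simp
    finally show ?case using Suc g(1) by (simp add: mult_mem)
  qed
  have gen: "\<exists>i. x = (((*) g) ^^ i) e" if "x \<in> D" "x \<noteq> 0" for x
  proof -
    have "x \<in> {g [^]\<^bsub>R\<^esub> i | i::nat. i \<in> UNIV}" using that unfolding g(2)[symmetric] by simp
    then obtain i :: nat where "x = g [^]\<^bsub>R\<^esub> i" by blast
    thus ?thesis using pow[of i] by auto
  qed
  show ?thesis by (rule that[of g]) (use g(1) gen in simp_all)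
qed

text \<open>An eigenfunctional \<nu> for multiplication by a generator g satisfies \<nu>(x m)
  \<nu>(e) = \<nu>(x) \<nu>(m), because every nonzero x is a power of g. Dividing by \<nu>(e) yields
  a homomorphism, F_q-linear by construction.\<close>

lemma embedding_into_alg_closure:
  fixes scale :: "'f::{field, finite} \<Rightarrow> 'b \<Rightarrow> 'b"
  assumes fin: "finite D" and alg: "fd_algebra scale"
  shows "\<exists>\<alpha> :: 'b \<Rightarrow> 'f alg_closure. \<alpha> e = 1 \<and> (\<forall>x\<in>D. \<forall>y\<in>D. \<alpha> (x + y) = \<alpha> x + \<alpha> y \<and> \<alpha> (x * y) = \<alpha> x * \<alpha> y) \<and>
    (\<forall>c. \<forall>x\<in>D. \<alpha> (scale c x) = to_ac c * \<alpha> x)"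
proof -
  interpret fd_algebra scale by fact
  obtain g where g: "g \<in> D" "g \<noteq> 0" "\<And>x. x \<in> D \<Longrightarrow> x \<noteq> 0 \<Longrightarrow> \<exists>i. x = (((*) g) ^^ i) e"
  proof (rule cyclic_generator[OF fin])
    fix h assume "h \<in> D" "h \<noteq> 0" "\<And>x. x \<in> D \<Longrightarrow> x \<noteq> 0 \<Longrightarrow> \<exists>i. x = (((*) h) ^^ i) e"
    thus thesis by (rule that)
  qed
  have pow_mem: "(((*) g) ^^ i) m \<in> D" if "m \<in> D" for i m
    using that by (induction i) (auto simp: mult_mem g)
  have pow_mult: "(((*) g) ^^ i) (m * x) = (((*) g) ^^ i) m * x" for i m x
    by (induction i) (simp_all add: mult.assoc)
  obtain y where y: "y \<in> D" "g * y = e" using inverse_ex g by blast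
  hence "y \<noteq> 0" using one_neq_0 by auto
  then obtain i where i: "y = (((*) g) ^^ i) e" using g y by blast
  have "(((*) g) ^^ Suc i) m = m" if "m \<in> D" for m
    using pow_mult[of "Suc i" e m] y that by (simp add: i[symmetric] one_mult)
  note period = this
  \<comment> \<open>The starting functional is the coordinate at e in an F_q-basis containing e, so
    it is nonzero on D.\<close>
  have indep: "independent {e}" using one_neq_0 by simp
  define B where "B = extend_basis {e}"
  have B: "independent B" "span B = UNIV" "e \<in> B"
    using independent_extend_basis[OF indep] span_extend_basis[OF indep] extend_basis_superset[OF indep]
    by (auto simp: B_def)
  define s :: "'b \<Rightarrow> 'f alg_closure" where "s = (\<lambda>b. to_ac (representation B b e))"
  have s_add: "s (x + y) = s x + s y" for x y
    using B by (simp add: s_def representation_add)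
  have s_scale: "s (scale c x) = to_ac c * s x" for c x
    using B by (simp add: s_def representation_scale)
  have s_e: "s e \<noteq> 0" using B by (simp add: s_def representation_basis)
  have "\<exists>c n z. (\<forall>m\<in>D. (\<Sum>i\<le>n. c i * s ((((*) g) ^^ i) (g * m))) = z * (\<Sum>i\<le>n. c i * s ((((*) g) ^^ i) m))) \<and>
    (\<exists>m\<in>D. (\<Sum>i\<le>n::nat. c i * s ((((*) g) ^^ i) m)) \<noteq> 0)"
    by (rule eigenfunctional[where N = "Suc i", OF period]) (use g(1) mult_mem one_mem s_e in auto)
  then obtain c n z m1 where ev: "\<forall>m\<in>D. (\<Sum>i\<le>n. c i * s ((((*) g) ^^ i) (g * m))) = z * (\<Sum>i\<le>n. c i * s ((((*) g) ^^ i) m))"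
    and m1: "m1 \<in> D" "(\<Sum>i\<le>n::nat. c i * s ((((*) g) ^^ i) m1)) \<noteq> 0" by blast
  define \<nu> where "\<nu> = (\<lambda>m. \<Sum>i\<le>n. c i * s ((((*) g) ^^ i) m))"
  have \<nu>_g: "\<nu> (g * m) = z * \<nu> m" if "m \<in> D" for m using bspec[OF ev that] by (simp add: \<nu>_def)
  have pow_add: "(((*) g) ^^ i) (x + y) = (((*) g) ^^ i) x + (((*) g) ^^ i) y" for i x y
    by (induction i) (simp_all add: distrib_left)
  have pow_scale: "(((*) g) ^^ i) (scale a x) = scale a ((((*) g) ^^ i) x)" for i a x
    by (induction i) (simp_all add: scale_mult_right)
  have \<nu>_add: "\<nu> (x + y) = \<nu> x + \<nu> y" for x y
    by (simp add: \<nu>_def pow_add s_add distrib_left sum.distrib)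
  have \<nu>_scale: "\<nu> (scale a x) = to_ac a * \<nu> x" for a x
    by (simp add: \<nu>_def pow_scale s_scale sum_distrib_left mult_ac)
  have \<nu>_0: "\<nu> 0 = 0" using \<nu>_scale[of 0 0] by simp
  have \<nu>_pow: "\<nu> ((((*) g) ^^ i) m) = z ^ i * \<nu> m" if "m \<in> D" for i m
    using that by (induction i) (simp_all add: \<nu>_g pow_mem)
  have \<nu>_mult: "\<nu> (x * m) * \<nu> e = \<nu> x * \<nu> m" if x: "x \<in> D" and m: "m \<in> D" for x m
  proof (cases "x = 0")
    case False
    then obtain i where i: "x = (((*) g) ^^ i) e" using g x by blast
    have "x * m = (((*) g) ^^ i) m" using pow_mult[of i e m] m by (simp add: i one_mult)
    thus ?thesis using \<nu>_pow[OF m, of i] \<nu>_pow[OF one_mem, of i] by (simp add: i)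
  qed (simp add: \<nu>_0)
  have "\<nu> e \<noteq> 0"
  proof
    assume "\<nu> e = 0"
    have "m1 \<noteq> 0" using m1 \<nu>_0 by (auto simp: \<nu>_def)
    then obtain i where "m1 = (((*) g) ^^ i) e" using g m1 by blast
    hence "\<nu> m1 = 0" using \<nu>_pow[OF one_mem, of i] \<open>\<nu> e = 0\<close> by simp
    thus False using m1 by (simp add: \<nu>_def)
  qed
  show ?thesis
  proof (intro exI[of _ "\<lambda>x. \<nu> x / \<nu> e"] conjI ballI allI)
    show "\<nu> (x * y) / \<nu> e = \<nu> x / \<nu> e * (\<nu> y / \<nu> e)" if "x \<in> D" "y \<in> D" for x y
      using \<nu>_mult[OF that] \<open>\<nu> e \<noteq> 0\<close> by (simp add: field_simps)
  qed (use \<open>\<nu> e \<noteq> 0\<close> in \<open>simp_all add: \<nu>_add \<nu>_scale add_divide_distrib\<close>)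
qed

end

section \<open>Basic hereditary algebras\<close>

lemma finite_fd_algebra:
  fixes scale :: "'f::{field, finite} \<Rightarrow> 'b::{ring, monoid_mult} \<Rightarrow> 'b"
  assumes "fd_algebra scale"
  shows "finite (UNIV :: 'b set)"
proof -
  interpret fd_algebra scale by fact
  obtain S where S: "finite S" "span S = UNIV" using finite_dim by blast
  have "finite (PiE S (\<lambda>_. UNIV :: 'f set))" using S(1) by (intro finite_PiE) auto
  moreover have "UNIV \<subseteq> (\<lambda>u. \<Sum>v\<in>S. scale (u v) v) ` PiE S (\<lambda>_. UNIV :: 'f set)"
  proof
    fix x :: 'b
    obtain u where u: "x = (\<Sum>v\<in>S. scale (u v) v)"
      using span_finite[OF S(1)] S(2) by blast
    have "x = (\<Sum>v\<in>S. scale (restrict u S v) v)" unfolding u by (intro sum.cong) auto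
    thus "x \<in> (\<lambda>u. \<Sum>v\<in>S. scale (u v) v) ` PiE S (\<lambda>_. UNIV :: 'f set)"
      by (intro image_eqI[of _ _ "restrict u S"]) simp_all
  qed
  ultimately show ?thesis by (meson finite_imageI finite_subset)
qed

lemma lookup_free_scale: "Poly_Mapping.lookup (free_scale r f) b = r * Poly_Mapping.lookup f b"
  by (simp add: free_scale_def Poly_Mapping.map.rep_eq when_def)

text \<open>One half of the dual basis lemma, for a prescribed finite generating set L. Rewriting
  the image under p of each basis vector in terms of L turns the splitting i into coordinates
  indexed by L.\<close>

lemma projective_dual_basis:
  fixes I :: "'b::{ring, monoid_mult} set"
  assumes proj: "projective_left_ideal I" and fin: "finite (UNIV :: 'b set)" and L: "finite L" "L \<subseteq> I"
    and gen: "\<And>x. x \<in> I \<Longrightarrow> \<exists>r. x = (\<Sum>l\<in>L. r l * l)"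
  obtains g where "\<And>l x y. x \<in> I \<Longrightarrow> y \<in> I \<Longrightarrow> g l (x + y) = g l x + g l y"
    and "\<And>l r x. x \<in> I \<Longrightarrow> g l (r * x) = r * g l x"
    and "\<And>x. x \<in> I \<Longrightarrow> x = (\<Sum>l\<in>L. g l x * l)"
proof -
  obtain i :: "'b \<Rightarrow> ('b \<Rightarrow>\<^sub>0 'b)" and p :: "('b \<Rightarrow>\<^sub>0 'b) \<Rightarrow> 'b" where
    i: "left_linear_on I (*) free_scale i" and p: "left_linear_on UNIV free_scale (*) p"
    and rp: "range p \<subseteq> I" and pi: "\<And>x. x \<in> I \<Longrightarrow> p (i x) = x"
    using proj unfolding projective_left_ideal_def by blast
  have p_add: "p (x + y) = p x + p y" and p_scale: "p (free_scale r x) = r * p x" for r x y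
    using p unfolding left_linear_on_def by auto
  have p_0: "p 0 = 0" using p_add[of 0 0] by simp
  have p_sum: "p (sum h A) = (\<Sum>a\<in>A. p (h a))" for h :: "'b \<Rightarrow> ('b \<Rightarrow>\<^sub>0 'b)" and A
    by (induction A rule: infinite_finite_induct) (simp_all add: p_0 p_add)
  have "\<forall>b. \<exists>r. p (Poly_Mapping.single b 1) = (\<Sum>l\<in>L. r l * l)" using gen rp by blast
  then obtain c where c: "\<And>b. p (Poly_Mapping.single b 1) = (\<Sum>l\<in>L. c b l * l)" by metis
  have expand: "f = (\<Sum>b\<in>UNIV. free_scale (Poly_Mapping.lookup f b) (Poly_Mapping.single b 1))" for f :: "'b \<Rightarrow>\<^sub>0 'b"
  proof (rule poly_mapping_eqI)
    fix k
    have "Poly_Mapping.lookup (\<Sum>b\<in>UNIV. free_scale (Poly_Mapping.lookup f b) (Poly_Mapping.single b 1)) k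
        = (\<Sum>b\<in>UNIV. if b = k then Poly_Mapping.lookup f k else 0)"
      unfolding Poly_Mapping.lookup_sum
      by (intro sum.cong) (auto simp: lookup_free_scale lookup_single when_def)
    thus "Poly_Mapping.lookup f k = Poly_Mapping.lookup (\<Sum>b\<in>UNIV. free_scale (Poly_Mapping.lookup f b) (Poly_Mapping.single b 1)) k"
      using fin by simp
  qed
  define g where "g = (\<lambda>l x. \<Sum>b\<in>UNIV. Poly_Mapping.lookup (i x) b * c b l)"
  show ?thesis
  proof
    show "g l (x + y) = g l x + g l y" if "x \<in> I" "y \<in> I" for l x y
      using i that unfolding left_linear_on_def g_def by (simp add: lookup_add distrib_right sum.distrib)
    show "g l (r * x) = r * g l x" if "x \<in> I" for l r x
      using i that unfolding left_linear_on_def g_def by (simp add: lookup_free_scale sum_distrib_left mult.assoc)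
    show "x = (\<Sum>l\<in>L. g l x * l)" if "x \<in> I" for x
    proof -
      have "x = p (\<Sum>b\<in>UNIV. free_scale (Poly_Mapping.lookup (i x) b) (Poly_Mapping.single b 1))"
        using pi[OF that] expand[of "i x"] by simp
      also have "\<dots> = (\<Sum>b\<in>UNIV. \<Sum>l\<in>L. Poly_Mapping.lookup (i x) b * (c b l * l))"
        by (simp only: p_sum p_scale c sum_distrib_left)
      also have "\<dots> = (\<Sum>l\<in>L. g l x * l)"
        unfolding g_def by (subst sum.swap) (simp add: sum_distrib_right mult.assoc)
      finally show ?thesis .
    qed
  qed
qed

text \<open>Right multiplication by x maps B e onto B x. As B x is projective this map splits, and
  as e is primitive B e is indecomposable, so the map is injective. The idempotent \<open>a'\<close>
  is the composite of the map with its splitting, seen as an element of e B e.\<close>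

lemma hereditary_primitive_mult_eq_0:
  fixes e x y :: "'b::{ring, monoid_mult}"
  assumes her: "hereditary TYPE('b)" and fin: "finite (UNIV :: 'b set)" and e: "primitive_idempotent e"
    and x: "x \<noteq> 0" "e * x = x" and y: "y * e = y" "y * x = 0"
  shows "y = 0"
proof -
  define I where "I = range (\<lambda>r. r * x)"
  have "left_ideal I"
    unfolding left_ideal_def I_def
  proof (intro conjI ballI allI)
    show "0 \<in> range (\<lambda>r. r * x)" using rangeI[of "\<lambda>r. r * x" 0] by simp
    show "u + v \<in> range (\<lambda>r. r * x)" if "u \<in> range (\<lambda>r. r * x)" "v \<in> range (\<lambda>r. r * x)" for u v
      using that by (auto simp: distrib_right[symmetric])
    show "r * u \<in> range (\<lambda>r. r * x)" if "u \<in> range (\<lambda>r. r * x)" for u r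
      using that by (auto simp: mult.assoc[symmetric])
  qed
  hence proj: "projective_left_ideal I" using her unfolding hereditary_def by blast
  have xI: "x \<in> I" unfolding I_def using rangeI[of "\<lambda>r. r * x" 1] by simp
  have gen: "\<exists>r. z = (\<Sum>l\<in>{x}. r l * l)" if z: "z \<in> I" for z
  proof -
    obtain r where "z = r * x" using z unfolding I_def by blast
    thus ?thesis by (intro exI[of _ "\<lambda>_. r"]) simp
  qed
  obtain g where g: "\<And>l u v. u \<in> I \<Longrightarrow> v \<in> I \<Longrightarrow> g l (u + v) = g l u + g l v"
    "\<And>l r u. u \<in> I \<Longrightarrow> g l (r * u) = r * g l u" "\<And>u. u \<in> I \<Longrightarrow> u = (\<Sum>l\<in>{x}. g l u * l)"
    by (rule projective_dual_basis[OF proj fin, of "{x}"]) (use xI gen in auto)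
  define a where "a = g x x"
  have ax: "a * x = x" using g(3)[OF xI] by (simp add: a_def)
  have ea: "e * a = a" using g(2)[OF xI, of x e] x by (simp add: a_def)
  have aa: "a * a = a" using g(2)[OF xI, of x a] ax by (simp add: a_def)
  define a' where "a' = a * e"
  have ee: "e * e = e" using e by (simp add: primitive_idempotent_def idempotent_def)
  have 1: "e * a' = a'" "a' * e = a'" "a' * a' = a'"
  proof -
    show "e * a' = a'" by (simp add: a'_def mult.assoc[symmetric] ea)
    show "a' * e = a'" by (simp add: a'_def mult.assoc ee)
    have "a' * a' = a * (e * a) * e" by (simp add: a'_def mult.assoc)
    thus "a' * a' = a'" by (simp add: ea aa a'_def)
  qed
  have "idempotent a'" "idempotent (e - a')" "orthogonal a' (e - a')" "e = a' + (e - a')"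
    using 1 ee by (simp_all add: idempotent_def orthogonal_def algebra_simps)
  hence "a' = 0 \<or> e - a' = 0" using e unfolding primitive_idempotent_def by blast
  moreover have "a' \<noteq> 0"
  proof
    assume "a' = 0"
    hence "a * (e * x) = 0" by (simp add: a'_def mult.assoc[symmetric])
    thus False using x ax by simp
  qed
  ultimately have "e = a'" by simp
  have "g x (0 * x) = 0 * a" using g(2)[OF xI, of x 0] by (simp add: a_def)
  hence "y * a = 0" using g(2)[OF xI, of x y] y by (simp add: a_def)
  hence "y * a' = 0" by (simp add: a'_def mult.assoc[symmetric])
  thus ?thesis using y \<open>e = a'\<close> by simp
qed

section \<open>Corner rings, the order on the idempotents, and the radical\<close>

locale basic_hereditary_algebra = fd_algebra scale
  for scale :: "'f::{field, finite} \<Rightarrow> 'b::{ring, monoid_mult} \<Rightarrow> 'b" +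
  fixes E :: "'b set"
  assumes hereditary: "hereditary TYPE('b)"
    and complete: "complete_primitive_orthogonal E"
    and non_isomorphic: "e \<in> E \<Longrightarrow> f \<in> E \<Longrightarrow> e \<noteq> f \<Longrightarrow>
      \<not> left_ideals_isomorphic (principal_left_ideal e) (principal_left_ideal f)"
begin

lemma finite_UNIV: "finite (UNIV :: 'b set)"
  using finite_fd_algebra[OF fd_algebra_axioms] .

lemma finite_alg [simp]: "finite (A :: 'b set)"
  by (rule finite_subset[OF subset_UNIV finite_UNIV])

lemma primitive: "e \<in> E \<Longrightarrow> primitive_idempotent e"
  and sum_E: "\<Sum>E = 1"
  using complete unfolding complete_primitive_orthogonal_def by auto

lemma E_idem [simp]: "e \<in> E \<Longrightarrow> e * e = e"
  and E_nonzero: "e \<in> E \<Longrightarrow> e \<noteq> 0"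
  using primitive unfolding primitive_idempotent_def idempotent_def by auto

lemma E_orth: "e \<in> E \<Longrightarrow> f \<in> E \<Longrightarrow> e \<noteq> f \<Longrightarrow> e * f = 0"
  using complete unfolding complete_primitive_orthogonal_def orthogonal_def by auto

lemma E_mult: "e \<in> E \<Longrightarrow> f \<in> E \<Longrightarrow> e * f = (if e = f then e else 0)"
  using E_orth by auto

lemma E_idem_left [simp]: "e \<in> E \<Longrightarrow> e * (e * x) = e * x"
  by (simp add: mult.assoc[symmetric])

lemma E_orth_left: "e \<in> E \<Longrightarrow> f \<in> E \<Longrightarrow> e \<noteq> f \<Longrightarrow> e * (f * x) = 0"
  by (simp add: mult.assoc[symmetric] E_orth)

lemma sum_E_left: "(\<Sum>e\<in>E. e * b) = b"
  and sum_E_right: "(\<Sum>e\<in>E. b * e) = b"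
  using sum_E by (simp_all add: sum_distrib_left[symmetric] sum_distrib_right[symmetric])

lemma cancel:
  "e \<in> E \<Longrightarrow> x \<noteq> 0 \<Longrightarrow> e * x = x \<Longrightarrow> y * e = y \<Longrightarrow> y * x = 0 \<Longrightarrow> y = 0"
  using hereditary_primitive_mult_eq_0[OF hereditary finite_UNIV primitive] by blast

definition D :: "'b \<Rightarrow> 'b set" where "D e = {x. e * x = x \<and> x * e = x}"

lemma D_I: "e \<in> E \<Longrightarrow> e * x * e \<in> D e"
  by (simp add: D_def mult.assoc)

text \<open>By \<open>cancel\<close>, right multiplication by a nonzero x is injective on the finite
  set \<open>D e\<close>, hence onto, so x has a left inverse y. The left inverse of y is then x
  itself, so y is two-sided.\<close>

lemma D_division: 
  assumes e: "e \<in> E"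
  shows "division_subring (D e) e"
proof
  have left_inv: "\<exists>y\<in>D e. y * x = e" if x: "x \<in> D e" "x \<noteq> 0" for x
  proof -
    have "inj_on (\<lambda>y. y * x) (D e)"
    proof (rule inj_onI)
      fix y z assume yz: "y \<in> D e" "z \<in> D e" "y * x = z * x"
      have "(y - z) * e = y - z" "(y - z) * x = 0" using yz by (simp_all add: D_def left_diff_distrib)
      hence "y - z = 0" using cancel[OF e, of x "y - z"] x by (simp add: D_def)
      thus "y = z" by simp
    qed
    moreover have "(\<lambda>y. y * x) ` D e \<subseteq> D e" using x by (auto simp: D_def mult.assoc) (simp add: mult.assoc[symmetric])
    ultimately have "(\<lambda>y. y * x) ` D e = D e" by (intro endo_inj_surj) auto
    moreover have "e \<in> D e" using e by (simp add: D_def)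
    ultimately show ?thesis by (metis imageE)
  qed
  fix x assume x: "x \<in> D e" "x \<noteq> 0"
  then obtain y where y: "y \<in> D e" "y * x = e" using left_inv by blast
  hence "y \<noteq> 0" using E_nonzero[OF e] by auto
  then obtain z where z: "z \<in> D e" "z * y = e" using left_inv y by blast
  have "z = z * (y * x)" using y z by (simp add: D_def)
  also have "\<dots> = x" using z x by (simp add: mult.assoc[symmetric] D_def)
  finally show "\<exists>y\<in>D e. y * x = e \<and> x * y = e" using y z by blast
next
  fix x y assume "x \<in> D e" "y \<in> D e"
  thus "x * y \<in> D e" by (simp add: D_def mult.assoc) (simp add: mult.assoc[symmetric])
qed (use e E_nonzero in \<open>simp_all add: D_def left_diff_distrib right_diff_distrib\<close>)

lemma mult_nonzero: "f \<in> E \<Longrightarrow> x * f = x \<Longrightarrow> f * y = y \<Longrightarrow> x \<noteq> 0 \<Longrightarrow> y \<noteq> 0 \<Longrightarrow> x * y \<noteq> 0"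
  using cancel by blast

text \<open>If both were nonzero, y * x would be nonzero in \<open>D f\<close>, hence invertible
  there, and right multiplication by x would be an isomorphism from B e to B f.\<close>

lemma no_cycle:
  assumes "e \<in> E" "f \<in> E" "e \<noteq> f" and a: "e * a * f \<noteq> 0"
  shows "f * b * e = 0"
proof (rule ccontr)
  assume b: "f * b * e \<noteq> 0"
  define x where "x = e * a * f"
  define y where "y = f * b * e"
  have x: "e * x = x" "x * f = x" "x \<noteq> 0" and y: "f * y = y" "y * e = y" "y \<noteq> 0"
    using assms b by (simp_all add: x_def y_def mult.assoc)
  have yx: "y * x \<noteq> 0" "y * x \<in> D f" using mult_nonzero[of e y x] assms x y
    by (simp_all add: D_def mult.assoc) (simp add: mult.assoc[symmetric])
  then obtain z where z: "z \<in> D f" "z * (y * x) = f"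
    using division_subring.inverse_ex[OF D_division] assms by blast
  have "left_ideals_isomorphic (principal_left_ideal e) (principal_left_ideal f)"
    unfolding left_ideals_isomorphic_def
  proof (intro exI conjI)
    show "left_linear_on (principal_left_ideal e) (*) (*) (\<lambda>r. r * x)"
      unfolding left_linear_on_def by (simp add: distrib_right mult.assoc)
    show "bij_betw (\<lambda>r. r * x) (principal_left_ideal e) (principal_left_ideal f)"
      unfolding bij_betw_def
    proof
      show "inj_on (\<lambda>r. r * x) (principal_left_ideal e)"
      proof (rule inj_onI)
        fix u v assume uv: "u \<in> principal_left_ideal e" "v \<in> principal_left_ideal e" "u * x = v * x"
        have "u * e = u" "v * e = v" using uv assms by (auto simp: principal_left_ideal_def mult.assoc)
        hence "(u - v) * e = u - v" "(u - v) * x = 0" using uv by (simp_all add: left_diff_distrib)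
        hence "u - v = 0" using cancel[of e x "u - v"] assms x by blast
        thus "u = v" by simp
      qed
      show "(\<lambda>r. r * x) ` principal_left_ideal e = principal_left_ideal f"
      proof (intro equalityI subsetI)
        fix u assume "u \<in> (\<lambda>r. r * x) ` principal_left_ideal e"
        then obtain r where "u = r * e * x" by (auto simp: principal_left_ideal_def)
        hence "u = (r * e * x) * f" using x by (simp add: mult.assoc)
        thus "u \<in> principal_left_ideal f" by (auto simp: principal_left_ideal_def)
      next
        fix u assume "u \<in> principal_left_ideal f"
        then obtain r where "u = r * f" by (auto simp: principal_left_ideal_def)
        hence "u = (r * z * y * e) * x" using z y by (simp add: mult.assoc x)
        moreover have "r * z * y * e \<in> principal_left_ideal e" by (simp add: principal_left_ideal_def)
        ultimately show "u \<in> (\<lambda>r. r * x) ` principal_left_ideal e" by blast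
      qed
    qed
  qed
  thus False using non_isomorphic assms by blast
qed

text \<open>By \<open>mult_nonzero\<close> and \<open>no_cycle\<close>, non-vanishing of e B f
  defines a strict order on distinct idempotents; counting predecessors turns it into a numerical
  rank.\<close>

definition height :: "'b \<Rightarrow> nat" where
  "height f = card {e \<in> E. e \<noteq> f \<and> (\<exists>x. e * x * f \<noteq> 0)}"

lemma height_le: "height f \<le> card E"
  unfolding height_def by (intro card_mono) auto

lemma height_less:
  assumes e: "e \<in> E" and f: "f \<in> E" and ef: "e \<noteq> f" "e * x * f \<noteq> 0"
  shows "height e < height f"
  unfolding height_def
proof (intro psubset_card_mono psubsetI)
  show "{d \<in> E. d \<noteq> e \<and> (\<exists>x. d * x * e \<noteq> 0)} \<subseteq> {d \<in> E. d \<noteq> f \<and> (\<exists>x. d * x * f \<noteq> 0)}"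
  proof clarify
    fix d y assume d: "d \<in> E" "d \<noteq> e" "d * y * e \<noteq> 0"
    have "(d * y * e) * (e * x * f) \<noteq> 0"
      by (rule mult_nonzero[OF e]) (use d e ef in \<open>simp_all add: mult.assoc\<close>)
    hence "d * (y * e * x) * f \<noteq> 0" using e by (simp add: mult.assoc)
    moreover have "d \<noteq> f" using no_cycle[OF e f ef, of y] d by auto
    ultimately show "d \<noteq> f \<and> (\<exists>x. d * x * f \<noteq> 0)" by blast
  qed
  have "e \<in> {d \<in> E. d \<noteq> f \<and> (\<exists>x. d * x * f \<noteq> 0)}" using e ef by blast
  thus "{d \<in> E. d \<noteq> e \<and> (\<exists>x. d * x * e \<noteq> 0)} \<noteq> {d \<in> E. d \<noteq> f \<and> (\<exists>x. d * x * f \<noteq> 0)}" by blast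
qed simp

text \<open>The projection to the diagonal part S. Throughout, \<open>sd s = s\<close> expresses
  membership in S and \<open>sd b = 0\<close> membership in J.\<close>

definition sd :: "'b \<Rightarrow> 'b" where "sd b = (\<Sum>e\<in>E. e * b * e)"
definition jd :: "'b \<Rightarrow> 'b" where "jd b = b - sd b"

lemma sd_add: "sd (x + y) = sd x + sd y"
  by (simp add: sd_def distrib_left distrib_right sum.distrib)

lemma sd_diff: "sd (x - y) = sd x - sd y"
  by (simp add: sd_def left_diff_distrib right_diff_distrib sum_subtractf)

lemma sd_0 [simp]: "sd 0 = 0"
  by (simp add: sd_def)

lemma sd_sum: "sd (sum g A) = (\<Sum>a\<in>A. sd (g a))"
  by (induction A rule: infinite_finite_induct) (simp_all add: sd_add)

lemma sd_scale: "sd (scale c x) = scale c (sd x)"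
  by (simp add: sd_def scale_mult_left scale_mult_right scale_sum_right)

lemma E_sd: assumes "e \<in> E" shows "e * sd b = e * b * e"
proof -
  have "e * sd b = (\<Sum>f\<in>E. if f = e then e * b * e else 0)"
    unfolding sd_def sum_distrib_left
    using assms by (intro sum.cong) (auto simp: mult.assoc E_orth_left)
  thus ?thesis using assms by simp
qed

lemma sd_E: assumes "e \<in> E" shows "sd b * e = e * b * e"
proof -
  have "sd b * e = (\<Sum>f\<in>E. if f = e then e * b * e else 0)"
    unfolding sd_def sum_distrib_right
    using assms by (intro sum.cong) (auto simp: mult.assoc E_orth)
  thus ?thesis using assms by simp
qed

lemma sd_sd [simp]: "sd (sd b) = sd b"
  unfolding sd_def[of "sd b"] by (simp add: E_sd mult.assoc) (simp add: sd_def mult.assoc)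

lemma sd_1 [simp]: "sd 1 = 1"
  using sum_E by (simp add: sd_def)

text \<open>A cross term e x f y e with f different from e vanishes by \<open>no_cycle\<close>.
  Multiplicativity makes the kernel J a two-sided ideal.\<close>

lemma sd_mult: "sd (x * y) = sd x * sd y"
proof -
  have 1: "e * (x * y) * e = (e * x * e) * (e * y * e)" if e: "e \<in> E" for e
  proof -
    have "e * (x * y) * e = e * x * (\<Sum>f\<in>E. f * y) * e" by (simp add: sum_E_left mult.assoc)
    also have "\<dots> = (\<Sum>f\<in>E. (e * x * f) * (f * y * e))"
      unfolding sum_distrib_left sum_distrib_right by (intro sum.cong) (simp_all add: mult.assoc)
    also have "\<dots> = (\<Sum>f\<in>E. if f = e then (e * x * e) * (e * y * e) else 0)"
    proof (rule sum.cong)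
      fix f assume "f \<in> E"
      thus "e * x * f * (f * y * e) = (if f = e then (e * x * e) * (e * y * e) else 0)"
        using no_cycle[of e f x y] e by (cases "f = e"; cases "e * x * f = 0"; simp)
    qed simp
    finally show ?thesis using e by simp
  qed
  have "sd x * sd y = (\<Sum>e\<in>E. e * x * e * sd y)" by (simp add: sd_def[of x] sum_distrib_right)
  also have "\<dots> = (\<Sum>e\<in>E. (e * x * e) * (e * y * e))"
    by (intro sum.cong) (simp_all add: E_sd mult.assoc)
  also have "\<dots> = sd (x * y)" unfolding sd_def by (intro sum.cong) (simp_all add: 1)
  finally show ?thesis ..
qed

lemma sd_D: assumes "e \<in> E" "x \<in> D e" shows "sd x = x"
proof -
  have "sd x = (\<Sum>f\<in>E. if f = e then x else 0)"
    unfolding sd_def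
  proof (rule sum.cong)
    fix f assume f: "f \<in> E"
    have "f * x * f = f * (e * x * e) * f" using assms by (simp add: D_def)
    thus "f * x * f = (if f = e then x else 0)"
      using E_mult[OF f assms(1)] f assms by (auto simp: mult.assoc[symmetric] D_def)
  qed simp
  thus ?thesis using assms by simp
qed

lemma sd_jd [simp]: "sd (jd b) = 0" by (simp add: jd_def sd_diff)
lemma jd_add: "jd (x + y) = jd x + jd y" by (simp add: jd_def sd_add)
lemma jd_eq: "sd b = 0 \<Longrightarrow> jd b = b" by (simp add: jd_def)
lemma jd_sd: "sd b = b \<Longrightarrow> jd b = 0" by (simp add: jd_def)
lemma sd_plus_jd: "sd b + jd b = b" by (simp add: jd_def)

text \<open>A multiplicative decreasing filtration with J in \<open>filt 1\<close> that vanishes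
  beyond \<open>card E\<close>. It contains the powers of J, and an element is zero once it has been
  pushed into every \<open>filt t\<close>.\<close>

definition filt :: "nat \<Rightarrow> 'b set" where
  "filt t = {b. \<forall>e\<in>E. \<forall>f\<in>E. e * b * f \<noteq> 0 \<longrightarrow> height e + t \<le> height f}"

lemma filt_0: "b \<in> filt 0"
  unfolding filt_def
proof clarify
  fix e f assume "e \<in> E" "f \<in> E" "e * b * f \<noteq> 0"
  thus "height e + 0 \<le> height f" using height_less[of e f b] by (cases "e = f") simp_all
qed

lemma filt_1: assumes "sd b = 0" shows "b \<in> filt 1"
  unfolding filt_def
proof clarify
  fix e f assume ef: "e \<in> E" "f \<in> E" "e * b * f \<noteq> 0"
  have "e \<noteq> f" using E_sd[OF ef(1), of b] assms ef by auto
  thus "height e + 1 \<le> height f" using height_less[OF ef(1,2)] ef(3) by (simp add: Suc_le_eq)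
qed

lemma filt_add: "x \<in> filt t \<Longrightarrow> y \<in> filt t \<Longrightarrow> x + y \<in> filt t"
  unfolding filt_def
proof clarify
  fix e f
  assume *: "\<forall>e\<in>E. \<forall>f\<in>E. e * x * f \<noteq> 0 \<longrightarrow> height e + t \<le> height f"
    "\<forall>e\<in>E. \<forall>f\<in>E. e * y * f \<noteq> 0 \<longrightarrow> height e + t \<le> height f"
    and ef: "e \<in> E" "f \<in> E" "e * (x + y) * f \<noteq> 0"
  have "e * x * f \<noteq> 0 \<or> e * y * f \<noteq> 0" using ef(3) by (auto simp: distrib_left distrib_right)
  thus "height e + t \<le> height f" using * ef(1,2) by blast
qed

lemma filt_zero: "0 \<in> filt t" by (simp add: filt_def)

lemma filt_sum: "(\<And>a. a \<in> A \<Longrightarrow> g a \<in> filt t) \<Longrightarrow> sum g A \<in> filt t"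
  by (induction A rule: infinite_finite_induct) (auto simp: filt_zero filt_add)

lemma filt_mult: assumes "x \<in> filt s" "y \<in> filt t" shows "x * y \<in> filt (s + t)"
  unfolding filt_def
proof clarify
  fix e f assume ef: "e \<in> E" "f \<in> E" "e * (x * y) * f \<noteq> 0"
  have "e * (x * y) * f = e * x * (\<Sum>g\<in>E. g * y) * f" by (simp add: sum_E_left mult.assoc)
  also have "\<dots> = (\<Sum>g\<in>E. (e * x * g) * (g * y * f))"
    unfolding sum_distrib_left sum_distrib_right by (intro sum.cong) (simp_all add: mult.assoc)
  finally obtain g where g: "g \<in> E" "(e * x * g) * (g * y * f) \<noteq> 0"
    using ef(3) by (metis (no_types, lifting) sum.neutral)
  hence "e * x * g \<noteq> 0" "g * y * f \<noteq> 0" by auto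
  hence "height e + s \<le> height g" "height g + t \<le> height f" using assms ef g unfolding filt_def by blast+
  thus "height e + (s + t) \<le> height f" by simp
qed

lemma filt_eq_0: assumes "b \<in> filt t" "t > card E" shows "b = 0"
proof -
  have "e * b * f = 0" if ef: "e \<in> E" "f \<in> E" for e f
  proof (rule ccontr)
    assume "e * b * f \<noteq> 0"
    hence "height e + t \<le> height f" using assms(1) ef unfolding filt_def by blast
    thus False using assms(2) height_le[of f] by simp
  qed
  hence "(\<Sum>e\<in>E. \<Sum>f\<in>E. e * b * f) = 0" by simp
  thus ?thesis by (simp add: sum_E_right sum_E_left)
qed

end

section \<open>A complement of the square of the radical\<close>

context basic_hereditary_algebra begin

lemma D_sd: "e \<in> E \<Longrightarrow> sd x = x \<Longrightarrow> e * x \<in> D e"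
  using E_sd[of e x] sd_E[of e x] by (simp add: D_def mult.assoc)

lemma E_mem_D: "e \<in> E \<Longrightarrow> e \<in> D e"
  by (simp add: D_def)

lemma D_mult_eq_0:
  assumes "e \<in> E" "f \<in> E" "e \<noteq> f" "x \<in> D e" "y \<in> D f"
  shows "x * y = 0"
proof -
  have "x * y = (x * e) * (f * y)" using assms by (simp add: D_def)
  also have "\<dots> = x * (e * f) * y" by (simp add: mult.assoc)
  finally show ?thesis using E_orth[of e f] assms by simp
qed

lemma D_inter: "e \<in> E \<Longrightarrow> f \<in> E \<Longrightarrow> e \<noteq> f \<Longrightarrow> x \<in> D e \<Longrightarrow> x \<in> D f \<Longrightarrow> x = 0"
  using D_mult_eq_0[of e f e x] E_mem_D[of e] by (simp add: D_def)

text \<open>The units of the single fields e B e, a disjoint union. With several idempotents they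
  are not units of S, but they generate S additively (see \<open>sd_induct\<close>), and averages
  over them are S-linear.\<close>

definition U :: "'b set" where "U = (\<Union>e\<in>E. D e - {0})"

definition iv :: "'b \<Rightarrow> 'b" where
  "iv x = (SOME y. \<exists>e\<in>E. x \<in> D e \<and> y \<in> D e \<and> y * x = e \<and> x * y = e)"

lemma iv: 
  assumes e: "e \<in> E" and x: "x \<in> D e" "x \<noteq> 0"
  shows "iv x \<in> D e" "iv x * x = e" "x * iv x = e"
proof -
  have "\<exists>y. \<exists>e\<in>E. x \<in> D e \<and> y \<in> D e \<and> y * x = e \<and> x * y = e"
    using division_subring.inverse_ex[OF D_division[OF e] x] e x by blast
  from someI_ex[OF this] obtain f where f: "f \<in> E" "x \<in> D f" "iv x \<in> D f" "iv x * x = f" "x * iv x = f"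
    unfolding iv_def[symmetric] by blast
  have "f = e" using D_inter[OF e f(1)] f(2) x by blast
  thus "iv x \<in> D e" "iv x * x = e" "x * iv x = e" using f by auto
qed

lemma D_mult: "e \<in> E \<Longrightarrow> x \<in> D e \<Longrightarrow> y \<in> D e \<Longrightarrow> x * y \<in> D e"
  using division_subring.mult_mem[OF D_division] by blast

lemma D_mult_nonzero: "e \<in> E \<Longrightarrow> x \<in> D e - {0} \<Longrightarrow> y \<in> D e - {0} \<Longrightarrow> x * y \<in> D e - {0}"
  using division_subring.mult_eq_0[OF D_division] D_mult by blast

lemma iv_nonzero: "e \<in> E \<Longrightarrow> x \<in> D e - {0} \<Longrightarrow> iv x \<in> D e - {0}"
  using iv[of e x] E_nonzero[of e] by auto

lemma iv_mult:
  assumes e: "e \<in> E" and x: "x \<in> D e - {0}" and y: "y \<in> D e - {0}"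
  shows "iv (x * y) = iv y * iv x"
proof -
  have xy: "x * y \<in> D e" "x * y \<noteq> 0" using D_mult_nonzero[OF assms] by auto
  have 1: "e * iv x = iv x" "iv (x * y) * e = iv (x * y)"
    using iv[OF e, of x] iv[OF e, of "x * y"] x xy by (auto simp: D_def)
  have "(x * y) * (iv y * iv x) = x * ((y * iv y) * iv x)" by (simp add: mult.assoc)
  also have "\<dots> = e" using iv[OF e, of x] iv[OF e, of y] x y 1 by simp
  finally have "iv (x * y) * ((x * y) * (iv y * iv x)) = iv (x * y)" using 1 by simp
  moreover have "iv (x * y) * ((x * y) * (iv y * iv x)) = e * (iv y * iv x)"
    using iv[OF e xy] by (simp add: mult.assoc[symmetric])
  moreover have "e * (iv y * iv x) = iv y * iv x"
    using iv[OF e, of y] y by (simp add: mult.assoc[symmetric] D_def)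
  ultimately show ?thesis by simp
qed

lemma sum_U:
  assumes e: "e \<in> E" and "\<And>f x. f \<in> E \<Longrightarrow> f \<noteq> e \<Longrightarrow> x \<in> D f \<Longrightarrow> x \<noteq> 0 \<Longrightarrow> g x = 0"
  shows "sum g U = sum g (D e - {0})"
proof (rule sum.mono_neutral_right)
  show "\<forall>i\<in>U - (D e - {0}). g i = 0"
  proof
    fix x assume "x \<in> U - (D e - {0})"
    then obtain f where "f \<in> E" "x \<in> D f" "x \<noteq> 0" "x \<notin> D e" by (auto simp: U_def)
    thus "g x = 0" using assms(2)[of f x] by blast
  qed
qed (use e in \<open>auto simp: U_def\<close>)

text \<open>\<open>card (D e)\<close> is divisible by the characteristic, so counting the units of \<open>D e\<close> gives \<open>-1\<close>.\<close>

lemma sum_units: assumes e: "e \<in> E" shows "(\<Sum>x\<in>D e - {0}. e) = - e"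
proof -
  interpret division_subring "D e" e by (rule D_division[OF e])
  have "(\<Sum>x\<in>D e. x + e) = (\<Sum>x\<in>D e. x)"
    by (rule sum.reindex_bij_witness[of _ "\<lambda>x. x - e" "\<lambda>x. x + e"]) (auto simp: add_mem diff_mem one_mem)
  hence "(\<Sum>x\<in>D e. e) = 0" by (simp add: sum.distrib)
  moreover have "(\<Sum>x\<in>D e. e) = e + (\<Sum>x\<in>D e - {0}. e)"
    by (rule sum.remove) (simp_all add: zero_mem)
  ultimately show ?thesis by (simp add: eq_neg_iff_add_eq_0 add.commute)
qed

lemma sum_U_split: "sum g U = (\<Sum>e\<in>E. \<Sum>x\<in>D e - {0}. g x)"
  unfolding U_def by (rule sum.UNION_disjoint) (use D_inter in auto)

lemma sum_iv_mult: "(\<Sum>x\<in>U. iv x * x) = - 1" and sum_mult_iv: "(\<Sum>x\<in>U. x * iv x) = - 1"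
proof -
  have "(\<Sum>e\<in>E. \<Sum>x\<in>D e - {0}. e) = - 1" by (simp add: sum_units sum_negf sum_E)
  moreover have "(\<Sum>x\<in>U. iv x * x) = (\<Sum>e\<in>E. \<Sum>x\<in>D e - {0}. e)"
    unfolding sum_U_split using iv by (intro sum.cong) auto
  moreover have "(\<Sum>x\<in>U. x * iv x) = (\<Sum>e\<in>E. \<Sum>x\<in>D e - {0}. e)"
    unfolding sum_U_split using iv by (intro sum.cong) auto
  ultimately show "(\<Sum>x\<in>U. iv x * x) = - 1" "(\<Sum>x\<in>U. x * iv x) = - 1" by simp_all
qed

lemma sum_units_mult_right:
  assumes e: "e \<in> E" and u: "u \<in> D e - {0}"
  shows "(\<Sum>x\<in>D e - {0}. g (x * u)) = sum g (D e - {0})"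
proof (rule sum.reindex_bij_witness[of _ "\<lambda>x. x * iv u" "\<lambda>x. x * u"])
  fix x assume x: "x \<in> D e - {0}"
  show "x * u * iv u = x" "x * iv u * u = x" using iv[OF e, of u] u x by (auto simp: mult.assoc D_def)
  show "x * u \<in> D e - {0}" using D_mult_nonzero[OF e x u] .
  show "x * iv u \<in> D e - {0}" using D_mult_nonzero[OF e x iv_nonzero[OF e u]] .
qed simp

lemma sum_units_mult_left:
  assumes e: "e \<in> E" and u: "u \<in> D e - {0}"
  shows "(\<Sum>x\<in>D e - {0}. g (u * x)) = sum g (D e - {0})"
proof (rule sum.reindex_bij_witness[of _ "\<lambda>x. iv u * x" "\<lambda>x. u * x"])
  fix x assume x: "x \<in> D e - {0}"
  show "iv u * (u * x) = x" "u * (iv u * x) = x" using iv[OF e, of u] u x by (auto simp: mult.assoc[symmetric] D_def)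
  show "u * x \<in> D e - {0}" using D_mult_nonzero[OF e u x] .
  show "iv u * x \<in> D e - {0}" using D_mult_nonzero[OF e iv_nonzero[OF e u] x] .
qed simp

lemma sd_induct [consumes 1, case_names add zero unit]:
  assumes s: "sd s = s"
    and add: "\<And>x y. P x \<Longrightarrow> P y \<Longrightarrow> P (x + y)" and zero: "P 0"
    and unit: "\<And>e u. e \<in> E \<Longrightarrow> u \<in> D e - {0} \<Longrightarrow> P u"
  shows "P s"
proof -
  have "P (\<Sum>e\<in>A. e * s)" if "A \<subseteq> E" for A
    using finite_alg[of A] that
  proof (induction rule: finite_induct)
    case (insert e A)
    have "P (e * s)" using unit[of e "e * s"] D_sd[of e s] s insert.prems zero by (cases "e * s = 0") auto
    thus ?case using insert add by simp
  qed (simp add: zero)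
  from this[of E] show ?thesis by (simp add: sum_E_left)
qed

text \<open>For a unit u of e B e, substituting x * u for x moves u out of the sum; the summands
  from other corners vanish on both sides. The abstract action covers B acting on itself and,
  through a homomorphism v, B acting on k.\<close>

lemma average_left:
  fixes act :: "'b \<Rightarrow> 'y::ab_group_add \<Rightarrow> 'y"
  assumes act: "\<And>x y z. act (x * y) z = act x (act y z)" "\<And>x y z. act (x + y) z = act x z + act y z"
      "\<And>x y z. act x (y + z) = act x y + act x z"
    and h: "\<And>x y. h (x + y) = h x + h y" and s: "sd s = s"
  shows "(\<Sum>x\<in>U. act (iv x) (h (x * (s * b)))) = act s (\<Sum>x\<in>U. act (iv x) (h (x * b)))"
proof -
  have h_0: "h 0 = 0" and act_0: "act 0 z = 0" "act x 0 = 0" for x z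
    using h[of 0 0] act(2)[of 0 0 z] act(3)[of x 0 0] by simp_all
  have act_sum: "act x (sum g A) = (\<Sum>a\<in>A. act x (g a))" for x A and g :: "'b \<Rightarrow> 'y"
    by (induction A rule: infinite_finite_induct) (simp_all add: act_0 act(3))
  show ?thesis
    using s
  proof (induction rule: sd_induct)
    case (unit e u)
    have "(\<Sum>x\<in>U. act (iv x) (h (x * (u * b)))) = (\<Sum>x\<in>D e - {0}. act (iv x) (h (x * (u * b))))"
    proof (rule sum_U[OF unit(1)])
      fix f x assume "f \<in> E" "f \<noteq> e" "x \<in> D f"
      hence "x * u = 0" using D_mult_eq_0[of f e] unit by auto
      thus "act (iv x) (h (x * (u * b))) = 0" by (simp add: mult.assoc[symmetric] h_0 act_0)
    qed
    also have "\<dots> = (\<Sum>x\<in>D e - {0}. act u (act (iv (x * u)) (h (x * u * b))))"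
    proof (rule sum.cong)
      fix x assume x: "x \<in> D e - {0}"
      have "u * iv (x * u) = (u * iv u) * iv x" using iv_mult[OF unit(1) x unit(2)] by (simp add: mult.assoc)
      also have "\<dots> = iv x" using iv[OF unit(1), of u] iv[OF unit(1), of x] unit x by (auto simp: D_def)
      finally show "act (iv x) (h (x * (u * b))) = act u (act (iv (x * u)) (h (x * u * b)))"
        by (simp add: mult.assoc flip: act(1))
    qed simp
    also have "\<dots> = (\<Sum>x\<in>D e - {0}. act u (act (iv x) (h (x * b))))"
      by (rule sum_units_mult_right[OF unit])
    also have "\<dots> = (\<Sum>x\<in>U. act u (act (iv x) (h (x * b))))"
    proof (rule sum_U[OF unit(1), symmetric])
      fix f x assume "f \<in> E" "f \<noteq> e" "x \<in> D f" "x \<noteq> 0"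
      hence "u * iv x = 0" using D_mult_eq_0[of e f u "iv x"] iv[of f x] unit by auto
      thus "act u (act (iv x) (h (x * b))) = 0" by (simp add: act_0 flip: act(1))
    qed
    finally show ?case by (simp add: act_sum)
  qed (simp_all add: distrib_left distrib_right h act sum.distrib h_0 act_0)
qed

lemma average_right:
  fixes act :: "'b \<Rightarrow> 'y::ab_group_add \<Rightarrow> 'y"
  assumes act: "\<And>x y z. act (x * y) z = act y (act x z)" "\<And>x y z. act (x + y) z = act x z + act y z"
      "\<And>x y z. act x (y + z) = act x y + act x z"
    and h: "\<And>x y. h (x + y) = h x + h y" and s: "sd s = s"
  shows "(\<Sum>x\<in>U. act (iv x) (h (b * s * x))) = act s (\<Sum>x\<in>U. act (iv x) (h (b * x)))"
proof -
  have h_0: "h 0 = 0" and act_0: "act 0 z = 0" "act x 0 = 0" for x z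
    using h[of 0 0] act(2)[of 0 0 z] act(3)[of x 0 0] by simp_all
  have act_sum: "act x (sum g A) = (\<Sum>a\<in>A. act x (g a))" for x A and g :: "'b \<Rightarrow> 'y"
    by (induction A rule: infinite_finite_induct) (simp_all add: act_0 act(3))
  show ?thesis
    using s
  proof (induction rule: sd_induct)
    case (unit e u)
    have "(\<Sum>x\<in>U. act (iv x) (h (b * u * x))) = (\<Sum>x\<in>D e - {0}. act (iv x) (h (b * u * x)))"
    proof (rule sum_U[OF unit(1)])
      fix f x assume "f \<in> E" "f \<noteq> e" "x \<in> D f"
      hence "u * x = 0" using D_mult_eq_0[of e f] unit by auto
      thus "act (iv x) (h (b * u * x)) = 0" by (simp add: mult.assoc h_0 act_0)
    qed
    also have "\<dots> = (\<Sum>x\<in>D e - {0}. act u (act (iv (u * x)) (h (b * (u * x)))))"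
    proof (rule sum.cong)
      fix x assume x: "x \<in> D e - {0}"
      have "iv (u * x) * u = iv x * (iv u * u)" using iv_mult[OF unit(1) unit(2) x] by (simp add: mult.assoc)
      also have "\<dots> = iv x" using iv[OF unit(1), of u] iv[OF unit(1), of x] unit x by (auto simp: D_def)
      finally show "act (iv x) (h (b * u * x)) = act u (act (iv (u * x)) (h (b * (u * x))))"
        by (simp add: mult.assoc flip: act(1))
    qed simp
    also have "\<dots> = (\<Sum>x\<in>D e - {0}. act u (act (iv x) (h (b * x))))"
      by (rule sum_units_mult_left[OF unit])
    also have "\<dots> = (\<Sum>x\<in>U. act u (act (iv x) (h (b * x))))"
    proof (rule sum_U[OF unit(1), symmetric])
      fix f x assume "f \<in> E" "f \<noteq> e" "x \<in> D f" "x \<noteq> 0"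
      hence "iv x * u = 0" using D_mult_eq_0[of f e "iv x" u] iv[of f x] unit by auto
      thus "act u (act (iv x) (h (b * x))) = 0" by (simp add: act_0 flip: act(1))
    qed
    finally show ?case by (simp add: act_sum)
  qed (simp_all add: distrib_left distrib_right h act sum.distrib h_0 act_0)
qed

section \<open>The square of the radical and a bimodule projection onto it\<close>

definition J2 :: "'b set" where "J2 = span {x * y | x y. sd x = 0 \<and> sd y = 0}"

lemma J2_prod: "sd x = 0 \<Longrightarrow> sd y = 0 \<Longrightarrow> x * y \<in> J2"
  unfolding J2_def by (rule span_base) blast

text \<open>Scalars are absorbed into the first factor of a product, so no case for scalar multiples
  arises.\<close>

lemma J2_induct [consumes 1, case_names zero add prod]:
  assumes "z \<in> J2" and zero: "P 0" and add: "\<And>x y. P x \<Longrightarrow> P y \<Longrightarrow> P (x + y)"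
    and prod: "\<And>x y. sd x = 0 \<Longrightarrow> sd y = 0 \<Longrightarrow> P (x * y)"
  shows "P z"
  using assms(1) unfolding J2_def
proof (induction rule: span_induct_alt)
  case (step c x z)
  then obtain u v where uv: "x = u * v" "sd u = 0" "sd v = 0" by blast
  have "P (scale c u * v)" using uv by (intro prod) (simp_all add: sd_scale)
  thus ?case using step add by (simp add: uv scale_mult_left)
qed (rule zero)

lemma J2_add: "x \<in> J2 \<Longrightarrow> y \<in> J2 \<Longrightarrow> x + y \<in> J2"
  and J2_diff: "x \<in> J2 \<Longrightarrow> y \<in> J2 \<Longrightarrow> x - y \<in> J2"
  and J2_0: "0 \<in> J2"
  unfolding J2_def by (auto intro: span_add span_diff span_zero)

lemma J2_sum: "(\<And>a. a \<in> A \<Longrightarrow> g a \<in> J2) \<Longrightarrow> sum g A \<in> J2"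
  unfolding J2_def by (rule span_sum)

lemma J2_mult_left: "z \<in> J2 \<Longrightarrow> b * z \<in> J2"
  by (induction rule: J2_induct) (auto simp: J2_0 distrib_left J2_add mult.assoc[symmetric] sd_mult intro!: J2_prod)

lemma J2_mult_right: "z \<in> J2 \<Longrightarrow> z * b \<in> J2"
  by (induction rule: J2_induct) (auto simp: J2_0 distrib_right J2_add mult.assoc sd_mult intro!: J2_prod)

lemma J2_sd: "z \<in> J2 \<Longrightarrow> sd z = 0"
  by (induction rule: J2_induct) (auto simp: sd_add sd_mult)

text \<open>A linear projection onto J2 is averaged on the left and then on the right. On J2 each
  averaging is multiplication by -1, by \<open>sum_iv_mult\<close> and \<open>sum_mult_iv\<close>,
  so the two signs cancel.\<close>

lemma bimodule_projection:
  obtains p where "\<And>x y. p (x + y) = p x + p y" "\<And>b. p b \<in> J2" "\<And>b. b \<in> J2 \<Longrightarrow> p b = b"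
    "\<And>s b. sd s = s \<Longrightarrow> p (s * b) = s * p b" "\<And>s b. sd s = s \<Longrightarrow> p (b * s) = p b * s"
proof -
  interpret vector_space_pair scale scale ..
  obtain h where h: "range h \<subseteq> J2" "Vector_Spaces.linear scale scale h" "\<And>b. b \<in> J2 \<Longrightarrow> h b = b"
  proof -
    have "inj_on id J2" "subspace J2" by (simp_all add: J2_def)
    from linear_exists_left_inverse_on[OF linear_id this(2,1)] show ?thesis using that by auto
  qed
  interpret h: Vector_Spaces.linear scale scale h by (rule h(2))
  note h_add = h.add
  define p1 where "p1 = (\<lambda>b. \<Sum>x\<in>U. iv x * h (x * b))"
  define p where "p = (\<lambda>b. \<Sum>x\<in>U. p1 (b * x) * iv x)"
  have p1_add: "p1 (x + y) = p1 x + p1 y" for x y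
    by (simp add: p1_def h_add distrib_left sum.distrib)
  show ?thesis
  proof
    show "p (x + y) = p x + p y" for x y by (simp add: p_def p1_add distrib_right sum.distrib)
    have "p1 b \<in> J2" for b unfolding p1_def using h(1) by (intro J2_sum J2_mult_left) blast
    thus "p b \<in> J2" for b unfolding p_def by (intro J2_sum J2_mult_right)
    have 1: "p1 b = - b" if "b \<in> J2" for b
    proof -
      have "p1 b = (\<Sum>x\<in>U. iv x * x) * b"
        unfolding p1_def sum_distrib_right by (intro sum.cong) (simp_all add: h(3) J2_mult_left that mult.assoc)
      thus ?thesis by (simp add: sum_iv_mult)
    qed
    show "p b = b" if "b \<in> J2" for b
    proof -
      have "p b = - b * (\<Sum>x\<in>U. x * iv x)"
        unfolding p_def sum_distrib_left
        by (intro sum.cong) (simp_all add: 1 J2_mult_right that mult.assoc)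
      thus ?thesis by (simp add: sum_mult_iv)
    qed
    show "p (s * b) = s * p b" if s: "sd s = s" for s b
    proof -
      have "p1 (s * b) = s * p1 b" for b
        unfolding p1_def by (rule average_left[where act = "(*)", OF _ _ _ h_add s]) (simp_all add: mult.assoc distrib_left distrib_right)
      thus ?thesis by (simp add: p_def mult.assoc sum_distrib_left)
    qed
    show "p (b * s) = p b * s" if s: "sd s = s" for s b
      unfolding p_def
      by (rule average_right[where act = "\<lambda>x z. z * x", OF _ _ _ p1_add s]) (simp_all add: mult.assoc distrib_left distrib_right)
  qed
qed

end

text \<open>Encodes J = B \<otimes>_S M by elements: L is a left S-basis of M, and
  \<open>fl l\<close> is the coordinate at l, taken in B idem(l) and extended by zero to S. The
  axiom \<open>fl_mult_right\<close> records that M is also stable under S from the right.\<close>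

locale dual_system = basic_hereditary_algebra scale E
  for scale :: "'f::{field, finite} \<Rightarrow> 'b::{ring, monoid_mult} \<Rightarrow> 'b" and E +
  fixes L :: "'b set" and idem :: "'b \<Rightarrow> 'b" and fl :: "'b \<Rightarrow> 'b \<Rightarrow> 'b"
  assumes L_sd: "l \<in> L \<Longrightarrow> sd l = 0"
    and idem_E: "l \<in> L \<Longrightarrow> idem l \<in> E"
    and idem_mult: "l \<in> L \<Longrightarrow> idem l * l = l"
    and fl_add: "l \<in> L \<Longrightarrow> fl l (x + y) = fl l x + fl l y"
    and fl_mult: "l \<in> L \<Longrightarrow> sd b = 0 \<Longrightarrow> fl l (y * b) = y * fl l b"
    and fl_sd: "l \<in> L \<Longrightarrow> sd s = s \<Longrightarrow> fl l s = 0"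
    and fl_idem: "l \<in> L \<Longrightarrow> fl l b * idem l = fl l b"
    and fl_expand: "b = sd b + (\<Sum>l\<in>L. fl l b * l)"
    and fl_dual: "l \<in> L \<Longrightarrow> l' \<in> L \<Longrightarrow> fl l l' = (if l = l' then idem l else 0)"
    and fl_mult_right: "l \<in> L \<Longrightarrow> l' \<in> L \<Longrightarrow> sd s = s \<Longrightarrow> sd (fl l (l' * s)) = fl l (l' * s)"

section \<open>Minimal generators and unique coordinates of the radical\<close>

context basic_hereditary_algebra begin

text \<open>L is a homogeneous generating set of least size. In a relation the coefficient of l0
  lies in the field \<open>D (h l0)\<close>; if it were nonzero it would be invertible and l0 could
  be dropped. The condition \<open>x l * h l = x l\<close> is what makes coefficients unique, since
  S is only a product of fields.\<close>

lemma minimal_homogeneous_generators: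
  assumes M0: "0 \<in> M" and M_add: "\<And>x y. x \<in> M \<Longrightarrow> y \<in> M \<Longrightarrow> x + y \<in> M"
    and M_mult: "\<And>s m. sd s = s \<Longrightarrow> m \<in> M \<Longrightarrow> s * m \<in> M"
  obtains L h where "L \<subseteq> M" "\<And>l. l \<in> L \<Longrightarrow> h l \<in> E \<and> h l * l = l"
    "\<And>m. m \<in> M \<Longrightarrow> \<exists>x. (\<forall>l. sd (x l) = x l) \<and> m = (\<Sum>l\<in>L. x l * l)"
    "\<And>x l. (\<And>l. sd (x l) = x l) \<Longrightarrow> (\<And>l. l \<in> L \<Longrightarrow> x l * h l = x l) \<Longrightarrow>
       (\<Sum>l\<in>L. x l * l) = 0 \<Longrightarrow> l \<in> L \<Longrightarrow> x l = 0"
proof -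
  define G where "G = (\<lambda>L. L \<subseteq> M \<and> (\<forall>l\<in>L. \<exists>e\<in>E. e * l = l) \<and>
    (\<forall>m\<in>M. \<exists>x. (\<forall>l. sd (x l) = x l) \<and> m = (\<Sum>l\<in>L. x l * l)))"
  define L0 where "L0 = {m \<in> M. \<exists>e\<in>E. e * m = m}"
  have "G L0"
    unfolding G_def
  proof (intro conjI ballI)
    fix m assume m: "m \<in> M"
    have em: "e * m \<in> L0" if "e \<in> E" for e
      using that m M_mult[of e m] sd_D[of e e] E_mem_D[of e] by (auto simp: L0_def intro!: bexI[of _ e])
    \<comment> \<open>Several e may give the same product e * m, namely 0, so the coefficient of l
      collects all of them.\<close>
    define x where "x = (\<lambda>l. \<Sum>e\<in>{e \<in> E. e * m = l}. e)"
    have "m = (\<Sum>e\<in>E. e * (e * m))" by (simp add: sum_E_left)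
    also have "\<dots> = (\<Sum>l\<in>L0. \<Sum>e\<in>{e \<in> E. e * m = l}. e * (e * m))"
      by (rule sum.group[symmetric]) (use em in auto)
    also have "\<dots> = (\<Sum>l\<in>L0. x l * l)"
      unfolding x_def sum_distrib_right by (intro sum.cong) auto
    finally have "m = (\<Sum>l\<in>L0. x l * l)" .
    moreover have "sd (x l) = x l" for l
      unfolding x_def sd_sum by (intro sum.cong) (auto simp: sd_D E_mem_D)
    ultimately show "\<exists>x. (\<forall>l. sd (x l) = x l) \<and> m = (\<Sum>l\<in>L0. x l * l)" by blast
  qed (auto simp: L0_def)
  then obtain L where L: "G L" and min: "\<And>L'. card L' < card L \<Longrightarrow> \<not> G L'"
    using ex_has_least_nat[of G L0 card] by (metis not_le)
  have "\<forall>l\<in>L. \<exists>e. e \<in> E \<and> e * l = l" using L unfolding G_def by blast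
  then obtain h where h: "\<And>l. l \<in> L \<Longrightarrow> h l \<in> E \<and> h l * l = l" by metis
  show ?thesis
  proof
    show "L \<subseteq> M" "\<And>m. m \<in> M \<Longrightarrow> \<exists>x. (\<forall>l. sd (x l) = x l) \<and> m = (\<Sum>l\<in>L. x l * l)"
      using L unfolding G_def by blast+
    show "\<And>l. l \<in> L \<Longrightarrow> h l \<in> E \<and> h l * l = l" by (rule h)
    fix x l0
    assume x: "\<And>l. sd (x l) = x l" "\<And>l. l \<in> L \<Longrightarrow> x l * h l = x l"
      and sum0: "(\<Sum>l\<in>L. x l * l) = 0" and l0: "l0 \<in> L"
    show "x l0 = 0"
    proof (rule ccontr)
      assume nz: "x l0 \<noteq> 0"
      define e where "e = h l0"
      have e: "e \<in> E" "e * l0 = l0" using h l0 by (auto simp: e_def)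
      have "x l0 = e * x l0 * e"
        using sd_E[OF e(1), of "x l0"] x(1)[of l0] x(2)[OF l0] by (simp add: e_def)
      hence "x l0 \<in> D e" using D_I[OF e(1)] by metis
      then obtain y where y: "y \<in> D e" "y * x l0 = e"
        using division_subring.inverse_ex[OF D_division[OF e(1)]] nz by blast
      have sdy: "sd y = y" using sd_D[OF e(1) y(1)] .
      have "0 = y * (\<Sum>l\<in>L. x l * l)" by (simp add: sum0)
      also have "\<dots> = y * (x l0 * l0) + (\<Sum>l\<in>L - {l0}. y * (x l * l))"
        unfolding sum_distrib_left by (rule sum.remove) (use l0 in auto)
      also have "y * (x l0 * l0) = l0" using y e by (simp add: mult.assoc[symmetric])
      finally have l0_eq: "l0 = - (\<Sum>l\<in>L - {l0}. y * x l * l)"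
        by (simp add: mult.assoc eq_neg_iff_add_eq_0)
      have "G (L - {l0})"
        unfolding G_def
      proof (intro conjI ballI)
        fix m assume "m \<in> M"
        then obtain z where z: "\<And>l. sd (z l) = z l" "m = (\<Sum>l\<in>L. z l * l)"
          using L unfolding G_def by blast
        have "m = z l0 * l0 + (\<Sum>l\<in>L - {l0}. z l * l)"
          unfolding z(2) by (rule sum.remove) (use l0 in auto)
        also have "z l0 * l0 = (\<Sum>l\<in>L - {l0}. - (z l0 * y * x l) * l)"
          by (subst l0_eq) (simp add: sum_distrib_left sum_negf mult.assoc)
        also have "\<dots> + (\<Sum>l\<in>L - {l0}. z l * l) = (\<Sum>l\<in>L - {l0}. (z l - z l0 * y * x l) * l)"
          by (simp add: sum.distrib[symmetric] algebra_simps)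
        finally show "\<exists>x. (\<forall>l. sd (x l) = x l) \<and> m = (\<Sum>l\<in>L - {l0}. x l * l)"
          by (intro exI[of _ "\<lambda>l. z l - z l0 * y * x l"]) (simp add: sd_diff sd_mult z x sdy)
      qed (use L in \<open>auto simp: G_def\<close>)
      moreover have "card (L - {l0}) < card L" using l0 by (intro psubset_card_mono) auto
      ultimately show False using min by blast
    qed
  qed
qed

text \<open>Nakayama's lemma by the filtration. Let N be the left ideal generated by L: if J lies in
  N + \<open>filt t\<close>, then a product of two elements of J lies in N +
  \<open>filt (t + 1)\<close>, and since J lies in N + J2 the same holds for J.\<close>

lemma generators_mod_J2:
  assumes L: "\<And>l. l \<in> L \<Longrightarrow> sd l = 0"
    and mod: "\<And>b. sd b = 0 \<Longrightarrow> \<exists>r. b - (\<Sum>l\<in>L. r l * l) \<in> J2" and b: "sd b = 0"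
  shows "\<exists>r. b = (\<Sum>l\<in>L. r l * l)"
proof -
  define N where "N = {n. \<exists>r. n = (\<Sum>l\<in>L. r l * l)}"
  have N_add: "x + y \<in> N" if xy: "x \<in> N" "y \<in> N" for x y
  proof -
    obtain r r' where "x = (\<Sum>l\<in>L. r l * l)" "y = (\<Sum>l\<in>L. r' l * l)" using xy unfolding N_def by blast
    hence "x + y = (\<Sum>l\<in>L. (r l + r' l) * l)" by (simp add: distrib_right sum.distrib)
    thus ?thesis unfolding N_def by (intro CollectI exI[of _ "\<lambda>l. r l + r' l"])
  qed
  have N_mult: "c * x \<in> N" if x: "x \<in> N" for x c
  proof -
    obtain r where "x = (\<Sum>l\<in>L. r l * l)" using x unfolding N_def by blast
    hence "c * x = (\<Sum>l\<in>L. (c * r l) * l)" by (simp add: sum_distrib_left mult.assoc)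
    thus ?thesis unfolding N_def by (intro CollectI exI[of _ "\<lambda>l. c * r l"])
  qed
  have N0: "0 \<in> N" using N_mult[of _ 0] unfolding N_def by (auto intro!: exI[of _ "\<lambda>_. 0"])
  have "\<forall>b. sd b = 0 \<longrightarrow> (\<exists>n\<in>N. b - n \<in> filt t)" for t
  proof (induction t)
    case 0
    thus ?case using N0 filt_0 by blast
  next
    case (Suc t)
    have J2: "\<exists>n\<in>N. z - n \<in> filt (Suc t)" if "z \<in> J2" for z
      using that
    proof (induction rule: J2_induct)
      case zero
      thus ?case using N0 filt_zero by (intro bexI[of _ 0]) auto
    next
      case (add x y)
      then obtain n n' where "n \<in> N" "n' \<in> N" "x - n \<in> filt (Suc t)" "y - n' \<in> filt (Suc t)" by blast
      thus ?case using filt_add[of "x - n" "Suc t" "y - n'"] N_add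
        by (intro bexI[of _ "n + n'"]) (simp_all add: algebra_simps)
    next
      case (prod x y)
      then obtain n where n: "n \<in> N" "y - n \<in> filt t" using Suc by blast
      have "x * (y - n) \<in> filt (1 + t)" using filt_mult[OF filt_1 n(2)] prod by blast
      thus ?case using n N_mult by (intro bexI[of _ "x * n"]) (simp_all add: right_diff_distrib)
    qed
    show ?case
    proof (intro allI impI)
      fix b assume "sd b = 0"
      then obtain r where "b - (\<Sum>l\<in>L. r l * l) \<in> J2" using mod by blast
      then obtain n where n: "n \<in> N" "b - (\<Sum>l\<in>L. r l * l) - n \<in> filt (Suc t)" using J2 by blast
      have "(\<Sum>l\<in>L. r l * l) + n \<in> N" using n N_add unfolding N_def by blast
      thus "\<exists>n\<in>N. b - n \<in> filt (Suc t)" using n by (intro bexI[of _ "(\<Sum>l\<in>L. r l * l) + n"]) (simp_all add: algebra_simps)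
    qed
  qed
  from this[of "Suc (card E)"] obtain n where "n \<in> N" "b - n \<in> filt (Suc (card E))" using b by blast
  moreover from this have "b - n = 0" using filt_eq_0 by blast
  ultimately have "b \<in> N" by simp
  thus ?thesis unfolding N_def by blast
qed

lemma radical_projective: "projective_left_ideal {b. sd b = 0}"
proof -
  have "left_ideal {b. sd b = 0}" unfolding left_ideal_def by (simp add: sd_add sd_mult)
  thus ?thesis using hereditary unfolding hereditary_def by blast
qed

text \<open>M is a complement of J2 in J, and L a basis of it over S. L generates J by Nakayama, and
  projectivity gives some coordinates g; the work lies in showing that coordinates are unique
  (\<open>free\<close>), from which duality and right S-stability follow.\<close>

theorem dual_system_exists: "\<exists>L idem fl. dual_system scale E L idem fl"
proof -
  obtain p where p: "\<And>x y. p (x + y) = p x + p y" "\<And>b. p b \<in> J2" "\<And>b. b \<in> J2 \<Longrightarrow> p b = b"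
    "\<And>s b. sd s = s \<Longrightarrow> p (s * b) = s * p b" "\<And>s b. sd s = s \<Longrightarrow> p (b * s) = p b * s"
    using bimodule_projection by blast
  have p_diff: "p (x - y) = p x - p y" for x y using p(1)[of "x - y" y] by (simp add: algebra_simps)
  define M where "M = {b. sd b = 0 \<and> p b = 0}"
  have p0: "p 0 = 0" using p(3) J2_0 by blast
  have M_mult: "s * m \<in> M" "m * s \<in> M" if "sd s = s" "m \<in> M" for s m
    using that by (auto simp: M_def sd_mult p(4,5))
  have M0: "0 \<in> M" and M_add: "\<And>x y. x \<in> M \<Longrightarrow> y \<in> M \<Longrightarrow> x + y \<in> M"
    by (simp_all add: M_def p0 p(1) sd_add)
  have M_diff: "x - y \<in> M" if "x \<in> M" "y \<in> M" for x y using that by (simp add: M_def p_diff sd_diff)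
  have M_sum: "sum g A \<in> M" if "\<And>a. a \<in> A \<Longrightarrow> g a \<in> M" for g :: "'b \<Rightarrow> 'b" and A
    using that by (induction A rule: infinite_finite_induct) (auto simp: M0 M_add)
  have M_J2: "z = 0" if "z \<in> M" "z \<in> J2" for z using that p(3) by (simp add: M_def)
  obtain L h where L: "L \<subseteq> M" "\<And>l. l \<in> L \<Longrightarrow> h l \<in> E \<and> h l * l = l"
    "\<And>m. m \<in> M \<Longrightarrow> \<exists>x. (\<forall>l. sd (x l) = x l) \<and> m = (\<Sum>l\<in>L. x l * l)"
    "\<And>x l. (\<And>l. sd (x l) = x l) \<Longrightarrow> (\<And>l. l \<in> L \<Longrightarrow> x l * h l = x l) \<Longrightarrow>
       (\<Sum>l\<in>L. x l * l) = 0 \<Longrightarrow> l \<in> L \<Longrightarrow> x l = 0"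
    using minimal_homogeneous_generators[OF M0 M_add M_mult(1)] by blast
  have L_sd: "sd l = 0" if "l \<in> L" for l using that L(1) by (auto simp: M_def)
  have sd_h: "sd (h l) = h l" if "l \<in> L" for l using that L(2) sd_D E_mem_D by blast
  have mod: "\<exists>r. b - (\<Sum>l\<in>L. r l * l) \<in> J2" if b: "sd b = 0" for b
  proof -
    have "b - p b \<in> M" using b p(2,3) by (simp add: M_def p_diff sd_diff J2_sd)
    then obtain x where "b - p b = (\<Sum>l\<in>L. x l * l)" using L(3) by blast
    hence "b - (\<Sum>l\<in>L. x l * l) = p b" by (simp add: algebra_simps)
    thus ?thesis using p(2) by metis
  qed
  obtain g where g: "\<And>l x y. sd x = 0 \<Longrightarrow> sd y = 0 \<Longrightarrow> g l (x + y) = g l x + g l y"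
    "\<And>l r x. sd x = 0 \<Longrightarrow> g l (r * x) = r * g l x"
    "\<And>x. sd x = 0 \<Longrightarrow> x = (\<Sum>l\<in>L. g l x * l)"
  proof (rule projective_dual_basis[OF radical_projective finite_UNIV, of L])
    show "\<exists>r. x = (\<Sum>l\<in>L. r l * l)" if "x \<in> {b. sd b = 0}" for x
      using generators_mod_J2[of L, OF L_sd mod] that by blast
  qed (use L_sd in auto)
  have g0: "g l 0 = 0" for l using g(1)[of 0 0 l] by simp
  have g_sum: "g l (\<Sum>a\<in>A. b a * a) = (\<Sum>a\<in>A. b a * g l a)" if "A \<subseteq> L" for l A and b :: "'b \<Rightarrow> 'b"
    using finite_alg[of A] that
  proof (induction rule: finite_induct)
    case (insert a A)
    have "sd (b a * a) = 0" using insert.prems by (simp add: sd_mult L_sd)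
    moreover have "sd (\<Sum>a\<in>A. b a * a) = 0"
      unfolding sd_sum by (rule sum.neutral) (use insert.prems in \<open>auto simp: sd_mult L_sd\<close>)
    ultimately show ?case using insert by (simp add: g L_sd)
  qed (simp add: g0)
  \<comment> \<open>The matrix a of coordinates of L itself is the identity modulo J. Applying the
    coordinates to a relation expresses b as minus b times the J-part of a, which moves b one step
    deeper into the filtration each time.\<close>
  have free: "b l = 0" if b: "\<And>l. l \<in> L \<Longrightarrow> b l * h l = b l" and sum0: "(\<Sum>l\<in>L. b l * l) = 0" and l: "l \<in> L" for b l
  proof -
    define a where "a = (\<lambda>l' l. g l l' * h l)"
    have a_h: "a l' l * h l = a l' l" if "l \<in> L" for l l'
      using that L(2) by (simp add: a_def mult.assoc)
    have a_expand: "l' = (\<Sum>l\<in>L. a l' l * l)" if "l' \<in> L" for l'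
    proof -
      have "(\<Sum>l\<in>L. a l' l * l) = (\<Sum>l\<in>L. g l l' * l)"
        using L(2) by (intro sum.cong) (simp_all add: a_def mult.assoc)
      thus ?thesis using g(3)[OF L_sd[OF that]] by simp
    qed
    \<comment> \<open>In the expansion of l' the J-parts of the coefficients contribute to J2 and
      the S-parts to M. As M and J2 meet in 0, the S-parts must be the trivial coordinates of l' in
      M.\<close>
    have a_sd: "sd (a l' l) = (if l = l' then h l else 0)" if l': "l' \<in> L" and l: "l \<in> L" for l' l
    proof -
      define x where "x = (\<lambda>l. if l \<in> L then sd (a l' l) - (if l = l' then h l else 0) else 0)"
      have eq: "(\<Sum>l\<in>L. x l * l) = (\<Sum>l\<in>L. sd (a l' l) * l) - l'"
      proof -
        have "(\<Sum>l\<in>L. x l * l) = (\<Sum>l\<in>L. sd (a l' l) * l - (if l = l' then l' else 0))"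
          using L(2) l' by (intro sum.cong) (auto simp: x_def left_diff_distrib)
        thus ?thesis using l' by (simp add: sum_subtractf)
      qed
      also have "\<dots> = - (\<Sum>l\<in>L. jd (a l' l) * l)"
      proof -
        have "l' = (\<Sum>l\<in>L. sd (a l' l) * l) + (\<Sum>l\<in>L. jd (a l' l) * l)"
          unfolding sum.distrib[symmetric] distrib_right[symmetric] sd_plus_jd using a_expand[OF l'] .
        thus ?thesis by (metis add_diff_cancel_left' minus_diff_eq)
      qed
      finally have "(\<Sum>l\<in>L. x l * l) \<in> J2"
        using J2_diff[OF J2_0 J2_sum[of L "\<lambda>l. jd (a l' l) * l"]] by (simp add: J2_prod L_sd)
      moreover have "(\<Sum>l\<in>L. x l * l) \<in> M"
        unfolding eq using L(1) l' by (intro M_diff M_sum M_mult) auto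
      ultimately have "(\<Sum>l\<in>L. x l * l) = 0" using M_J2 by blast
      moreover have "sd (x l) = x l" for l by (simp add: x_def sd_diff sd_h)
      moreover have "x l * h l = x l" if "l \<in> L" for l
      proof -
        have "sd (a l' l) * h l = sd (a l' l)" using a_h[OF that, of l'] sd_h[OF that] by (metis sd_mult)
        moreover have "h l * h l = h l" using L(2)[OF that] E_idem by blast
        ultimately show ?thesis using that by (cases "l = l'") (simp_all add: x_def left_diff_distrib)
      qed
      ultimately have "x l = 0" using L(4) l by blast
      thus ?thesis using l by (simp add: x_def)
    qed
    have "\<forall>l\<in>L. b l \<in> filt t" for t
    proof (induction t)
      case (Suc t)
      show ?case
      proof
        fix l assume l: "l \<in> L"
        have "0 = g l (\<Sum>l'\<in>L. b l' * l') * h l" by (simp add: sum0 g0)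
        also have "\<dots> = (\<Sum>l'\<in>L. b l' * a l' l)" by (simp add: g_sum sum_distrib_right a_def mult.assoc)
        also have "\<dots> = (\<Sum>l'\<in>L. b l' * jd (a l' l) + (if l' = l then b l else 0))"
        proof (rule sum.cong)
          fix l' assume l': "l' \<in> L"
          have "b l' * a l' l = b l' * jd (a l' l) + b l' * sd (a l' l)"
            unfolding distrib_left[symmetric] by (simp add: jd_def)
          thus "b l' * a l' l = b l' * jd (a l' l) + (if l' = l then b l else 0)"
            using a_sd[OF l' l] b[OF l] by auto
        qed simp
        also have "\<dots> = (\<Sum>l'\<in>L. b l' * jd (a l' l)) + b l" using l by (simp add: sum.distrib)
        finally have "b l = (\<Sum>l'\<in>L. b l' * - jd (a l' l))"
          by (simp add: sum_negf eq_neg_iff_add_eq_0 add.commute)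
        moreover have "b l' * - jd (a l' l) \<in> filt (t + 1)" if "l' \<in> L" for l'
          using Suc that by (intro filt_mult filt_1) (auto simp: jd_def sd_diff)
        ultimately show "b l \<in> filt (Suc t)" using filt_sum[of L "\<lambda>l'. b l' * - jd (a l' l)" "Suc t"] by simp
      qed
    qed (simp add: filt_0)
    thus ?thesis using filt_eq_0[of "b l" "Suc (card E)"] l by blast
  qed
  \<comment> \<open>\<open>jd\<close> extends the coordinate by zero to S, and the factor
    \<open>h l\<close> puts it into B h(l), where uniqueness holds.\<close>
  define fl where "fl = (\<lambda>l b. g l (jd b) * h l)"
  have fl_expand: "jd b = (\<Sum>l\<in>L. fl l b * l)" for b
  proof -
    have "(\<Sum>l\<in>L. fl l b * l) = (\<Sum>l\<in>L. g l (jd b) * l)"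
      using L(2) by (intro sum.cong) (simp_all add: fl_def mult.assoc)
    thus ?thesis using g(3)[of "jd b"] by simp
  qed
  have fl_unique: "fl l b = x l" 
    if b: "jd b = (\<Sum>l\<in>L. x l * l)" and x_h: "\<And>l. l \<in> L \<Longrightarrow> x l * h l = x l" and l: "l \<in> L" for b x l
  proof -
    have "(\<Sum>l\<in>L. (fl l b - x l) * l) = 0"
      using b fl_expand[of b] by (simp add: left_diff_distrib sum_subtractf)
    moreover have "(fl k b - x k) * h k = fl k b - x k" if k: "k \<in> L" for k
    proof -
      have "fl k b * h k = fl k b" using L(2)[OF k] by (simp add: fl_def mult.assoc)
      thus ?thesis using x_h[OF k] by (simp add: left_diff_distrib)
    qed
    ultimately have "fl l b - x l = 0" using free[of "\<lambda>l. fl l b - x l" l] l by blast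
    thus ?thesis by simp
  qed
  have fl_dual: "fl l l' = (if l = l' then h l else 0)" if "l \<in> L" "l' \<in> L" for l l'
  proof (rule fl_unique)
    have "(\<Sum>l\<in>L. (if l = l' then h l else 0) * l) = (\<Sum>l\<in>L. if l = l' then l' else 0)"
      using L(2) by (intro sum.cong) auto
    thus "jd l' = (\<Sum>l\<in>L. (if l = l' then h l else 0) * l)"
      using that(2) by (simp add: jd_eq L_sd)
  qed (use that L(2) in auto)
  have "dual_system scale E L h fl"
  proof
    fix l assume l: "l \<in> L"
    show "sd l = 0" "h l \<in> E" "h l * l = l" using l L_sd L(2) by auto
    show "fl l (x + y) = fl l x + fl l y" for x y by (simp add: fl_def jd_add g distrib_right)
    show "fl l (y * b) = y * fl l b" if "sd b = 0" for y b
      using that by (simp add: fl_def jd_eq sd_mult g mult.assoc)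
    show "fl l s = 0" if "sd s = s" for s using that by (simp add: fl_def jd_sd g0)
    show "fl l b * h l = fl l b" for b using L(2)[OF l] by (simp add: fl_def mult.assoc)
    \<comment> \<open>M is closed under right multiplication by S, so l' * s has coefficients in S;
      by uniqueness they agree with the coordinates \<open>fl\<close>.\<close>
    show "sd (fl l (l' * s)) = fl l (l' * s)" if l': "l' \<in> L" and s: "sd s = s" for l' s
    proof -
      have "l' * s \<in> M" using l' s L(1) by (intro M_mult) auto
      then obtain x where x: "\<And>l. sd (x l) = x l" "l' * s = (\<Sum>l\<in>L. x l * l)" using L(3) by blast
      have "fl l (l' * s) = x l * h l"
      proof (rule fl_unique)
        have "(\<Sum>l\<in>L. x l * h l * l) = (\<Sum>l\<in>L. x l * l)"
          using L(2) by (intro sum.cong) (simp_all add: mult.assoc)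
        moreover have "jd (l' * s) = l' * s" using l' by (simp add: jd_eq sd_mult L_sd)
        ultimately show "jd (l' * s) = (\<Sum>l\<in>L. x l * h l * l)" using x(2) by (simp only:)
      qed (use l L(2) in \<open>auto simp: mult.assoc\<close>)
      thus ?thesis using x(1) sd_h[OF l] by (simp add: sd_mult)
    qed
  next
    show "b = sd b + (\<Sum>l\<in>L. fl l b * l)" for b using fl_expand[of b] sd_plus_jd[of b] by simp
  qed (rule fl_dual)
  thus ?thesis by blast
qed

end

section \<open>Homomorphisms to the algebraic closure\<close>

context basic_hereditary_algebra begin

definition V :: "('b \<Rightarrow> 'f alg_closure) set" where
  "V = {v. (\<forall>x y. v (x + y) = v x + v y) \<and> (\<forall>x y. v (x * y) = v x * v y) \<and> v 1 = 1 \<and>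
    (\<forall>c x. v (scale c x) = to_ac c * v x)}"

lemma V_add: "v \<in> V \<Longrightarrow> v (x + y) = v x + v y"
  and V_mult: "v \<in> V \<Longrightarrow> v (x * y) = v x * v y"
  and V_1: "v \<in> V \<Longrightarrow> v 1 = 1"
  and V_scale: "v \<in> V \<Longrightarrow> v (scale c x) = to_ac c * v x"
  unfolding V_def by blast+

lemma V_0: "v \<in> V \<Longrightarrow> v 0 = 0"
  using V_scale[of v 0 0] by simp

lemma V_sum: "v \<in> V \<Longrightarrow> v (sum g A) = (\<Sum>a\<in>A. v (g a))"
  by (induction A rule: infinite_finite_induct) (simp_all add: V_0 V_add)

lemma V_minus: "v \<in> V \<Longrightarrow> v (- x) = - v x"
  using V_add[of v x "- x"] by (simp add: V_0 eq_neg_iff_add_eq_0 add.commute)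

lemma V_E: assumes "v \<in> V" "e \<in> E" shows "v e = 0 \<or> v e = 1"
proof -
  have "v e * v e = v e" using V_mult[OF assms(1), of e e] assms by simp
  thus ?thesis by simp
qed

lemma V_sum_E: "v \<in> V \<Longrightarrow> (\<Sum>e\<in>E. v e) = 1"
  using V_sum[of v "\<lambda>e. e" E] by (simp add: sum_E V_1)

lemma V_ex_E: assumes "v \<in> V" obtains e where "e \<in> E" "v e = 1"
proof -
  have "\<exists>e\<in>E. v e \<noteq> 0" using V_sum_E[OF assms] by (metis sum.neutral zero_neq_one)
  thus ?thesis using V_E[OF assms] that by blast
qed

lemma V_E_unique: "v \<in> V \<Longrightarrow> e \<in> E \<Longrightarrow> f \<in> E \<Longrightarrow> v e = 1 \<Longrightarrow> f \<noteq> e \<Longrightarrow> v f = 0"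
  using V_mult[of v e f] E_orth[of e f] V_0[of v] by simp

lemma V_sd: assumes v: "v \<in> V" shows "v (sd b) = v b"
proof -
  have "v (sd b) = (\<Sum>e\<in>E. v e * v b)"
    unfolding sd_def V_sum[OF v]
  proof (rule sum.cong)
    fix e assume "e \<in> E"
    thus "v (e * b * e) = v e * v b" using V_E[OF v, of e] by (auto simp: V_mult[OF v])
  qed simp
  thus ?thesis by (simp add: sum_distrib_right[symmetric] V_sum_E[OF v])
qed

lemma V_radical: "v \<in> V \<Longrightarrow> sd b = 0 \<Longrightarrow> v b = 0"
  using V_sd[of v b] by (simp add: V_0)

lemma U_sd: "x \<in> U \<Longrightarrow> sd x = x"
  unfolding U_def using sd_D by auto

lemma D_other:
  assumes v: "v \<in> V" and e: "e \<in> E" "v e = 1" and f: "f \<in> E" "f \<noteq> e" and x: "x \<in> D f"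
  shows "v x = 0"
proof -
  have "v x = v f * v x" using x by (simp add: D_def flip: V_mult[OF v])
  thus ?thesis using V_E_unique[OF v e(1) f(1) e(2) f(2)] by simp
qed

text \<open>Orthogonality of characters on the units of the field e B e with v e = 1; v vanishes on
  the other corners. If v and w differ, some u has v(u^-1) w(u) different from 1, and translating by
  u multiplies the sum by that factor. If they agree, the sum counts the units, which gives
  -1.\<close>

lemma V_orthogonality:
  assumes v: "v \<in> V" and w: "w \<in> V"
  shows "(\<Sum>x\<in>U. v (iv x) * w x) = (if v = w then - 1 else 0)"
proof -
  obtain e where e: "e \<in> E" "v e = 1" using V_ex_E[OF v] .
  have "(\<Sum>x\<in>U. v (iv x) * w x) = (\<Sum>x\<in>D e - {0}. v (iv x) * w x)"
  proof (rule sum_U[OF e(1)])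
    fix f x assume f: "f \<in> E" "f \<noteq> e" "x \<in> D f" "x \<noteq> 0"
    hence "v (iv x) = 0" using D_other[OF v e f(1,2)] iv(1)[OF f(1,3,4)] by blast
    thus "v (iv x) * w x = 0" by simp
  qed
  also have "\<dots> = (if v = w then - 1 else 0)"
  proof (cases "v = w")
    case True
    have "(\<Sum>x\<in>D e - {0}. v (iv x) * w x) = (\<Sum>x\<in>D e - {0}. v e)"
    proof (rule sum.cong)
      fix x assume "x \<in> D e - {0}"
      hence "iv x * x = e" using iv(2)[OF e(1)] by blast
      thus "v (iv x) * w x = v e" using True V_mult[OF v, of "iv x" x] by simp
    qed simp
    also have "\<dots> = v (\<Sum>x\<in>D e - {0}. e)" by (simp only: V_sum[OF v])
    also have "\<dots> = - 1" by (simp only: sum_units[OF e(1)] V_minus[OF v] e(2))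
    finally show ?thesis using True by simp
  next
    case False
    have "\<exists>u\<in>D e - {0}. v (iv u) * w u \<noteq> 1"
    proof (rule ccontr)
      assume "\<not> ?thesis"
      hence all: "v (iv u) * w u = 1" if "u \<in> D e - {0}" for u using that by blast
      have eq: "v u = w u" if u: "u \<in> D e" for u
      proof (cases "u = 0")
        case False
        have "u * iv u = e" using iv(3)[OF e(1) u False] .
        hence "v u * v (iv u) = 1" using V_mult[OF v, of u "iv u"] e by simp
        moreover have "v (iv u) * w u = 1" using all u False by blast
        ultimately show ?thesis by (metis mult.assoc mult.left_neutral mult.right_neutral)
      qed (simp add: V_0 v w)
      have "w e = 1" using eq[OF E_mem_D[OF e(1)]] e by simp
      have "v b = w b" for b
        using eq[OF D_I[OF e(1), of b]] by (simp add: V_mult v w e(2) \<open>w e = 1\<close>)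
      thus False using False by blast
    qed
    then obtain u where u: "u \<in> D e - {0}" "v (iv u) * w u \<noteq> 1" by blast
    define T where "T = (\<Sum>x\<in>D e - {0}. v (iv x) * w x)"
    have "T = (\<Sum>x\<in>D e - {0}. v (iv (x * u)) * w (x * u))"
      unfolding T_def by (rule sum_units_mult_right[OF e(1) u(1), symmetric])
    also have "\<dots> = (\<Sum>x\<in>D e - {0}. (v (iv u) * w u) * (v (iv x) * w x))"
      by (rule sum.cong) (simp_all add: iv_mult[OF e(1) _ u(1)] V_mult v w)
    also have "\<dots> = (v (iv u) * w u) * T" by (simp only: T_def sum_distrib_left)
    finally have "(v (iv u) * w u - 1) * T = 0" by (simp add: left_diff_distrib)
    hence "T = 0" using u(2) by simp
    thus ?thesis using False by (simp add: T_def)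
  qed
  finally show ?thesis .
qed

text \<open>Powers of each b repeat, so v(b) is a root of a nonzero polynomial x^m - x^n that does
  not depend on v. Hence all v take values in one finite set.\<close>

lemma finite_V: "finite V"
proof -
  have fin: "finite {z :: 'f alg_closure. \<forall>m n. b ^ m = b ^ n \<longrightarrow> z ^ m = z ^ n}" for b :: 'b
  proof -
    have "\<not> inj (\<lambda>n::nat. b ^ n)" using finite_alg[of "range (\<lambda>n. b ^ n)"] finite_imageD by blast
    then obtain m n :: nat where mn: "m \<noteq> n" "b ^ m = b ^ n" by (auto simp: inj_def)
    define p :: "'f alg_closure poly" where "p = Polynomial.monom 1 m - Polynomial.monom 1 n"
    have "Polynomial.coeff p m = 1" using mn by (simp add: p_def)
    hence "p \<noteq> 0" by auto
    hence "finite {z. poly p z = 0}" by (rule poly_roots_finite)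
    moreover have "{z. \<forall>m n. b ^ m = b ^ n \<longrightarrow> z ^ m = z ^ n} \<subseteq> {z. poly p z = 0}"
      using mn(2) by (auto simp: p_def poly_monom)
    ultimately show ?thesis by (rule rev_finite_subset)
  qed
  define Z :: "'f alg_closure set" where "Z = (\<Union>b\<in>(UNIV :: 'b set). {z. \<forall>m n. b ^ m = b ^ n \<longrightarrow> z ^ m = z ^ n})"
  have "finite Z" unfolding Z_def using fin by simp
  hence "finite (PiE (UNIV :: 'b set) (\<lambda>_. Z))" by (intro finite_PiE) simp_all
  moreover have "V \<subseteq> PiE UNIV (\<lambda>_. Z)"
  proof
    fix v assume v: "v \<in> V"
    have pow: "v (b ^ n) = v b ^ n" for b n by (induction n) (simp_all add: V_1 V_mult v)
    have "v b ^ m = v b ^ n" if "b ^ m = b ^ n" for b m n using that pow by metis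
    hence "v b \<in> Z" for b unfolding Z_def by blast
    thus "v \<in> PiE UNIV (\<lambda>_. Z)" by auto
  qed
  ultimately show ?thesis by (rule rev_finite_subset)
qed

text \<open>An embedding of the field e B e into k, composed with x \<mapsto> e x e, lies in V
  because \<open>sd\<close> is multiplicative; it does not vanish at b when e b e is
  nonzero.\<close>

lemma V_separates: assumes "\<And>v. v \<in> V \<Longrightarrow> v b = 0" shows "sd b = 0"
proof -
  have "e * b * e = 0" if e: "e \<in> E" for e
  proof (rule ccontr)
    assume nz: "e * b * e \<noteq> 0"
    interpret De: division_subring "D e" e by (rule D_division[OF e])
    obtain \<alpha> :: "'b \<Rightarrow> 'f alg_closure" where
      \<alpha>: "\<And>x y. x \<in> D e \<Longrightarrow> y \<in> D e \<Longrightarrow> \<alpha> (x + y) = \<alpha> x + \<alpha> y"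
        "\<And>x y. x \<in> D e \<Longrightarrow> y \<in> D e \<Longrightarrow> \<alpha> (x * y) = \<alpha> x * \<alpha> y"
        "\<alpha> e = 1" "\<And>c x. x \<in> D e \<Longrightarrow> \<alpha> (scale c x) = to_ac c * \<alpha> x"
      using De.embedding_into_alg_closure[OF finite_alg fd_algebra_axioms] by metis
    define v where "v = (\<lambda>x. \<alpha> (e * x * e))"
    have "e * (x * y) * e = (e * x * e) * (e * y * e)" for x y
    proof -
      have "e * (x * y) * e = (e * sd x) * sd y" using E_sd[OF e, of "x * y"] by (simp add: sd_mult mult.assoc)
      also have "\<dots> = e * x * (e * sd y)" by (simp only: E_sd[OF e, of x] mult.assoc)
      also have "\<dots> = e * x * (e * y * e)" by (simp only: E_sd[OF e, of y])
      also have "\<dots> = (e * x * e) * (e * y * e)" using e by (simp add: mult.assoc)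
      finally show ?thesis .
    qed
    hence "v \<in> V"
      unfolding V_def v_def using e \<alpha> D_I[OF e]
      by (simp add: distrib_left distrib_right scale_mult_left scale_mult_right)
    hence "\<alpha> (e * b * e) = 0" using assms by (simp add: v_def)
    moreover obtain y where "y \<in> D e" "y * (e * b * e) = e" using De.inverse_ex[OF D_I[OF e] nz] by blast
    ultimately show False using \<alpha>(2)[of y "e * b * e"] \<alpha>(3) D_I[OF e] by simp
  qed
  thus ?thesis by (simp add: sd_def)
qed

definition fr :: "('b \<Rightarrow> 'f alg_closure) \<Rightarrow> 'b \<Rightarrow> 'f alg_closure" where
  "fr v = (\<lambda>b. v b ^ CARD('f))"

lemma fr_apply: "fr v b = v b ^ CARD('f)"
  by (simp add: fr_def)

lemma fr_V: "v \<in> V \<Longrightarrow> fr v \<in> V"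
  unfolding V_def fr_def by (simp add: frobenius_add power_mult_distrib frobenius_to_ac)

lemma fr_inj: "fr v = fr w \<Longrightarrow> v = w"
  unfolding fr_def by (meson ext frobenius_inj fun_cong)

lemma fr_bij: "bij_betw fr V V"
  unfolding bij_betw_def
proof
  show "inj_on fr V" by (rule inj_onI) (rule fr_inj)
  thus "fr ` V = V" using fr_V finite_V by (intro endo_inj_surj) auto
qed

lemma sum_V_fixed:
  assumes "\<And>v. v \<in> V \<Longrightarrow> lam (fr v) = lam v ^ CARD('f)"
  shows "\<exists>c. (\<Sum>v\<in>V. v b * lam v) = to_ac (c :: 'f)"
proof (rule frobenius_fixed_imp_to_ac)
  have "(\<Sum>v\<in>V. v b * lam v) ^ CARD('f) = (\<Sum>v\<in>V. fr v b * lam (fr v))"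
    unfolding frobenius_sum by (rule sum.cong) (simp_all add: assms fr_apply power_mult_distrib)
  also have "\<dots> = (\<Sum>v\<in>V. v b * lam v)" by (rule sum.reindex_bij_betw[OF fr_bij])
  finally show "(\<Sum>v\<in>V. v b * lam v) ^ CARD('f) = (\<Sum>v\<in>V. v b * lam v)" .
qed

text \<open>Fourier inversion on S. Equivariance of \<open>lam\<close> makes the coefficients \<Sum>
  v(b) lam(v) Frobenius-fixed, hence elements of F_q, so the inverse transform can be formed inside
  B; orthogonality recovers \<open>lam\<close> up to sign. The coefficients c stay in the statement
  for the sake of \<open>V_reproducing\<close>.\<close>

lemma V_interpolation:
  assumes "\<And>v. v \<in> V \<Longrightarrow> lam (fr v) = lam v ^ CARD('f)"
  shows "\<exists>c. (\<forall>b. (\<Sum>v\<in>V. v b * lam v) = to_ac (c b :: 'f)) \<and>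
    sd (\<Sum>y\<in>U. scale (c (iv y)) y) = (\<Sum>y\<in>U. scale (c (iv y)) y) \<and>
    (\<forall>v\<in>V. v (\<Sum>y\<in>U. scale (c (iv y)) y) = - lam v)"
proof -
  obtain c where c: "\<And>b. (\<Sum>v\<in>V. v b * lam v) = to_ac (c b :: 'f)"
    using sum_V_fixed[of lam, OF assms] by metis
  show ?thesis
  proof (intro exI[of _ c] conjI allI ballI c)
    show "sd (\<Sum>y\<in>U. scale (c (iv y)) y) = (\<Sum>y\<in>U. scale (c (iv y)) y)"
      unfolding sd_sum by (rule sum.cong) (simp_all add: sd_scale U_sd)
    fix v assume v: "v \<in> V"
    have "v (\<Sum>y\<in>U. scale (c (iv y)) y) = (\<Sum>y\<in>U. \<Sum>w\<in>V. lam w * (w (iv y) * v y))"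
      unfolding V_sum[OF v] V_scale[OF v] c[symmetric] sum_distrib_right by (simp add: mult_ac)
    also have "\<dots> = (\<Sum>w\<in>V. lam w * (\<Sum>y\<in>U. w (iv y) * v y))"
      by (subst sum.swap) (simp add: sum_distrib_left)
    also have "\<dots> = (\<Sum>w\<in>V. if w = v then - lam v else 0)"
      by (rule sum.cong) (simp_all add: V_orthogonality v)
    also have "\<dots> = - lam v" using finite_V v by simp
    finally show "v (\<Sum>y\<in>U. scale (c (iv y)) y) = - lam v" .
  qed
qed

lemma V_surjective:
  assumes "\<And>v. v \<in> V \<Longrightarrow> lam (fr v) = lam v ^ CARD('f)"
  shows "\<exists>s. sd s = s \<and> (\<forall>v\<in>V. v s = lam v)"
proof -
  obtain c where c: "sd (\<Sum>y\<in>U. scale (c (iv y)) y) = (\<Sum>y\<in>U. scale (c (iv y)) y)"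
    "\<forall>v\<in>V. v (\<Sum>y\<in>U. scale (c (iv y)) y) = - lam v"
    using V_interpolation[of lam, OF assms] by blast
  have "sd (- (\<Sum>y\<in>U. scale (c (iv y)) y)) = - (\<Sum>y\<in>U. scale (c (iv y)) y)"
    using sd_diff[of 0 "\<Sum>y\<in>U. scale (c (iv y)) y"] c(1) by simp
  moreover have "\<forall>v\<in>V. v (- (\<Sum>y\<in>U. scale (c (iv y)) y)) = lam v"
  proof
    fix v assume v: "v \<in> V"
    show "v (- (\<Sum>y\<in>U. scale (c (iv y)) y)) = lam v" using bspec[OF c(2) v] V_minus[OF v] by simp
  qed
  ultimately show ?thesis by blast
qed

text \<open>The element interpolating the constant function 1 takes the value -1 at every v, so
  \<open>V_separates\<close> identifies it with -1. Read as a sum over w, the identity decomposes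
  \<nu> into its right w-components, up to sign.\<close>

lemma V_reproducing:
  fixes \<nu> :: "'b \<Rightarrow> 'f alg_closure"
  assumes add: "\<And>x y. \<nu> (x + y) = \<nu> x + \<nu> y" and scale: "\<And>c x. \<nu> (scale c x) = to_ac c * \<nu> x"
  shows "(\<Sum>w\<in>V. \<Sum>y\<in>U. w (iv y) * \<nu> (b * y)) = - \<nu> b"
proof -
  have "\<exists>c. (\<forall>b. (\<Sum>v\<in>V. v b * 1) = to_ac (c b :: 'f)) \<and>
    sd (\<Sum>y\<in>U. scale (c (iv y)) y) = (\<Sum>y\<in>U. scale (c (iv y)) y) \<and>
    (\<forall>v\<in>V. v (\<Sum>y\<in>U. scale (c (iv y)) y) = - 1)"
    by (rule V_interpolation[of "\<lambda>_. 1"]) simp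
  then obtain c where c: "\<And>b. (\<Sum>v\<in>V. v b * 1) = to_ac (c b :: 'f)"
    "sd (\<Sum>y\<in>U. scale (c (iv y)) y) = (\<Sum>y\<in>U. scale (c (iv y)) y)"
    "\<And>v. v \<in> V \<Longrightarrow> v (\<Sum>y\<in>U. scale (c (iv y)) y) = - 1"
    by blast
  define z where "z = (\<Sum>y\<in>U. scale (c (iv y)) y)"
  have "sd (z + 1) = 0"
  proof (rule V_separates)
    fix v assume v: "v \<in> V"
    show "v (z + 1) = 0" using c(3)[OF v] by (simp add: V_add[OF v] V_1[OF v] z_def[symmetric])
  qed
  hence z: "z = - 1" using c(2) by (simp add: sd_add z_def eq_neg_iff_add_eq_0)
  have \<nu>_0: "\<nu> 0 = 0" using scale[of 0 0] by simp
  have \<nu>_sum: "\<nu> (sum g A) = (\<Sum>a\<in>A. \<nu> (g a))" for g :: "'b \<Rightarrow> 'b" and A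
    by (induction A rule: infinite_finite_induct) (simp_all add: \<nu>_0 add)
  have "(\<Sum>w\<in>V. \<Sum>y\<in>U. w (iv y) * \<nu> (b * y)) = (\<Sum>y\<in>U. to_ac (c (iv y)) * \<nu> (b * y))"
    by (subst sum.swap) (simp add: sum_distrib_right[symmetric] c(1)[symmetric])
  also have "\<dots> = \<nu> (b * z)"
    by (simp add: z_def sum_distrib_left scale_mult_right \<nu>_sum scale)
  also have "\<dots> = - \<nu> b"
    using add[of b "- b"] by (simp add: z \<nu>_0 eq_neg_iff_add_eq_0 add.commute)
  finally show ?thesis .
qed

end

section \<open>Arrow functionals\<close>

context dual_system begin

text \<open>For additive h and v in V, minus \<open>AL v h\<close> is the projection of h to the
  functionals with \<mu>(s b) = v(s) \<mu>(b) for s in S; \<open>AR\<close> does the same on the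
  right.\<close>

definition AL :: "('b \<Rightarrow> 'f alg_closure) \<Rightarrow> ('b \<Rightarrow> 'f alg_closure) \<Rightarrow> 'b \<Rightarrow> 'f alg_closure" where
  "AL v h b = (\<Sum>x\<in>U. v (iv x) * h (x * b))"

definition AR :: "('b \<Rightarrow> 'f alg_closure) \<Rightarrow> ('b \<Rightarrow> 'f alg_closure) \<Rightarrow> 'b \<Rightarrow> 'f alg_closure" where
  "AR w h b = (\<Sum>y\<in>U. w (iv y) * h (b * y))"

lemma AL_add: "(\<And>x y. h (x + y) = h x + h y) \<Longrightarrow> AL v h (x + y) = AL v h x + AL v h y"
  by (simp add: AL_def distrib_left sum.distrib)

lemma AR_add: "(\<And>x y. h (x + y) = h x + h y) \<Longrightarrow> AR v h (x + y) = AR v h x + AR v h y"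
  by (simp add: AR_def distrib_right distrib_left sum.distrib)

lemma AL_mult:
  assumes v: "v \<in> V" and h: "\<And>x y. h (x + y) = h x + h y" and s: "sd s = s"
  shows "AL v h (s * b) = v s * AL v h b"
  unfolding AL_def
  by (rule average_left[where act = "\<lambda>x z. v x * z", OF _ _ _ h s]) (simp_all add: V_mult[OF v] V_add[OF v] algebra_simps)

lemma AR_mult:
  assumes v: "v \<in> V" and h: "\<And>x y. h (x + y) = h x + h y" and s: "sd s = s"
  shows "AR v h (b * s) = v s * AR v h b"
  unfolding AR_def
  by (rule average_right[where act = "\<lambda>x z. v x * z", OF _ _ _ h s]) (simp_all add: V_mult[OF v] V_add[OF v] algebra_simps)

text \<open>The F_q-valued functionals on J/J2, extended by zero to S. Values are taken in k, where
  lying in F_q means being fixed by Frobenius.\<close>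

definition Rat :: "('b \<Rightarrow> 'f alg_closure) set" where
  "Rat = {\<nu>. (\<forall>x y. \<nu> (x + y) = \<nu> x + \<nu> y) \<and> (\<forall>c x. \<nu> (scale c x) = to_ac c * \<nu> x) \<and>
    (\<forall>s. sd s = s \<longrightarrow> \<nu> s = 0) \<and> (\<forall>x y. sd x = 0 \<longrightarrow> sd y = 0 \<longrightarrow> \<nu> (x * y) = 0) \<and>
    (\<forall>b. \<nu> b ^ CARD('f) = \<nu> b)}"

lemma Rat_add: "\<nu> \<in> Rat \<Longrightarrow> \<nu> (x + y) = \<nu> x + \<nu> y"
  and Rat_scale: "\<nu> \<in> Rat \<Longrightarrow> \<nu> (scale c x) = to_ac c * \<nu> x"
  and Rat_sd: "\<nu> \<in> Rat \<Longrightarrow> sd s = s \<Longrightarrow> \<nu> s = 0"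
  and Rat_J2: "\<nu> \<in> Rat \<Longrightarrow> sd x = 0 \<Longrightarrow> sd y = 0 \<Longrightarrow> \<nu> (x * y) = 0"
  and Rat_fixed: "\<nu> \<in> Rat \<Longrightarrow> \<nu> b ^ CARD('f) = \<nu> b"
  unfolding Rat_def by blast+

lemma finite_Rat: "finite Rat"
proof -
  have "finite (PiE (UNIV :: 'b set) (\<lambda>_. range (to_ac :: 'f \<Rightarrow> 'f alg_closure)))" by (intro finite_PiE) simp_all
  moreover have "Rat \<subseteq> PiE UNIV (\<lambda>_. range (to_ac :: 'f \<Rightarrow> 'f alg_closure))"
    using frobenius_fixed_imp_to_ac Rat_fixed by fastforce
  ultimately show ?thesis by (rule rev_finite_subset)
qed

text \<open>The (v, w)-component of \<nu>; the signs of the two averages cancel.\<close>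

definition pr where "pr v w \<nu> = AL v (AR w \<nu>)"

lemma pr_eq: "pr v w \<nu> b = (\<Sum>x\<in>U. \<Sum>y\<in>U. v (iv x) * w (iv y) * \<nu> (x * b * y))"
  by (simp add: pr_def AL_def AR_def sum_distrib_left mult.assoc)

lemma pr_add: "\<nu> \<in> Rat \<Longrightarrow> pr v w \<nu> (x + y) = pr v w \<nu> x + pr v w \<nu> y"
  unfolding pr_def by (intro AL_add AR_add Rat_add)

lemma pr_sd: "\<nu> \<in> Rat \<Longrightarrow> sd s = s \<Longrightarrow> pr v w \<nu> s = 0"
  unfolding pr_eq by (intro sum.neutral ballI) (simp add: Rat_sd sd_mult U_sd)

lemma pr_J2: assumes "\<nu> \<in> Rat" "sd b = 0" "sd b' = 0" shows "pr v w \<nu> (b * b') = 0"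
  unfolding pr_eq
proof (intro sum.neutral ballI)
  fix x y
  have "\<nu> ((x * b) * (b' * y)) = 0" using assms by (intro Rat_J2) (simp_all add: sd_mult)
  thus "v (iv x) * w (iv y) * \<nu> (x * (b * b') * y) = 0" by (simp add: mult.assoc)
qed

lemma pr_mult_left: "\<nu> \<in> Rat \<Longrightarrow> v \<in> V \<Longrightarrow> sd s = s \<Longrightarrow> pr v w \<nu> (s * b) = v s * pr v w \<nu> b"
  unfolding pr_def by (intro AL_mult AR_add Rat_add)

lemma pr_mult_right:
  assumes "\<nu> \<in> Rat" "w \<in> V" "sd s = s"
  shows "pr v w \<nu> (b * s) = pr v w \<nu> b * w s"
proof -
  have "AR w \<nu> (x * (b * s)) = w s * AR w \<nu> (x * b)" for x
    using AR_mult[OF assms(2) _ assms(3), of \<nu> "x * b"] Rat_add[OF assms(1)] by (simp add: mult.assoc)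
  thus ?thesis by (simp add: pr_def AL_def sum_distrib_left mult_ac)
qed

text \<open>Of the products of S- and J-parts of x and y, those inside S and inside J2 are killed
  and the mixed ones follow by equivariance. The resulting derivation rule holds on all of B and
  spares later case distinctions.\<close>

lemma pr_mult:
  assumes \<nu>: "\<nu> \<in> Rat" and v: "v \<in> V" and w: "w \<in> V"
  shows "pr v w \<nu> (x * y) = v x * pr v w \<nu> y + pr v w \<nu> x * w y"
proof -
  have eq: "x * y = sd x * sd y + sd x * jd y + jd x * sd y + jd x * jd y"
    by (simp add: jd_def algebra_simps)
  have jd: "pr v w \<nu> (jd b) = pr v w \<nu> b" for b
    using pr_add[OF \<nu>, of v w "sd b" "jd b"] pr_sd[OF \<nu>, of "sd b"] by (simp add: sd_plus_jd)
  have "pr v w \<nu> (x * y) = v x * pr v w \<nu> y + w y * pr v w \<nu> x"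
    unfolding eq pr_add[OF \<nu>]
    by (simp add: pr_sd[OF \<nu>] sd_mult pr_mult_left[OF \<nu> v] pr_mult_right[OF \<nu> w] pr_J2[OF \<nu>] jd V_sd[OF v] V_sd[OF w])
  thus ?thesis by (simp add: mult.commute)
qed

text \<open>The values of \<nu> are fixed by Frobenius, so only v and w are conjugated. This is what
  lets \<sigma> permute arrows.\<close>

lemma pr_frobenius: "\<nu> \<in> Rat \<Longrightarrow> pr v w \<nu> b ^ CARD('f) = pr (fr v) (fr w) \<nu> b"
  unfolding pr_eq frobenius_sum fr_def power_mult_distrib by (simp add: Rat_fixed)

section \<open>A choice of arrows compatible with Frobenius\<close>

abbreviation comb where
  "comb v w R k b \<equiv> \<Sum>\<rho>\<in>R. k \<rho> * pr v w \<rho> b"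

text \<open>R consists of rational functionals rather than their projections, so that one R can
  provide a basis for several pairs (v, w) at once.\<close>

definition is_basis where
  "is_basis v w R \<longleftrightarrow> R \<subseteq> Rat \<and>
    (\<forall>k. (\<forall>b. comb v w R k b = 0) \<longrightarrow> (\<forall>\<rho>\<in>R. k \<rho> = 0)) \<and>
    (\<forall>\<nu>\<in>Rat. \<exists>k. \<forall>b. pr v w \<nu> b = (comb v w R k b))"

lemma is_basis_ex: "\<exists>R. is_basis v w R"
proof -
  define ind where "ind = (\<lambda>R. R \<subseteq> Rat \<and> (\<forall>k. (\<forall>b. comb v w R k b = 0) \<longrightarrow> (\<forall>\<rho>\<in>R. k \<rho> = 0)))"
  have "ind {}" by (simp add: ind_def)
  moreover have "\<forall>R. ind R \<longrightarrow> card R < Suc (card Rat)" using card_mono[OF finite_Rat] by (auto simp: ind_def less_Suc_eq_le)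
  ultimately obtain R where R: "ind R" and max: "\<And>R'. ind R' \<Longrightarrow> card R' \<le> card R"
    using ex_has_greatest_nat[of ind "{}" card "Suc (card Rat)"] by blast
  have R_Rat: "R \<subseteq> Rat" using R by (simp add: ind_def)
  hence finR: "finite R" using finite_Rat finite_subset by blast
  have "\<exists>k. \<forall>b. pr v w \<nu> b = comb v w R k b" if \<nu>: "\<nu> \<in> Rat" for \<nu>
  proof (cases "\<nu> \<in> R")
    case True
    have "pr v w \<nu> b = (\<Sum>\<rho>\<in>R. (if \<rho> = \<nu> then 1 else 0) * pr v w \<rho> b)" for b
      using True finR by (simp add: if_distrib[of "\<lambda>x. x * _"] cong: if_cong)
    thus ?thesis by (intro exI[of _ "\<lambda>\<rho>. if \<rho> = \<nu> then 1 else 0"] allI)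
  next
    case False
    hence "card (insert \<nu> R) > card R" using finR by simp
    hence "\<not> ind (insert \<nu> R)" using max[of "insert \<nu> R"] by linarith
    then obtain k \<rho>0 where k: "\<And>b. (\<Sum>\<rho>\<in>insert \<nu> R. k \<rho> * pr v w \<rho> b) = 0" "\<rho>0 \<in> insert \<nu> R" "k \<rho>0 \<noteq> 0"
      using \<nu> R_Rat unfolding ind_def by auto
    have sum: "k \<nu> * pr v w \<nu> b + comb v w R k b = 0" for b
      using k(1)[of b] False finR by simp
    have "k \<nu> \<noteq> 0"
    proof
      assume 0: "k \<nu> = 0"
      hence "\<forall>\<rho>\<in>R. k \<rho> = 0" using sum R unfolding ind_def by simp
      thus False using k(2,3) 0 by auto
    qed
    have "pr v w \<nu> b = (\<Sum>\<rho>\<in>R. (- k \<rho> / k \<nu>) * pr v w \<rho> b)" for b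
    proof -
      have "(\<Sum>\<rho>\<in>R. (- k \<rho> / k \<nu>) * pr v w \<rho> b) = - (comb v w R k b) / k \<nu>"
        by (simp add: sum_negf sum_divide_distrib)
      also have "- (comb v w R k b) = k \<nu> * pr v w \<nu> b"
        using sum[of b] by (simp add: add_eq_0_iff2)
      finally show ?thesis using \<open>k \<nu> \<noteq> 0\<close> by simp
    qed
    thus ?thesis by (intro exI[of _ "\<lambda>\<rho>. - k \<rho> / k \<nu>"] allI)
  qed
  thus ?thesis using R unfolding is_basis_def ind_def by blast
qed

text \<open>Raising a linear combination to the q-th power conjugates the pair and raises the
  coefficients to the q-th power. As k contains q-th roots, this is a semilinear bijection, so it
  preserves independence and spanning.\<close>

lemma is_basis_fr: "is_basis (fr v) (fr w) R \<longleftrightarrow> is_basis v w R"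
proof (cases "R \<subseteq> Rat")
  case R: True
  have key: "(comb v w R k b) ^ CARD('f) = (\<Sum>\<rho>\<in>R. k \<rho> ^ CARD('f) * pr (fr v) (fr w) \<rho> b)" for k b
    unfolding frobenius_sum using R by (intro sum.cong) (auto simp: power_mult_distrib pr_frobenius)
  obtain rt :: "'f alg_closure \<Rightarrow> 'f alg_closure" where rt: "\<And>x. rt x ^ CARD('f) = x"
    using frobenius_surj by metis
  have rt0: "rt x = 0 \<longleftrightarrow> x = 0" for x using frobenius_eq_0_iff[of "rt x"] by (simp add: rt)
  have key': "(\<Sum>\<rho>\<in>R. rt (k \<rho>) * pr v w \<rho> b) ^ CARD('f) = comb (fr v) (fr w) R k b" for k b
    by (simp add: key rt)
  show ?thesis
  proof
    assume B: "is_basis (fr v) (fr w) R"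
    show "is_basis v w R"
      unfolding is_basis_def
    proof (intro conjI allI impI ballI R)
      fix k \<rho> assume "\<forall>b. comb v w R k b = 0" "\<rho> \<in> R"
      hence "\<forall>b. (\<Sum>\<rho>\<in>R. k \<rho> ^ CARD('f) * pr (fr v) (fr w) \<rho> b) = 0" by (simp flip: key)
      hence "\<forall>\<rho>\<in>R. k \<rho> ^ CARD('f) = 0" using B unfolding is_basis_def by (elim conjE allE[of _ "\<lambda>\<rho>. k \<rho> ^ CARD('f)"]) blast
      thus "k \<rho> = 0" using \<open>\<rho> \<in> R\<close> by simp
    next
      fix \<nu> assume \<nu>: "\<nu> \<in> Rat"
      then obtain k where k: "\<And>b. pr (fr v) (fr w) \<nu> b = comb (fr v) (fr w) R k b"
        using B unfolding is_basis_def by blast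
      have "pr v w \<nu> b = (\<Sum>\<rho>\<in>R. rt (k \<rho>) * pr v w \<rho> b)" for b
        by (rule frobenius_inj) (simp only: key' pr_frobenius[OF \<nu>] k)
      thus "\<exists>k. \<forall>b. pr v w \<nu> b = comb v w R k b" by (intro exI[of _ "\<lambda>\<rho>. rt (k \<rho>)"] allI)
    qed
  next
    assume B: "is_basis v w R"
    show "is_basis (fr v) (fr w) R"
      unfolding is_basis_def
    proof (intro conjI allI impI ballI R)
      fix k \<rho> assume 0: "\<forall>b. (comb (fr v) (fr w) R k b) = 0" "\<rho> \<in> R"
      have "(\<Sum>\<rho>\<in>R. rt (k \<rho>) * pr v w \<rho> b) ^ CARD('f) = 0" for b using 0(1) by (simp only: key')
      hence "\<forall>b. (\<Sum>\<rho>\<in>R. rt (k \<rho>) * pr v w \<rho> b) = 0" by simp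
      hence "\<forall>\<rho>\<in>R. rt (k \<rho>) = 0" using B unfolding is_basis_def by (elim conjE allE[of _ "\<lambda>\<rho>. rt (k \<rho>)"]) blast
      thus "k \<rho> = 0" using \<open>\<rho> \<in> R\<close> by (simp add: rt0)
    next
      fix \<nu> assume \<nu>: "\<nu> \<in> Rat"
      then obtain k where k: "\<And>b. pr v w \<nu> b = comb v w R k b"
        using B unfolding is_basis_def by blast
      have "pr (fr v) (fr w) \<nu> b = (\<Sum>\<rho>\<in>R. k \<rho> ^ CARD('f) * pr (fr v) (fr w) \<rho> b)" for b
        by (simp only: key[symmetric] pr_frobenius[OF \<nu>, symmetric] k)
      thus "\<exists>k. \<forall>b. pr (fr v) (fr w) \<nu> b = comb (fr v) (fr w) R k b"
        by (intro exI[of _ "\<lambda>\<rho>. k \<rho> ^ CARD('f)"] allI)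
    qed
  qed
qed (simp add: is_basis_def)

text \<open>By \<open>is_basis_fr\<close>, the choice depends only on the Frobenius orbit of \<open>(v, w)\<close>.\<close>

definition Rb where "Rb v w = (SOME R. is_basis v w R)"

lemma Rb: "is_basis v w (Rb v w)"
  unfolding Rb_def using is_basis_ex by (rule someI_ex)

lemma Rb_fr: "Rb (fr v) (fr w) = Rb v w"
  unfolding Rb_def is_basis_fr ..

lemma Rb_Rat: "\<rho> \<in> Rb v w \<Longrightarrow> \<rho> \<in> Rat"
  using Rb[of v w] unfolding is_basis_def by blast

lemma finite_Rb: "finite (Rb v w)"
  using Rb_Rat finite_Rat finite_subset by (metis subsetI)

lemma Rb_independent: "(\<And>b. (comb v w (Rb v w) k b) = 0) \<Longrightarrow> \<rho> \<in> Rb v w \<Longrightarrow> k \<rho> = 0"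
  using Rb[of v w] unfolding is_basis_def by (elim conjE allE[of _ k]) blast

text \<open>Averaging the relation on the right with w0 isolates its w0-part, by orthogonality;
  within one pair \<open>Rb\<close> is independent.\<close>

lemma Rb_independent':
  assumes w0: "w0 \<in> V" and \<rho>: "\<rho> \<in> Rb v w0"
    and sum0: "\<And>b. (\<Sum>w\<in>V. \<Sum>\<rho>\<in>Rb v w. k w \<rho> * pr v w \<rho> b) = 0"
  shows "k w0 \<rho> = 0"
proof (rule Rb_independent[OF _ \<rho>])
  fix b
  have "0 = (\<Sum>y\<in>U. w0 (iv y) * (\<Sum>w\<in>V. \<Sum>\<rho>\<in>Rb v w. k w \<rho> * pr v w \<rho> (b * y)))"
    by (simp add: sum0)
  also have "\<dots> = (\<Sum>w\<in>V. \<Sum>y\<in>U. w0 (iv y) * (comb v w (Rb v w) (k w) (b * y)))"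
    unfolding sum_distrib_left[of _ _ V] by (rule sum.swap)
  also have "\<dots> = (\<Sum>w\<in>V. (\<Sum>y\<in>U. w0 (iv y) * w y) * (comb v w (Rb v w) (k w) b))"
  proof (rule sum.cong)
    fix w assume w: "w \<in> V"
    have "w0 (iv y) * (comb v w (Rb v w) (k w) (b * y)) = w0 (iv y) * w y * (comb v w (Rb v w) (k w) b)"
      if "y \<in> U" for y
    proof -
      have "(comb v w (Rb v w) (k w) (b * y)) = w y * (comb v w (Rb v w) (k w) b)"
        unfolding sum_distrib_left
        by (rule sum.cong) (simp_all add: pr_mult_right[OF Rb_Rat w U_sd[OF that]])
      thus ?thesis by simp
    qed
    thus "(\<Sum>y\<in>U. w0 (iv y) * (comb v w (Rb v w) (k w) (b * y))) =
        (\<Sum>y\<in>U. w0 (iv y) * w y) * (comb v w (Rb v w) (k w) b)"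
      unfolding sum_distrib_right by (rule sum.cong[OF refl])
  qed simp
  also have "\<dots> = (\<Sum>w\<in>V. if w = w0 then - (comb v w0 (Rb v w0) (k w0) b) else 0)"
    by (rule sum.cong) (auto simp: V_orthogonality[OF w0])
  also have "\<dots> = - (comb v w0 (Rb v w0) (k w0) b)" using w0 finite_V by simp
  finally show "(comb v w0 (Rb v w0) (k w0) b) = 0" by simp
qed

lemma fl_sum: "l \<in> L \<Longrightarrow> fl l (sum g A) = (\<Sum>a\<in>A. fl l (g a))"
  by (induction A rule: infinite_finite_induct) (simp_all add: fl_add fl_sd)

lemma fl_jd: "l \<in> L \<Longrightarrow> fl l (jd b) = fl l b"
  using fl_add[of l "sd b" "jd b"] fl_sd[of l "sd b"] by (simp add: sd_plus_jd)

lemma fl_mult_sd: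
  assumes l: "l \<in> L" and s: "sd s = s" shows "fl l (s * b) = s * fl l b"
proof -
  have "s * b = s * sd b + s * jd b" by (simp flip: distrib_left add: sd_plus_jd)
  thus ?thesis using fl_mult[OF l sd_jd, of s b] fl_sd[OF l, of "s * sd b"]
    by (simp add: fl_add[OF l] fl_jd[OF l] sd_mult s)
qed

text \<open>The trace-like functional \<mu>, the sum of u(fl l b) over all u in V, is F_q-valued,
  although a single v(fl l b) need not be. Its left v-component is v(fl l b), and
  \<open>V_reproducing\<close> splits that further into (v, w)-components, which \<open>Rb\<close>
  spans.\<close>

lemma coordinate_expansion:
  assumes l: "l \<in> L" and v: "v \<in> V"
  shows "\<exists>k. \<forall>b. v (fl l b) = (\<Sum>w\<in>V. \<Sum>\<rho>\<in>Rb v w. k w \<rho> * pr v w \<rho> b)"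
proof -
  define \<mu> where "\<mu> = (\<lambda>b. \<Sum>u\<in>V. u (fl l b))"
  have \<mu>: "\<mu> \<in> Rat"
    unfolding Rat_def
  proof (intro CollectI conjI allI impI)
    show "\<mu> (x + y) = \<mu> x + \<mu> y" for x y by (simp add: \<mu>_def fl_add[OF l] V_add sum.distrib)
    show "\<mu> (scale c x) = to_ac c * \<mu> x" for c x
    proof -
      have "fl l (scale c x) = scale c (fl l x)"
        using fl_mult_sd[OF l, of "scale c 1" x] by (simp add: sd_scale scale_mult_left)
      thus ?thesis by (simp add: \<mu>_def V_scale sum_distrib_left)
    qed
    show "\<mu> s = 0" if "sd s = s" for s using that by (simp add: \<mu>_def fl_sd[OF l] V_0)
    show "\<mu> (x * y) = 0" if "sd x = 0" "sd y = 0" for x y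
      using that by (simp add: \<mu>_def fl_mult[OF l] V_mult V_radical)
    fix b
    have "\<mu> b ^ CARD('f) = (\<Sum>u\<in>V. fr u (fl l b))" by (simp add: \<mu>_def frobenius_sum fr_def)
    also have "\<dots> = \<mu> b" unfolding \<mu>_def by (rule sum.reindex_bij_betw[OF fr_bij])
    finally show "\<mu> b ^ CARD('f) = \<mu> b" .
  qed
  have "\<forall>w. \<exists>k. \<forall>b. pr v w \<mu> b = (comb v w (Rb v w) k b)"
    using Rb \<mu> unfolding is_basis_def by blast
  then obtain k where k: "\<And>w b. pr v w \<mu> b = (comb v w (Rb v w) (k w) b)" by metis
  have "v (fl l b) = (\<Sum>w\<in>V. pr v w \<mu> b)" for b
  proof -
    have "(\<Sum>w\<in>V. pr v w \<mu> b) = (\<Sum>x\<in>U. v (iv x) * (\<Sum>w\<in>V. AR w \<mu> (x * b)))"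
      unfolding pr_def AL_def by (subst sum.swap) (simp add: sum_distrib_left)
    also have "\<dots> = (\<Sum>x\<in>U. v (iv x) * - (\<Sum>u\<in>V. u x * u (fl l b)))"
    proof (rule sum.cong)
      fix x assume x: "x \<in> U"
      have "(\<Sum>w\<in>V. AR w \<mu> (x * b)) = - \<mu> (x * b)"
        unfolding AR_def by (rule V_reproducing) (use \<mu> in \<open>simp_all add: Rat_add Rat_scale\<close>)
      also have "\<mu> (x * b) = (\<Sum>u\<in>V. u x * u (fl l b))"
        unfolding \<mu>_def by (rule sum.cong) (simp_all add: fl_mult_sd[OF l U_sd[OF x]] V_mult)
      finally show "v (iv x) * (\<Sum>w\<in>V. AR w \<mu> (x * b)) = v (iv x) * - (\<Sum>u\<in>V. u x * u (fl l b))" by simp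
    qed simp
    also have "\<dots> = (\<Sum>u\<in>V. - (\<Sum>x\<in>U. v (iv x) * u x) * u (fl l b))"
      by (simp add: sum_distrib_left sum_distrib_right sum_negf mult_ac) (rule sum.swap)
    also have "\<dots> = (\<Sum>u\<in>V. if u = v then v (fl l b) else 0)"
      by (rule sum.cong) (auto simp: V_orthogonality[OF v])
    also have "\<dots> = v (fl l b)" using v finite_V by simp
    finally show ?thesis ..
  qed
  thus ?thesis using k by (intro exI[of _ k]) simp
qed

end

section \<open>Coefficients along paths\<close>

abbreviation (input) lookup where "lookup \<equiv> Poly_Mapping.lookup"

text \<open>Isolates what the path calculus needs: at each vertex u, the functionals of the arrows
  into u are independent and their span contains every \<open>vh u\<close> composed with
  \<open>fl l\<close>. The rank \<open>rk\<close> bounds the length of paths.\<close>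

locale path_system = dual_system scale E L idem fl + ad_quiver Q sv sa
  for scale :: "'f::{field, finite} \<Rightarrow> 'b::{ring, monoid_mult} \<Rightarrow> 'b" and E L idem fl
    and Q :: "('v, 'a) pre_digraph" and sv sa +
  fixes vh :: "'v \<Rightarrow> 'b \<Rightarrow> 'f alg_closure" and am :: "'a \<Rightarrow> 'b \<Rightarrow> 'f alg_closure" and rk :: "'v \<Rightarrow> nat"
  assumes vh_bij: "bij_betw vh (verts Q) V"
    and vh_sv: "u \<in> verts Q \<Longrightarrow> vh (sv u) = fr (vh u)"
    and am_add: "a \<in> arcs Q \<Longrightarrow> am a (x + y) = am a x + am a y"
    and am_sd: "a \<in> arcs Q \<Longrightarrow> sd s = s \<Longrightarrow> am a s = 0"
    and am_mult: "a \<in> arcs Q \<Longrightarrow> am a (x * y) = vh (head Q a) x * am a y + am a x * vh (tail Q a) y"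
    and am_sa: "a \<in> arcs Q \<Longrightarrow> am (sa a) b = am a b ^ CARD('f)"
    and am_independent: "u \<in> verts Q \<Longrightarrow> (\<And>b. (\<Sum>a\<in>{a \<in> arcs Q. head Q a = u}. c a * am a b) = 0) \<Longrightarrow>
      a \<in> arcs Q \<Longrightarrow> head Q a = u \<Longrightarrow> c a = 0"
    and am_spans: "l \<in> L \<Longrightarrow> u \<in> verts Q \<Longrightarrow>
      \<exists>c. \<forall>b. vh u (fl l b) = (\<Sum>a\<in>{a \<in> arcs Q. head Q a = u}. c a * am a b)"
    and rk_less: "a \<in> arcs Q \<Longrightarrow> rk (head Q a) < rk (tail Q a)"
begin

lemma vh_V: "u \<in> verts Q \<Longrightarrow> vh u \<in> V"
  using vh_bij by (auto simp: bij_betw_def)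

lemma idem_sd: "l \<in> L \<Longrightarrow> sd (idem l) = idem l"
  using sd_D E_mem_D idem_E by blast

lemma am_0: "a \<in> arcs Q \<Longrightarrow> am a 0 = 0"
  using am_sd[of a 0] by simp

lemma am_sum: "a \<in> arcs Q \<Longrightarrow> am a (sum g A) = (\<Sum>i\<in>A. am a (g i))"
  by (induction A rule: infinite_finite_induct) (simp_all add: am_0 am_add)

abbreviation into :: "'v \<Rightarrow> 'a set" where "into u \<equiv> {a \<in> arcs Q. head Q a = u}"

lemma am_expand:
  assumes a: "a \<in> arcs Q"
  shows "am a b = (\<Sum>l\<in>L. vh (head Q a) (fl l b) * am a l)"
proof -
  have "am a b = am a (sd b + (\<Sum>l\<in>L. fl l b * l))" using fl_expand[of b] by simp
  also have "\<dots> = (\<Sum>l\<in>L. am a (fl l b * l))" by (simp add: am_add[OF a] am_sum[OF a] am_sd[OF a])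
  also have "\<dots> = (\<Sum>l\<in>L. vh (head Q a) (fl l b) * am a l)"
    by (rule sum.cong) (simp_all add: am_mult[OF a] V_radical[OF vh_V[OF tail_in_verts[OF a]]] L_sd)
  finally show ?thesis .
qed

lemma am_idem:
  assumes a: "a \<in> arcs Q" and l: "l \<in> L"
  shows "vh (head Q a) (idem l) * am a l = am a l"
  using am_mult[OF a, of "idem l" l] am_sd[OF a idem_sd[OF l]] by (simp add: idem_mult[OF l])

text \<open>The first arrow a of a path is the rightmost factor of the product, and in the expansion
  of b the generator l is rightmost too. So the remaining path is evaluated at \<open>fl l b\<close>
  and a at l: this is a tensor product of functionals on J = B \<otimes>_S M.\<close>

primrec cf :: "'v \<Rightarrow> 'a list \<Rightarrow> 'b \<Rightarrow> 'f alg_closure" where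
  "cf u [] = vh u"
| "cf u (a # p) = (\<lambda>b. \<Sum>l\<in>L. cf (head Q a) p (fl l b) * am a l)"

lemma paths_Nil: "(u, []) \<in> paths Q \<longleftrightarrow> u \<in> verts Q"
proof -
  have "(u, []) \<in> paths Q \<longleftrightarrow> (\<exists>v. awalk u [] v)" by (simp add: paths_def)
  also have "\<dots> \<longleftrightarrow> u \<in> verts Q" unfolding awalk_Nil_iff by blast
  finally show ?thesis .
qed

lemma paths_Cons: "(u, a # p) \<in> paths Q \<longleftrightarrow> a \<in> arcs Q \<and> u = tail Q a \<and> (head Q a, p) \<in> paths Q"
proof -
  have "(u, a # p) \<in> paths Q \<longleftrightarrow> (\<exists>v. awalk u (a # p) v)" by (simp add: paths_def)
  also have "\<dots> \<longleftrightarrow> a \<in> arcs Q \<and> u = tail Q a \<and> (\<exists>v. awalk (head Q a) p v)"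
    unfolding awalk_Cons_iff by blast
  finally show ?thesis by (simp add: paths_def)
qed

lemma paths_verts: "(u, p) \<in> paths Q \<Longrightarrow> u \<in> verts Q"
  by (cases p) (auto simp: paths_Nil paths_Cons)

lemma target_Nil: "path_target Q (u, []) = u"
  and target_Cons: "path_target Q (u, a # p) = path_target Q (head Q a, p)"
  by (simp_all add: path_target_def)

lemma paths_append: "(u, p @ r) \<in> paths Q \<longleftrightarrow> (u, p) \<in> paths Q \<and> (path_target Q (u, p), r) \<in> paths Q"
  by (induction p arbitrary: u) (auto simp: paths_Nil paths_Cons target_Nil target_Cons paths_verts)

lemma cf_add: "(u, p) \<in> paths Q \<Longrightarrow> cf u p (x + y) = cf u p x + cf u p y"
  by (induction p arbitrary: u x y)
    (simp_all add: paths_Nil paths_Cons V_add vh_V fl_add distrib_right sum.distrib)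

lemma fl_scale: assumes l: "l \<in> L" shows "fl l (scale c b) = scale c (fl l b)"
  using fl_mult_sd[OF l, of "scale c 1" b] by (simp add: sd_scale scale_mult_left)

lemma cf_scale: "(u, p) \<in> paths Q \<Longrightarrow> cf u p (scale c b) = to_ac c * cf u p b"
  by (induction p arbitrary: u b)
    (simp_all add: paths_Nil paths_Cons V_scale vh_V fl_scale sum_distrib_left mult.assoc)

lemma cf_0: "(u, p) \<in> paths Q \<Longrightarrow> cf u p 0 = 0"
  using cf_scale[of u p 0 0] by simp

lemma cf_sum: "(u, p) \<in> paths Q \<Longrightarrow> cf u p (sum g A) = (\<Sum>i\<in>A. cf u p (g i))"
  by (induction A rule: infinite_finite_induct) (simp_all add: cf_0 cf_add)

lemma fl_mult_right_sum:
  assumes l: "l \<in> L" and s: "sd s = s"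
  shows "fl l (b * s) = (\<Sum>l'\<in>L. fl l' b * fl l (l' * s))"
proof -
  have "b * s = sd b * s + (\<Sum>l'\<in>L. fl l' b * (l' * s))"
    by (subst fl_expand[of b]) (simp add: distrib_right sum_distrib_right mult.assoc)
  hence "fl l (b * s) = fl l (sd b * s) + (\<Sum>l'\<in>L. fl l (fl l' b * (l' * s)))"
    by (simp add: fl_add[OF l] fl_sum[OF l])
  also have "fl l (sd b * s) = 0" by (rule fl_sd[OF l]) (simp add: sd_mult s)
  also have "(\<Sum>l'\<in>L. fl l (fl l' b * (l' * s))) = (\<Sum>l'\<in>L. fl l' b * fl l (l' * s))"
    by (rule sum.cong) (simp_all add: fl_mult[OF l] sd_mult L_sd)
  finally show ?thesis by simp
qed

text \<open>This is the balancing condition over S behind the recursion for \<open>cf\<close>. The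
  coordinates of l' * s lie in S, so the induction hypothesis turns them into values of
  \<open>vh\<close>, and \<open>am_expand\<close> reassembles \<open>am a (l' * s)\<close>.\<close>

lemma cf_mult_sd:
  "(u, p) \<in> paths Q \<Longrightarrow> sd s = s \<Longrightarrow> cf u p (b * s) = cf u p b * vh u s"
proof (induction p arbitrary: u b s)
  case Nil
  thus ?case by (simp add: paths_Nil V_mult vh_V)
next
  case (Cons a p)
  have a: "a \<in> arcs Q" "u = tail Q a" and p: "(head Q a, p) \<in> paths Q" using Cons.prems by (auto simp: paths_Cons)
  have "cf u (a # p) (b * s) = (\<Sum>l\<in>L. \<Sum>l'\<in>L. cf (head Q a) p (fl l' b) * vh (head Q a) (fl l (l' * s)) * am a l)"
    using Cons.IH[OF p] by (simp add: fl_mult_right_sum[OF _ Cons.prems(2), of _ b] Cons.prems(2) cf_sum[OF p] fl_mult_right sum_distrib_right)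
  also have "\<dots> = (\<Sum>l'\<in>L. cf (head Q a) p (fl l' b) * (\<Sum>l\<in>L. vh (head Q a) (fl l (l' * s)) * am a l))"
    by (subst sum.swap) (simp add: sum_distrib_left mult.assoc)
  also have "\<dots> = (\<Sum>l'\<in>L. cf (head Q a) p (fl l' b) * (am a l' * vh u s))"
    unfolding am_expand[OF a(1), symmetric] am_mult[OF a(1)] by (simp add: am_sd[OF a(1) Cons.prems(2)] a(2))
  also have "\<dots> = cf u (a # p) b * vh u s" by (simp add: sum_distrib_right mult.assoc)
  finally show ?case .
qed

text \<open>The S-part of y gives the cut k = 0, where y is evaluated at the trivial path. The
  J-part satisfies fl l (x * jd y) = x * fl l y, and the induction hypothesis supplies the cuts
  after the first arrow.\<close>

lemma cf_mult:
  "(u, p) \<in> paths Q \<Longrightarrow>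
    cf u p (x * y) = (\<Sum>k\<le>length p. cf (path_target Q (u, take k p)) (drop k p) x * cf u (take k p) y)"
proof (induction p arbitrary: u x y)
  case Nil
  thus ?case by (simp add: paths_Nil V_mult vh_V target_Nil)
next
  case (Cons a p)
  have a: "a \<in> arcs Q" "u = tail Q a" and p: "(head Q a, p) \<in> paths Q" using Cons.prems by (auto simp: paths_Cons)
  have u: "vh u \<in> V" using Cons.prems vh_V paths_verts by blast
  have fl: "fl l (x * y) = fl l (x * sd y) + x * fl l y" if l: "l \<in> L" for l
  proof -
    have "x * y = x * sd y + x * jd y" by (simp flip: distrib_left add: sd_plus_jd)
    thus ?thesis using fl_mult[OF l sd_jd, of x y] by (simp add: fl_add[OF l] fl_jd[OF l])
  qed
  have "cf u (a # p) (x * y) = (\<Sum>l\<in>L. (cf (head Q a) p (fl l (x * sd y)) + cf (head Q a) p (x * fl l y)) * am a l)"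
    by (simp add: fl cf_add[OF p])
  also have "\<dots> = cf u (a # p) (x * sd y) + (\<Sum>l\<in>L. cf (head Q a) p (x * fl l y) * am a l)"
    by (simp add: distrib_right sum.distrib)
  also have "cf u (a # p) (x * sd y) = cf u (a # p) x * vh u y"
    using cf_mult_sd[OF Cons.prems, of "sd y" x] by (simp only: sd_sd V_sd[OF u])
  also have "(\<Sum>l\<in>L. cf (head Q a) p (x * fl l y) * am a l) =
      (\<Sum>k\<le>length p. cf (path_target Q (head Q a, take k p)) (drop k p) x * cf u (a # take k p) y)"
    unfolding Cons.IH[OF p] sum_distrib_right
    by (subst sum.swap) (simp add: sum_distrib_left mult.assoc)
  finally show ?case by (simp only: length_Cons sum.atMost_Suc_shift) (simp add: target_Nil target_Cons del: cf.simps(2))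
qed

lemma cf_1: "(u, p) \<in> paths Q \<Longrightarrow> cf u p 1 = (if p = [] then 1 else 0)"
  by (cases p) (simp_all add: paths_Nil paths_Cons V_1 vh_V fl_sd cf_0)

lemma cf_frobenius: "(u, p) \<in> paths Q \<Longrightarrow> cf (sv u) (map sa p) b = cf u p b ^ CARD('f)"
  by (induction p arbitrary: u b)
    (simp_all add: paths_Nil paths_Cons vh_sv fr_def frobenius_sum head_sa am_sa power_mult_distrib)

text \<open>Vanishing is inherited by every \<open>fl l b\<close>: by duality its coefficient at p
  is a sum over l' of cf v p (fl l' b) * vh v (fl l l'), and expanding the second factor in arrow
  functionals yields coefficients of b at paths one arrow longer. So \<open>fl l b\<close> lies in
  \<open>filt t\<close> by induction, and b in \<open>filt (t + 1)\<close>.\<close>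

lemma cf_injective:
  assumes "\<And>u p. (u, p) \<in> paths Q \<Longrightarrow> cf u p b = 0"
  shows "b = 0"
proof -
  have "b \<in> filt t" if "\<And>u p. (u, p) \<in> paths Q \<Longrightarrow> cf u p b = 0" for t b
    using that
  proof (induction t arbitrary: b)
    case 0
    show ?case by (rule filt_0)
  next
    case (Suc t)
    have sd_b: "sd b = 0"
    proof (rule V_separates)
      fix v assume "v \<in> V"
      hence "v \<in> vh ` verts Q" using bij_betw_imp_surj_on[OF vh_bij] by simp
      then obtain u where "u \<in> verts Q" "vh u = v" by blast
      thus "v b = 0" using Suc.prems[of u "[]"] by (simp add: paths_Nil)
    qed
    have "fl l b * l \<in> filt (Suc t)" if l: "l \<in> L" for l
    proof -
      have "fl l b \<in> filt t"
      proof (rule Suc.IH)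
        fix v p assume p: "(v, p) \<in> paths Q"
        have v: "v \<in> verts Q" using p by (rule paths_verts)
        obtain c where c: "\<And>b. vh v (fl l b) = (\<Sum>a\<in>into v. c a * am a b)" using am_spans[OF l v] by blast
        have "cf v p (fl l b) = cf v p (fl l b * idem l)" by (simp add: fl_idem[OF l])
        also have "\<dots> = (\<Sum>l'\<in>L. if l' = l then cf v p (fl l b) * vh v (idem l) else 0)"
          using l by (simp add: cf_mult_sd[OF p idem_sd[OF l]])
        also have "\<dots> = (\<Sum>l'\<in>L. cf v p (fl l' b) * vh v (fl l l'))"
          by (rule sum.cong) (auto simp: fl_dual[OF l] V_0[OF vh_V[OF v]])
        also have "\<dots> = (\<Sum>a\<in>into v. c a * (\<Sum>l'\<in>L. cf v p (fl l' b) * am a l'))"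
          unfolding c sum_distrib_left by (subst sum.swap) (simp add: mult_ac)
        also have "\<dots> = 0"
        proof (rule sum.neutral, rule ballI)
          fix a assume a: "a \<in> into v"
          hence "(tail Q a, a # p) \<in> paths Q" using p by (auto simp: paths_Cons)
          from Suc.prems[OF this] show "c a * (\<Sum>l'\<in>L. cf v p (fl l' b) * am a l') = 0" using a by simp
        qed
        finally show "cf v p (fl l b) = 0" .
      qed
      thus ?thesis using filt_mult[of "fl l b" t l 1] filt_1[OF L_sd[OF l]] by simp
    qed
    hence "(\<Sum>l\<in>L. fl l b * l) \<in> filt (Suc t)" by (rule filt_sum)
    thus ?case using fl_expand[of b] sd_b by simp
  qed
  from this[of b "Suc (card E)"] show ?thesis using assms filt_eq_0[of b "Suc (card E)"] by blast
qed

lemma sum_into_sa: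
  assumes v: "v \<in> verts Q"
  shows "(\<Sum>a\<in>into (sv v). h a) = (\<Sum>a\<in>into v. h (sa a))"
proof (rule sum.reindex_bij_witness[of _ sa "inv_into UNIV sa"])
  fix a assume a: "a \<in> into (sv v)"
  show 1: "sa (inv_into UNIV sa a) = a" using permutes_inverses(1)[OF permutes_arcs] .
  have b: "inv_into UNIV sa a \<in> arcs Q" using permutes_in_image[OF permutes_inv[OF permutes_arcs], of a] a by simp
  have "sv (head Q (inv_into UNIV sa a)) = sv v" using head_sa[OF b] a 1 by simp
  hence "head Q (inv_into UNIV sa a) = v" using permutes_inj[OF permutes_verts] by (simp add: inj_eq)
  thus "inv_into UNIV sa a \<in> into v" using b by simp
  show "h (sa (inv_into UNIV sa a)) = h a" using 1 by simp
next
  fix a assume a: "a \<in> into v"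
  show "inv_into UNIV sa (sa a) = a" using permutes_inverses(2)[OF permutes_arcs] .
  show "sa a \<in> into (sv v)" using a head_sa[of a] permutes_in_image[OF permutes_arcs, of a] by simp
qed

text \<open>Induction on the length. Values prescribed at paths with a first arrow are distributed
  over elements \<open>bl l\<close> by a matrix c inverse to the matrix of the
  \<open>am a l\<close>; the hypothesis applies to them because c is Frobenius-equivariant.\<close>

lemma cf_surjective_bounded:
  assumes "\<And>u p. (u, p) \<in> paths Q \<Longrightarrow> \<Lambda> (sv u, map sa p) = \<Lambda> (u, p) ^ CARD('f)"
  shows "\<exists>b. \<forall>u p. (u, p) \<in> paths Q \<longrightarrow> length p \<le> n \<longrightarrow> cf u p b = \<Lambda> (u, p)"
  using assms
proof (induction n arbitrary: \<Lambda>)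
  case 0
  define g where "g = the_inv_into (verts Q) vh"
  have g: "g v \<in> verts Q" "vh (g v) = v" if "v \<in> V" for v
    using that vh_bij f_the_inv_into_f_bij_betw[OF vh_bij] the_inv_into_into[of vh "verts Q" v "verts Q"]
    by (auto simp: g_def bij_betw_def)
  have g_vh: "g (vh u) = u" if "u \<in> verts Q" for u
    using that vh_bij by (simp add: g_def the_inv_into_f_f bij_betw_def)
  have g_fr: "g (fr v) = sv (g v)" if v: "v \<in> V" for v
  proof -
    have "fr v = vh (sv (g v))" using vh_sv[OF g(1)[OF v]] g(2)[OF v] by simp
    moreover have "sv (g v) \<in> verts Q" using g(1)[OF v] permutes_in_image[OF permutes_verts] by simp
    ultimately show ?thesis using g_vh by simp
  qed
  have "\<exists>s. sd s = s \<and> (\<forall>v\<in>V. v s = \<Lambda> (g v, []))"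
  proof (rule V_surjective[of "\<lambda>v. \<Lambda> (g v, [])"])
    show "\<Lambda> (g (fr v), []) = \<Lambda> (g v, []) ^ CARD('f)" if v: "v \<in> V" for v
      using "0.prems"[of "g v" "[]"] g(1)[OF v] g_fr[OF v] by (simp add: paths_Nil)
  qed
  then obtain s where s: "sd s = s" "\<And>v. v \<in> V \<Longrightarrow> v s = \<Lambda> (g v, [])" by blast
  have "cf u p s = \<Lambda> (u, p)" if "(u, p) \<in> paths Q" "length p \<le> 0" for u p
    using that s(2)[OF vh_V, of u] g_vh[of u] by (simp add: paths_Nil)
  thus ?case by blast
next
  case (Suc n)
  \<comment> \<open>Only the values of s0 at trivial paths are used; its J-part is discarded in
    s.\<close>
  obtain s0 where s0: "\<And>u. u \<in> verts Q \<Longrightarrow> vh u s0 = \<Lambda> (u, [])"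
    using Suc.IH[OF Suc.prems] paths_Nil by fastforce
  define s where "s = sd s0"
  have s: "sd s = s" "\<And>u. u \<in> verts Q \<Longrightarrow> vh u s = \<Lambda> (u, [])"
    using s0 by (simp_all add: s_def V_sd vh_V)
  define c where "c = (\<lambda>l u. SOME c. \<forall>b. vh u (fl l b) = (\<Sum>a\<in>into u. c a * am a b))"
  have c: "vh u (fl l b) = (\<Sum>a\<in>into u. c l u a * am a b)" if "l \<in> L" "u \<in> verts Q" for l u b
    using someI_ex[OF am_spans[OF that]] unfolding c_def by blast
  \<comment> \<open>Raising the expansion at v to the q-th power gives an expansion at
    \<open>sv v\<close>; independence of the arrow functionals forces equal coefficients.\<close>
  have c_sa: "c l (sv v) (sa a) = c l v a ^ CARD('f)" if l: "l \<in> L" and v: "v \<in> verts Q" and a: "a \<in> into v" for l v a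
  proof -
    have sv: "sv v \<in> verts Q" using v permutes_in_image[OF permutes_verts] by simp
    have inv_sa: "inv_into UNIV sa (sa a) = a" for a using permutes_inverses(2)[OF permutes_arcs] .
    define d where "d = (\<lambda>a. c l (sv v) a - c l v (inv_into UNIV sa a) ^ CARD('f))"
    have "(\<Sum>a\<in>into (sv v). d a * am a b) = 0" for b
    proof -
      have "(\<Sum>a\<in>into (sv v). c l v (inv_into UNIV sa a) ^ CARD('f) * am a b) = (\<Sum>a\<in>into v. (c l v a * am a b) ^ CARD('f))"
        unfolding sum_into_sa[OF v] by (rule sum.cong) (simp_all add: inv_sa am_sa power_mult_distrib)
      also have "\<dots> = vh v (fl l b) ^ CARD('f)" unfolding c[OF l v] by (rule frobenius_sum[symmetric])
      also have "\<dots> = vh (sv v) (fl l b)" by (simp add: vh_sv[OF v] fr_def)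
      also have "\<dots> = (\<Sum>a\<in>into (sv v). c l (sv v) a * am a b)" by (rule c[OF l sv])
      finally show ?thesis by (simp add: d_def left_diff_distrib sum_subtractf)
    qed
    moreover have "sa a \<in> arcs Q" "head Q (sa a) = sv v" using a head_sa permutes_in_image[OF permutes_arcs] by auto
    ultimately have "d (sa a) = 0" using am_independent[OF sv, of d "sa a"] by blast
    thus ?thesis by (simp add: d_def inv_sa)
  qed
  \<comment> \<open>Inserting the expansion that defines c into \<open>am_expand\<close> expresses
    \<open>am a\<close> through the arrow functionals into v; by independence the coefficients are
    the trivial ones.\<close>
  have c_dual: "(\<Sum>l\<in>L. c l v a' * am a l) = (if a' = a then 1 else 0)"
    if v: "v \<in> verts Q" and a: "a \<in> into v" and a': "a' \<in> into v" for v a a'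
  proof -
    define d where "d = (\<lambda>a'. (\<Sum>l\<in>L. c l v a' * am a l) - (if a' = a then 1 else 0))"
    have "(\<Sum>a'\<in>into v. d a' * am a' b) = 0" for b
    proof -
      have "am a b = (\<Sum>l\<in>L. (\<Sum>a'\<in>into v. c l v a' * am a' b) * am a l)"
        using am_expand[of a b] a c[OF _ v] by simp
      also have "\<dots> = (\<Sum>a'\<in>into v. (\<Sum>l\<in>L. c l v a' * am a l) * am a' b)"
        unfolding sum_distrib_right by (subst sum.swap) (simp add: mult_ac)
      finally have "(\<Sum>a'\<in>into v. (\<Sum>l\<in>L. c l v a' * am a l) * am a' b) = am a b" ..
      moreover have "(\<Sum>a'\<in>into v. (if a' = a then 1 else 0) * am a' b) = (\<Sum>a'\<in>into v. if a' = a then am a b else 0)"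
        by (rule sum.cong) auto
      moreover have "\<dots> = am a b" using a finite_arcs by simp
      ultimately show ?thesis unfolding d_def left_diff_distrib sum_subtractf by simp
    qed
    hence "d a' = 0" using am_independent[OF v, of d a'] a' by blast
    thus ?thesis by (simp add: d_def)
  qed
  define \<Lambda>' where "\<Lambda>' = (\<lambda>l (v, p). \<Sum>a\<in>into v. c l v a * \<Lambda> (tail Q a, a # p))"
  have "\<Lambda>' l (sv v, map sa p) = \<Lambda>' l (v, p) ^ CARD('f)" if l: "l \<in> L" and p: "(v, p) \<in> paths Q" for l v p
  proof -
    have v: "v \<in> verts Q" using p by (rule paths_verts)
    have "\<Lambda>' l (sv v, map sa p) = (\<Sum>a\<in>into v. c l (sv v) (sa a) * \<Lambda> (tail Q (sa a), sa a # map sa p))"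
      unfolding \<Lambda>'_def prod.case by (rule sum_into_sa[OF v])
    also have "\<dots> = (\<Sum>a\<in>into v. (c l v a * \<Lambda> (tail Q a, a # p)) ^ CARD('f))"
    proof (rule sum.cong)
      fix a assume a: "a \<in> into v"
      hence "(tail Q a, a # p) \<in> paths Q" using p by (auto simp: paths_Cons)
      from Suc.prems[OF this] show "c l (sv v) (sa a) * \<Lambda> (tail Q (sa a), sa a # map sa p) = (c l v a * \<Lambda> (tail Q a, a # p)) ^ CARD('f)"
        using a by (simp add: c_sa[OF l v a] tail_sa power_mult_distrib)
    qed simp
    also have "\<dots> = \<Lambda>' l (v, p) ^ CARD('f)" by (simp add: \<Lambda>'_def frobenius_sum)
    finally show ?thesis .
  qed
  hence "\<forall>l\<in>L. \<exists>b. \<forall>u p. (u, p) \<in> paths Q \<longrightarrow> length p \<le> n \<longrightarrow> cf u p b = \<Lambda>' l (u, p)"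
    using Suc.IH by blast
  then obtain bl where bl: "\<And>l u p. l \<in> L \<Longrightarrow> (u, p) \<in> paths Q \<Longrightarrow> length p \<le> n \<Longrightarrow> cf u p (bl l) = \<Lambda>' l (u, p)"
    by metis
  \<comment> \<open>The factor \<open>idem l\<close> makes \<open>fl l b\<close> equal to
    \<open>bl l * idem l\<close>; it is absorbed again by \<open>am_idem\<close>.\<close>
  define b where "b = s + (\<Sum>l\<in>L. bl l * idem l * l)"
  have fl_b: "fl l b = bl l * idem l" if l: "l \<in> L" for l
  proof -
    have "fl l b = (\<Sum>l'\<in>L. bl l' * idem l' * fl l l')"
      unfolding b_def by (simp add: fl_add[OF l] fl_sd[OF l s(1)] fl_sum[OF l] fl_mult[OF l L_sd])
    also have "\<dots> = (\<Sum>l'\<in>L. if l' = l then bl l * idem l else 0)"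
    proof (rule sum.cong)
      fix l' assume "l' \<in> L"
      thus "bl l' * idem l' * fl l l' = (if l' = l then bl l * idem l else 0)"
        using idem_E[OF l] by (auto simp: fl_dual[OF l] mult.assoc)
    qed simp
    finally show ?thesis using l by simp
  qed
  have "cf u p b = \<Lambda> (u, p)" if p: "(u, p) \<in> paths Q" "length p \<le> Suc n" for u p
  proof (cases p)
    case Nil
    have u: "u \<in> verts Q" using paths_verts p by blast
    show ?thesis
      using Nil by (simp add: b_def V_add[OF vh_V[OF u]] V_sum[OF vh_V[OF u]] V_mult[OF vh_V[OF u]]
          V_radical[OF vh_V[OF u] L_sd] s(2)[OF u])
  next
    case (Cons a r)
    define v where "v = head Q a"
    have a: "a \<in> arcs Q" "u = tail Q a" and r: "(v, r) \<in> paths Q" "length r \<le> n"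
      using p Cons by (auto simp: paths_Cons v_def)
    have v: "v \<in> verts Q" and av: "a \<in> into v" using paths_verts r a by (auto simp: v_def)
    have "cf u p b = (\<Sum>l\<in>L. \<Lambda>' l (v, r) * (vh v (idem l) * am a l))"
      using Cons by (simp add: v_def[symmetric] fl_b cf_mult_sd[OF r(1) idem_sd] bl[OF _ r] mult.assoc)
    also have "\<dots> = (\<Sum>l\<in>L. \<Lambda>' l (v, r) * am a l)"
      by (rule sum.cong) (simp_all add: v_def am_idem[OF a(1)])
    also have "\<dots> = (\<Sum>a'\<in>into v. \<Lambda> (tail Q a', a' # r) * (\<Sum>l\<in>L. c l v a' * am a l))"
      unfolding \<Lambda>'_def prod.case sum_distrib_right sum_distrib_left by (subst sum.swap) (simp add: mult_ac)
    also have "\<dots> = (\<Sum>a'\<in>into v. if a' = a then \<Lambda> (tail Q a, a # r) else 0)"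
      by (rule sum.cong) (auto simp: c_dual[OF v av])
    also have "\<dots> = \<Lambda> (u, p)" using av Cons a finite_arcs by simp
    finally show ?thesis .
  qed
  thus ?case by blast
qed

section \<open>Finiteness of the set of paths and the isomorphism\<close>

lemma paths_length: "(u, p) \<in> paths Q \<Longrightarrow> length p \<le> rk u"
proof (induction p arbitrary: u)
  case (Cons a p)
  hence a: "a \<in> arcs Q" "u = tail Q a" and "(head Q a, p) \<in> paths Q" by (simp_all add: paths_Cons)
  hence "length p \<le> rk (head Q a)" using Cons.IH by blast
  thus ?case using rk_less[OF a(1)] a(2) by simp
qed simp

text \<open>The inserted 0 covers the empty quiver, which occurs when B is the zero ring.\<close>

definition bound :: nat where "bound = Max (insert 0 (rk ` verts Q))"

lemma paths_bound: assumes "(u, p) \<in> paths Q" shows "length p \<le> bound"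
proof -
  have "rk u \<le> bound" unfolding bound_def using paths_verts[OF assms] finite_verts by (intro Max_ge) auto
  thus ?thesis using paths_length[OF assms] by simp
qed

lemma paths_arcs: "(u, p) \<in> paths Q \<Longrightarrow> set p \<subseteq> arcs Q"
  by (induction p arbitrary: u) (auto simp: paths_Cons)

lemma finite_paths: "finite (paths Q)"
proof (rule finite_subset)
  show "paths Q \<subseteq> verts Q \<times> {p. set p \<subseteq> arcs Q \<and> length p \<le> bound}"
    by (auto dest: paths_verts paths_bound paths_arcs[THEN subsetD])
  show "finite (verts Q \<times> {p. set p \<subseteq> arcs Q \<and> length p \<le> bound})"
    by (intro finite_cartesian_product finite_verts finite_lists_length_le finite_arcs)
qed

definition \<Phi> :: "'b \<Rightarrow> (('v, 'a) path \<Rightarrow>\<^sub>0 'f alg_closure)" where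
  "\<Phi> b = (\<Sum>x\<in>paths Q. Poly_Mapping.single x (cf (fst x) (snd x) b))"

lemma lookup_\<Phi>: "lookup (\<Phi> b) x = (if x \<in> paths Q then cf (fst x) (snd x) b else 0)"
  unfolding \<Phi>_def Poly_Mapping.lookup_sum
  by (simp add: lookup_single when_def finite_paths if_distrib cong: if_cong)

lemma \<Phi>_path_algebra: "\<Phi> b \<in> path_algebra Q"
proof -
  have "x \<in> paths Q" if "x \<in> Poly_Mapping.keys (\<Phi> b)" for x
    using that by (simp add: in_keys_iff lookup_\<Phi> split: if_splits)
  thus ?thesis by (auto simp: path_algebra_def)
qed

lemma lookup_path_mult:
  assumes f: "f \<in> path_algebra Q" and g: "g \<in> path_algebra Q"
  shows "lookup (path_mult Q f g) (u, p) =
    (if (u, p) \<in> paths Q then \<Sum>k\<le>length p. lookup f (path_target Q (u, take k p), drop k p) *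
       lookup g (u, take k p) else 0)"
proof -
  \<comment> \<open>Pairs of composable paths with product (u, p), where y is traversed first; the
    length of y identifies them with the cut points of p.\<close>
  define T where "T = {(x, y). x \<in> paths Q \<and> y \<in> paths Q \<and> path_source x = path_target Q y \<and>
    (path_source y, snd y @ snd x) = (u, p)}"
  have "path_mult Q f g = (\<Sum>x\<in>paths Q. \<Sum>y\<in>paths Q. if path_source x = path_target Q y
    then Poly_Mapping.single (path_source y, snd y @ snd x) (lookup f x * lookup g y) else 0)"
  proof -
    have "path_mult Q f g = (\<Sum>x\<in>Poly_Mapping.keys f. \<Sum>y\<in>paths Q. if path_source x = path_target Q y
      then Poly_Mapping.single (path_source y, snd y @ snd x) (lookup f x * lookup g y) else 0)"
      unfolding path_mult_def
      by (intro sum.cong sum.mono_neutral_left refl finite_paths)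
        (use g in \<open>auto simp: path_algebra_def in_keys_iff\<close>)
    also have "\<dots> = (\<Sum>x\<in>paths Q. \<Sum>y\<in>paths Q. if path_source x = path_target Q y
      then Poly_Mapping.single (path_source y, snd y @ snd x) (lookup f x * lookup g y) else 0)"
      by (rule sum.mono_neutral_left[OF finite_paths])
        (use f in \<open>auto simp: path_algebra_def in_keys_iff intro!: sum.neutral\<close>)
    finally show ?thesis .
  qed
  hence "lookup (path_mult Q f g) (u, p) = (\<Sum>x\<in>paths Q. \<Sum>y\<in>paths Q.
      if (x, y) \<in> T then lookup f x * lookup g y else 0)"
    unfolding T_def by (simp add: Poly_Mapping.lookup_sum)
      (intro sum.cong refl, auto simp: lookup_single when_def)
  also have "\<dots> = (\<Sum>(x, y)\<in>paths Q \<times> paths Q. if (x, y) \<in> T then lookup f x * lookup g y else 0)"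
    by (rule sum.cartesian_product)
  also have "\<dots> = (\<Sum>(x, y)\<in>T. lookup f x * lookup g y)"
  proof (rule sum.mono_neutral_cong_right)
    show "T \<subseteq> paths Q \<times> paths Q" by (auto simp: T_def)
  qed (auto simp: finite_paths)
  also have "\<dots> = (if (u, p) \<in> paths Q then \<Sum>k\<le>length p. lookup f (path_target Q (u, take k p), drop k p) *
       lookup g (u, take k p) else 0)"
  proof (cases "(u, p) \<in> paths Q")
    case True
    have split: "(u, take k p) \<in> paths Q \<and> (path_target Q (u, take k p), drop k p) \<in> paths Q" for k
      using True paths_append[of u "take k p" "drop k p"] by simp
    define j where "j = (\<lambda>(x :: ('v, 'a) path, y :: ('v, 'a) path). length (snd y))"
    have "(\<Sum>(x, y)\<in>T. lookup f x * lookup g y) =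
      (\<Sum>k\<le>length p. lookup f (path_target Q (u, take k p), drop k p) * lookup g (u, take k p))"
    proof (rule sum.reindex_bij_witness[of _ "\<lambda>k. ((path_target Q (u, take k p), drop k p), (u, take k p))" j])
      fix z assume "z \<in> T"
      then obtain r r' where "z = ((path_target Q (u, r'), r), (u, r'))" "p = r' @ r"
        by (auto simp: T_def path_source_def)
      note z = this
      show "((path_target Q (u, take (j z) p), drop (j z) p), (u, take (j z) p)) = z" "j z \<in> {..length p}"
        "lookup f (path_target Q (u, take (j z) p), drop (j z) p) * lookup g (u, take (j z) p) =
          (case z of (x, y) \<Rightarrow> lookup f x * lookup g y)"
        by (simp_all add: z j_def)
    next
      fix k assume "k \<in> {..length p}"
      thus "j ((path_target Q (u, take k p), drop k p), u, take k p) = k" by (simp add: j_def)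
      show "((path_target Q (u, take k p), drop k p), u, take k p) \<in> T"
        using split[of k] by (simp add: T_def path_source_def)
    qed
    thus ?thesis using True by simp
  next
    case False
    have "T = {}" using False paths_append by (auto simp: T_def path_source_def)
    thus ?thesis using False by simp
  qed
  finally show ?thesis .
qed

lemma \<Phi>_mult: "\<Phi> (x * y) = path_mult Q (\<Phi> x) (\<Phi> y)"
proof (rule poly_mapping_eqI)
  fix z :: "('v, 'a) path"
  obtain u p where z: "z = (u, p)" by (cases z)
  have "(u, take k p) \<in> paths Q \<and> (path_target Q (u, take k p), drop k p) \<in> paths Q" if "(u, p) \<in> paths Q" for k
    using that paths_append[of u "take k p" "drop k p"] by simp
  thus "lookup (\<Phi> (x * y)) z = lookup (path_mult Q (\<Phi> x) (\<Phi> y)) z"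
    unfolding z lookup_path_mult[OF \<Phi>_path_algebra \<Phi>_path_algebra] by (simp add: lookup_\<Phi> cf_mult)
qed

lemma path_image_inj: "inj (path_image sv sa)"
proof (rule injI)
  fix x y assume "path_image sv sa x = path_image sv sa y"
  thus "x = y" using permutes_inj[OF permutes_verts] permutes_inj[OF permutes_arcs]
    by (auto simp: path_image_def inj_eq prod_eq_iff inj_map_eq_map)
qed

lemma path_image_surj: "\<exists>x. y = path_image sv sa x"
  using permutes_inverses(1)[OF permutes_verts] permutes_inverses(1)[OF permutes_arcs]
  by (intro exI[of _ "(inv_into UNIV sv (fst y), map (inv_into UNIV sa) (snd y))"]) (simp add: path_image_def comp_def)

lemma path_image_paths: "path_image sv sa (u, p) \<in> paths Q \<longleftrightarrow> (u, p) \<in> paths Q"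
proof (induction p arbitrary: u)
  case Nil
  show ?case using permutes_in_image[OF permutes_verts] by (simp add: path_image_def paths_Nil)
next
  case (Cons a p)
  show ?case
  proof (cases "a \<in> arcs Q")
    case True
    thus ?thesis using Cons.IH[of "head Q a"] permutes_in_image[OF permutes_arcs] permutes_inj[OF permutes_verts]
      by (simp add: path_image_def paths_Cons head_sa tail_sa inj_eq)
  next
    case False
    thus ?thesis using permutes_in_image[OF permutes_arcs] by (simp add: path_image_def paths_Cons)
  qed
qed

text \<open>\<open>path_image\<close> is a bijection of all pairs, not only of the paths of Q, so
  each coefficient of \<open>frobenius sv sa f\<close> comes from a single one of f and the
  condition can be read pointwise.\<close>

lemma frobenius_fixed_iff:
  "frobenius sv sa f = f \<longleftrightarrow> (\<forall>x. lookup f (path_image sv sa x) = lookup f x ^ CARD('f))"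
  for f :: "('v, 'a) path \<Rightarrow>\<^sub>0 'f alg_closure"
proof -
  have lookup_frobenius: "lookup (frobenius sv sa f) (path_image sv sa x) = lookup f x ^ CARD('f)" for x
  proof -
    have "lookup (frobenius sv sa f) (path_image sv sa x) =
      (\<Sum>y\<in>Poly_Mapping.keys f. if y = x then lookup f x ^ CARD('f) else 0)"
      unfolding frobenius_def Poly_Mapping.lookup_sum
      by (intro sum.cong refl) (auto simp: lookup_single when_def inj_eq[OF path_image_inj])
    also have "\<dots> = lookup f x ^ CARD('f)"
      by (simp add: in_keys_iff)
    finally show ?thesis .
  qed
  show ?thesis
  proof
    assume fixed: "\<forall>x. lookup f (path_image sv sa x) = lookup f x ^ CARD('f)"
    show "frobenius sv sa f = f"
    proof (rule poly_mapping_eqI)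
      fix y
      obtain x where y: "y = path_image sv sa x" using path_image_surj by blast
      show "lookup (frobenius sv sa f) y = lookup f y"
        unfolding y lookup_frobenius using spec[OF fixed] by (rule sym)
    qed
  next
    assume "frobenius sv sa f = f"
    thus "\<forall>x. lookup f (path_image sv sa x) = lookup f x ^ CARD('f)"
      using lookup_frobenius by simp
  qed
qed

theorem isomorphic: "isomorphic_to_fixed_point_algebra scale Q sv sa"
  unfolding isomorphic_to_fixed_point_algebra_def
proof (intro exI conjI allI)
  show "bij_betw \<Phi> UNIV (fixed_point_algebra Q sv sa)"
    unfolding bij_betw_def
  proof
    show "inj \<Phi>"
    proof (rule injI)
      fix x y assume xy: "\<Phi> x = \<Phi> y"
      have "x - y = 0"
      proof (rule cf_injective)
        fix u p assume p: "(u, p) \<in> paths Q"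
        have "cf u p x = cf u p y" using arg_cong[OF xy, of "\<lambda>f. lookup f (u, p)"] p by (simp add: lookup_\<Phi>)
        thus "cf u p (x - y) = 0" using cf_add[OF p, of "x - y" y] by simp
      qed
      thus "x = y" by simp
    qed
    show "range \<Phi> = fixed_point_algebra Q sv sa"
    proof (intro equalityI subsetI)
      fix f assume "f \<in> range \<Phi>"
      then obtain b where f: "f = \<Phi> b" by blast
      have "lookup f (path_image sv sa x) = lookup f x ^ CARD('f)" for x
      proof (cases x)
        case (Pair u p)
        show ?thesis unfolding Pair f lookup_\<Phi> path_image_paths
          by (simp add: path_image_def cf_frobenius)
      qed
      thus "f \<in> fixed_point_algebra Q sv sa"
        unfolding fixed_point_algebra_def using \<Phi>_path_algebra f frobenius_fixed_iff[of f] by blast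
    next
      fix f :: "('v, 'a) path \<Rightarrow>\<^sub>0 'f alg_closure" assume "f \<in> fixed_point_algebra Q sv sa"
      hence f: "f \<in> path_algebra Q" and "frobenius sv sa f = f" by (simp_all add: fixed_point_algebra_def)
      hence fixed: "lookup f (path_image sv sa x) = lookup f x ^ CARD('f)" for x
        using frobenius_fixed_iff[of f] by blast
      have "\<exists>b. \<forall>u p. (u, p) \<in> paths Q \<longrightarrow> length p \<le> bound \<longrightarrow> cf u p b = lookup f (u, p)"
      proof (rule cf_surjective_bounded)
        show "lookup f (sv u, map sa p) = lookup f (u, p) ^ CARD('f)" for u p
          using fixed[of "(u, p)"] by (simp add: path_image_def)
      qed
      then obtain b where b: "\<And>u p. (u, p) \<in> paths Q \<Longrightarrow> length p \<le> bound \<Longrightarrow> cf u p b = lookup f (u, p)"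
        by blast
      have "\<Phi> b = f"
      proof (rule poly_mapping_eqI)
        fix x show "lookup (\<Phi> b) x = lookup f x"
          using b[of "fst x" "snd x"] paths_bound[of "fst x" "snd x"] f by (auto simp: lookup_\<Phi> path_algebra_def in_keys_iff)
      qed
      thus "f \<in> range \<Phi>" by blast
    qed
  qed
  show "\<Phi> (x + y) = \<Phi> x + \<Phi> y" for x y
    by (rule poly_mapping_eqI) (simp add: lookup_\<Phi> lookup_add cf_add split_beta)
  show "\<Phi> (x * y) = path_mult Q (\<Phi> x) (\<Phi> y)" for x y by (rule \<Phi>_mult)
  show "\<Phi> 1 = path_one Q"
  proof (rule poly_mapping_eqI)
    fix z :: "('v, 'a) path"
    obtain u p where z: "z = (u, p)" by (cases z)
    have "lookup (path_one Q :: ('v, 'a) path \<Rightarrow>\<^sub>0 'f alg_closure) z = (\<Sum>v\<in>verts Q. if v = u \<and> p = [] then 1 else 0)"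
      unfolding path_one_def Poly_Mapping.lookup_sum z by (intro sum.cong refl) (auto simp: lookup_single when_def)
    also have "\<dots> = (if (u, p) \<in> paths Q \<and> p = [] then 1 else 0)"
      using finite_verts by (cases "p = []") (simp_all add: paths_Nil)
    finally show "lookup (\<Phi> 1) z = lookup (path_one Q :: ('v, 'a) path \<Rightarrow>\<^sub>0 'f alg_closure) z"
      unfolding lookup_\<Phi> z fst_conv snd_conv by (auto simp only: cf_1 split: if_splits)
  qed
  show "\<Phi> (scale c x) = path_scale (to_ac c) (\<Phi> x)" for c x
    by (rule poly_mapping_eqI) (auto simp: lookup_\<Phi> path_scale_def Poly_Mapping.map.rep_eq when_def cf_scale)
qed

end

section \<open>The quiver of the algebra\<close>

context dual_system begin

text \<open>By \<open>V_E_unique\<close> there is just one such e; v factors through the field e B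
  e.\<close>

definition vert_idem :: "('b \<Rightarrow> 'f alg_closure) \<Rightarrow> 'b" where
  "vert_idem v = (SOME e. e \<in> E \<and> v e = 1)"

lemma vert_idem: "v \<in> V \<Longrightarrow> vert_idem v \<in> E \<and> v (vert_idem v) = 1"
  unfolding vert_idem_def by (rule someI_ex) (use V_ex_E in blast)

lemma vert_idem_fr: assumes v: "v \<in> V" shows "vert_idem (fr v) = vert_idem v"
proof (rule ccontr)
  assume ne: "vert_idem (fr v) \<noteq> vert_idem v"
  have "v (vert_idem (fr v)) = 0"
    using V_E_unique[OF v _ _ _ ne] vert_idem[OF v] vert_idem[OF fr_V[OF v]] by blast
  thus False using vert_idem[OF fr_V[OF v]] frobenius_eq_0_iff[of "v (vert_idem (fr v))"] by (simp add: fr_apply)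
qed

lemma pr_nonzero: assumes "\<rho> \<in> Rb v w" obtains b where "pr v w \<rho> b \<noteq> 0"
proof (rule ccontr)
  assume "\<not> thesis"
  hence 0: "pr v w \<rho> b = 0" for b using that by blast
  have "(\<Sum>\<rho>'\<in>Rb v w. (if \<rho>' = \<rho> then 1 else 0) * pr v w \<rho>' b) = 0" for b
    by (rule sum.neutral) (simp add: 0)
  from Rb_independent[OF this assms] show False by simp
qed

text \<open>An arrow functional vanishes on S but not identically, and equivariance makes it nonzero
  at some e b f; so e and f differ and e B f is nonzero.\<close>

lemma height_arrow:
  assumes v: "v \<in> V" and w: "w \<in> V" and \<rho>: "\<rho> \<in> Rb v w"
  shows "height (vert_idem v) < height (vert_idem w)"
proof -
  define e where "e = vert_idem v"
  define f where "f = vert_idem w"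
  have e: "e \<in> E" "v e = 1" and f: "f \<in> E" "w f = 1"
    using vert_idem v w by (simp_all add: e_def f_def)
  have sd: "sd e = e" "sd f = f" using sd_D E_mem_D e f by blast+
  obtain b where "pr v w \<rho> b \<noteq> 0" using pr_nonzero[OF \<rho>] .
  moreover have "pr v w \<rho> (e * (b * f)) = pr v w \<rho> b"
    by (simp add: pr_mult_left[OF Rb_Rat[OF \<rho>] v sd(1)] pr_mult_right[OF Rb_Rat[OF \<rho>] w sd(2)] e f)
  ultimately have nz: "pr v w \<rho> (e * b * f) \<noteq> 0" by (simp add: mult.assoc)
  have "e \<noteq> f"
  proof
    assume "e = f"
    hence "sd (e * b * f) = e * b * f" using sd_D[OF e(1) D_I[OF e(1)]] by simp
    thus False using nz pr_sd[OF Rb_Rat[OF \<rho>]] by blast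
  qed
  moreover have "e * b * f \<noteq> 0" using nz pr_sd[OF Rb_Rat[OF \<rho>], of 0] by auto
  ultimately show ?thesis using height_less[OF e(1) f(1)] by (simp add: e_def f_def)
qed

text \<open>The head v comes first, matching the side on which it acts. The pair belongs to the
  arrow because one \<rho> may serve several pairs.\<close>

definition Arr :: "(('b \<Rightarrow> 'f alg_closure) \<times> ('b \<Rightarrow> 'f alg_closure) \<times> ('b \<Rightarrow> 'f alg_closure)) set" where
  "Arr = {(v, w, \<rho>). v \<in> V \<and> w \<in> V \<and> \<rho> \<in> Rb v w}"

lemma finite_Arr: "finite Arr"
proof (rule finite_subset)
  show "Arr \<subseteq> V \<times> V \<times> Rat" using Rb_Rat by (auto simp: Arr_def)
  show "finite (V \<times> V \<times> Rat)" by (intro finite_cartesian_product finite_V finite_Rat)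
qed

text \<open>The label \<rho> is kept, which is legitimate by \<open>Rb_fr\<close>.\<close>

definition fr_arr where "fr_arr = (\<lambda>(v, w, \<rho> :: 'b \<Rightarrow> 'f alg_closure). (fr v, fr w, \<rho>))"

lemma fr_arr_bij: "bij_betw fr_arr Arr Arr"
  unfolding bij_betw_def
proof
  show "inj_on fr_arr Arr" by (rule inj_onI) (auto simp: fr_arr_def dest: fr_inj)
  moreover have "fr_arr ` Arr \<subseteq> Arr" by (auto simp: Arr_def fr_arr_def fr_V Rb_fr)
  ultimately show "fr_arr ` Arr = Arr" using finite_Arr by (intro endo_inj_surj)
qed

theorem quiver_exists:
  "\<exists>(Q :: (nat, nat) pre_digraph) sv sa. ad_quiver Q sv sa \<and> isomorphic_to_fixed_point_algebra scale Q sv sa"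
proof -
  obtain ev :: "nat \<Rightarrow> 'b \<Rightarrow> 'f alg_closure" where "bij_betw ev {0..<card V} V"
    using ex_bij_betw_nat_finite[OF finite_V] by blast
  moreover define NV where "NV = {0..<card V}"
  ultimately have ev: "bij_betw ev NV V" by simp
  obtain ea where "bij_betw ea {0..<card Arr} Arr"
    using ex_bij_betw_nat_finite[OF finite_Arr] by blast
  moreover define NA where "NA = {0..<card Arr}"
  ultimately have ea: "bij_betw ea NA Arr" by simp
  define de where "de = the_inv_into NV ev"
  define da where "da = the_inv_into NA ea"
  have de: "bij_betw de V NV" unfolding de_def by (rule bij_betw_the_inv_into[OF ev])
  have da: "bij_betw da Arr NA" unfolding da_def by (rule bij_betw_the_inv_into[OF ea])
  have ev_de: "ev (de v) = v" if "v \<in> V" for v unfolding de_def using f_the_inv_into_f_bij_betw[OF ev] that by blast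
  have de_ev: "de (ev u) = u" if "u \<in> NV" for u unfolding de_def using the_inv_into_f_f[of ev NV u] ev that by (simp add: bij_betw_def)
  have ea_da: "ea (da x) = x" if "x \<in> Arr" for x unfolding da_def using f_the_inv_into_f_bij_betw[OF ea] that by blast
  have da_ea: "da (ea a) = a" if "a \<in> NA" for a unfolding da_def using the_inv_into_f_f[of ea NA a] ea that by (simp add: bij_betw_def)
  have ev_V: "ev u \<in> V" if "u \<in> NV" for u using bij_betw_apply[OF ev that] .
  have de_NV: "de v \<in> NV" if "v \<in> V" for v using bij_betw_apply[OF de that] .
  have ea_Arr: "ea a \<in> Arr" if "a \<in> NA" for a using bij_betw_apply[OF ea that] .
  have da_NA: "da x \<in> NA" if "x \<in> Arr" for x using bij_betw_apply[OF da that] .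
  define hv where "hv = (\<lambda>a. fst (ea a))"
  define tw where "tw = (\<lambda>a. fst (snd (ea a)))"
  define rh where "rh = (\<lambda>a. snd (snd (ea a)))"
  have arr: "hv a \<in> V" "tw a \<in> V" "rh a \<in> Rb (hv a) (tw a)" if "a \<in> NA" for a
    using ea_Arr[OF that] by (auto simp: Arr_def hv_def tw_def rh_def)
  have ea_eq: "ea a = (hv a, tw a, rh a)" for a by (simp add: hv_def tw_def rh_def)
  define Q :: "(nat, nat) pre_digraph" where
    "Q = \<lparr>verts = NV, arcs = NA, tail = (\<lambda>a. de (tw a)), head = (\<lambda>a. de (hv a))\<rparr>"
  define sv where "sv = (\<lambda>u. if u \<in> NV then de (fr (ev u)) else u)"
  define sa where "sa = (\<lambda>a. if a \<in> NA then da (fr_arr (ea a)) else a)"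
  have Q [simp]: "verts Q = NV" "arcs Q = NA" "tail Q a = de (tw a)" "head Q a = de (hv a)" for a
    by (simp_all add: Q_def)
  \<comment> \<open>Constant on Frobenius orbits by \<open>vert_idem_fr\<close> and smaller at the
    head of an arrow than at its tail; this alone excludes loops and arrows within an orbit.\<close>
  define rk where "rk = (\<lambda>u. height (vert_idem (ev u)))"
  have rk_less: "rk (de (hv a)) < rk (de (tw a))" if "a \<in> NA" for a
    using height_arrow[OF arr[OF that]] arr[OF that] by (simp add: rk_def ev_de)
  have sv_perm: "sv permutes NV"
  proof (rule bij_imp_permutes)
    have "bij_betw (de \<circ> (fr \<circ> ev)) NV NV" by (intro bij_betw_trans[OF bij_betw_trans[OF ev fr_bij] de])
    thus "bij_betw sv NV NV" by (rule bij_betw_cong[THEN iffD1, rotated]) (simp add: sv_def)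
  qed (simp add: sv_def)
  have sa_perm: "sa permutes NA"
  proof (rule bij_imp_permutes)
    have "bij_betw (da \<circ> (fr_arr \<circ> ea)) NA NA" by (intro bij_betw_trans[OF bij_betw_trans[OF ea fr_arr_bij] da])
    thus "bij_betw sa NA NA" by (rule bij_betw_cong[THEN iffD1, rotated]) (simp add: sa_def)
  qed (simp add: sa_def)
  have ev_sv: "ev (sv u) = fr (ev u)" if "u \<in> NV" for u
    using that by (simp add: sv_def ev_de fr_V ev_V)
  have sv_de: "sv (de v) = de (fr v)" if "v \<in> V" for v
    using that by (simp add: sv_def ev_de de_NV)
  have sa_simps: "sa a \<in> NA" "hv (sa a) = fr (hv a)" "tw (sa a) = fr (tw a)" "rh (sa a) = rh a" if a: "a \<in> NA" for a
  proof -
    have "fr_arr (ea a) \<in> Arr" using bij_betw_apply[OF fr_arr_bij ea_Arr[OF a]] .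
    hence "sa a \<in> NA" "ea (sa a) = fr_arr (ea a)" using a by (simp_all add: sa_def da_NA ea_da)
    thus "sa a \<in> NA" "hv (sa a) = fr (hv a)" "tw (sa a) = fr (tw a)" "rh (sa a) = rh a"
      by (simp_all add: hv_def tw_def rh_def fr_arr_def split: prod.splits)
  qed
  have quiver: "ad_quiver Q sv sa"
  proof
    fix a assume a: "a \<in> arcs Q"
    hence aN: "a \<in> NA" by simp
    show "tail Q a \<in> verts Q" "head Q a \<in> verts Q" using arr[OF aN] by (simp_all add: de_NV)
    show "tail Q a \<noteq> head Q a" using rk_less[OF aN] by auto
    show "tail Q (sa a) = sv (tail Q a)" "head Q (sa a) = sv (head Q a)"
      using arr[OF aN] by (simp_all add: sa_simps[OF aN] sv_de)
    have "x \<in> NV \<and> rk x = rk (de (tw a))" if "x \<in> orbit sv (de (tw a))" for x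
      using that
    proof induction
      case base
      show ?case using arr[OF aN] by (simp add: sv_de de_NV fr_V rk_def ev_de vert_idem_fr)
    next
      case (step x)
      hence x: "x \<in> NV" "rk x = rk (de (tw a))" by auto
      have "sv x \<in> NV" using permutes_in_image[OF sv_perm] x by simp
      moreover have "rk (sv x) = rk x" using x by (simp add: rk_def ev_sv vert_idem_fr ev_V)
      ultimately show ?case using x by simp
    qed
    thus "head Q a \<notin> orbit sv (tail Q a)" using rk_less[OF aN] by fastforce
  next
    show "finite (verts Q)" "finite (arcs Q)" by (simp_all add: NV_def NA_def)
    show "sv permutes verts Q" "sa permutes arcs Q" using sv_perm sa_perm by simp_all
  qed
  define am where "am = (\<lambda>a. pr (hv a) (tw a) (rh a))"
  have rat: "rh a \<in> Rat" if "a \<in> NA" for a using Rb_Rat arr(3)[OF that] .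
  \<comment> \<open>Sums over the arrows into u become double sums over w and \<rho>, the form in
    which \<open>Rb_independent'\<close> and \<open>coordinate_expansion\<close> are stated.\<close>
  have sum_into: "(\<Sum>a\<in>{a \<in> arcs Q. head Q a = u}. g a) = (\<Sum>w\<in>V. \<Sum>\<rho>\<in>Rb (ev u) w. g (da (ev u, w, \<rho>)))"
    if u: "u \<in> NV" for u and g :: "nat \<Rightarrow> 'f alg_closure"
  proof -
    have "(\<Sum>a\<in>{a \<in> arcs Q. head Q a = u}. g a) = (\<Sum>(w, \<rho>)\<in>(SIGMA w:V. Rb (ev u) w). g (da (ev u, w, \<rho>)))"
    proof (rule sum.reindex_bij_witness[of _ "\<lambda>(w, \<rho>). da (ev u, w, \<rho>)" "\<lambda>a. (tw a, rh a)"])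
      fix a assume "a \<in> {a \<in> arcs Q. head Q a = u}"
      hence a: "a \<in> NA" "de (hv a) = u" by simp_all
      have hv: "hv a = ev u" using a arr[OF a(1)] ev_de by metis
      show "(case (tw a, rh a) of (w, \<rho>) \<Rightarrow> da (ev u, w, \<rho>)) = a"
        using da_ea[OF a(1)] by (simp add: ea_eq hv)
      thus "(case (tw a, rh a) of (w, \<rho>) \<Rightarrow> g (da (ev u, w, \<rho>))) = g a" by simp
      show "(tw a, rh a) \<in> (SIGMA w:V. Rb (ev u) w)" using arr[OF a(1)] by (simp add: hv)
    next
      fix x assume "x \<in> (SIGMA w:V. Rb (ev u) w)"
      then obtain w \<rho> where x: "x = (w, \<rho>)" "w \<in> V" "\<rho> \<in> Rb (ev u) w" by blast
      have A: "(ev u, w, \<rho>) \<in> Arr" using x ev_V[OF u] by (simp add: Arr_def)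
      show "(tw (case x of (w, \<rho>) \<Rightarrow> da (ev u, w, \<rho>)), rh (case x of (w, \<rho>) \<Rightarrow> da (ev u, w, \<rho>))) = x"
        by (simp add: x(1) tw_def rh_def ea_da[OF A])
      show "(case x of (w, \<rho>) \<Rightarrow> da (ev u, w, \<rho>)) \<in> {a \<in> arcs Q. head Q a = u}"
        using u by (simp add: x(1) hv_def ea_da[OF A] da_NA[OF A] de_ev)
    qed
    also have "\<dots> = (\<Sum>w\<in>V. \<Sum>\<rho>\<in>Rb (ev u) w. g (da (ev u, w, \<rho>)))"
      by (rule sum.Sigma[symmetric]) (simp_all add: finite_V finite_Rb)
    finally show ?thesis .
  qed
  have am_da: "am (da (ev u, w, \<rho>)) = pr (ev u) w \<rho>" if "u \<in> NV" "w \<in> V" "\<rho> \<in> Rb (ev u) w" for u w \<rho>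
    using that ev_V ea_da[of "(ev u, w, \<rho>)"] by (simp add: am_def hv_def tw_def rh_def Arr_def)
  have sum_am: "(\<Sum>a\<in>{a \<in> arcs Q. head Q a = u}. c a * am a b) =
      (\<Sum>w\<in>V. \<Sum>\<rho>\<in>Rb (ev u) w. c (da (ev u, w, \<rho>)) * pr (ev u) w \<rho> b)" if u: "u \<in> NV" for u c b
    unfolding sum_into[OF u] by (intro sum.cong refl) (simp add: am_da[OF u])
  interpret ad_quiver Q sv sa by (rule quiver)
  interpret path_system scale E L idem fl Q sv sa ev am rk
  proof
    show "bij_betw ev (verts Q) V" using ev by simp
    show "ev (sv u) = fr (ev u)" if "u \<in> verts Q" for u using ev_sv that by simp
    show "am a (x + y) = am a x + am a y" if "a \<in> arcs Q" for a x y
      using that pr_add[OF rat] by (simp add: am_def)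
    show "am a s = 0" if "a \<in> arcs Q" "sd s = s" for a s
      using that pr_sd[OF rat] by (simp add: am_def)
    show "am a (x * y) = ev (head Q a) x * am a y + am a x * ev (tail Q a) y" if "a \<in> arcs Q" for a x y
      using that pr_mult[OF rat arr(1,2)] arr by (simp add: am_def ev_de)
    show "am (sa a) b = am a b ^ CARD('f)" if "a \<in> arcs Q" for a b
      using that pr_frobenius[OF rat] by (simp add: am_def sa_simps)
    show "c a = 0" if u: "u \<in> verts Q" and 0: "\<And>b. (\<Sum>a\<in>{a \<in> arcs Q. head Q a = u}. c a * am a b) = 0"
      and a: "a \<in> arcs Q" "head Q a = u" for u c a
    proof -
      have uN: "u \<in> NV" and aN: "a \<in> NA" using u a by simp_all
      have hv: "hv a = ev u" using a arr[OF aN] ev_de[of "hv a"] by simp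
      have "(\<lambda>w \<rho>. c (da (ev u, w, \<rho>))) (tw a) (rh a) = 0"
        by (rule Rb_independent'[where v = "ev u"]) (use arr[OF aN] hv 0 sum_am[OF uN] in simp_all)
      thus ?thesis using da_ea[OF aN] by (simp add: ea_eq hv)
    qed
    show "\<exists>c. \<forall>b. ev u (fl l b) = (\<Sum>a\<in>{a \<in> arcs Q. head Q a = u}. c a * am a b)"
      if l: "l \<in> L" and u: "u \<in> verts Q" for l u
    proof -
      have uN: "u \<in> NV" using u by simp
      obtain k where k: "\<And>b. ev u (fl l b) = (\<Sum>w\<in>V. \<Sum>\<rho>\<in>Rb (ev u) w. k w \<rho> * pr (ev u) w \<rho> b)"
        using coordinate_expansion[OF l ev_V[OF uN]] by blast
      have "ev u (fl l b) = (\<Sum>a\<in>{a \<in> arcs Q. head Q a = u}. k (tw a) (rh a) * am a b)" for b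
        unfolding k sum_am[OF uN]
        by (intro sum.cong refl) (simp add: tw_def rh_def ea_da Arr_def ev_V[OF uN])
      thus ?thesis by (intro exI[of _ "\<lambda>a. k (tw a) (rh a)"] allI)
    qed
    show "rk (head Q a) < rk (tail Q a)" if "a \<in> arcs Q" for a
      using rk_less that by simp
  qed
  show ?thesis using quiver isomorphic by blast
qed

end

theorem theorem6p5:
  fixes scale :: "'f::{field, finite} \<Rightarrow> 'b::{ring, monoid_mult} \<Rightarrow> 'b"
  assumes "fd_algebra scale"
    and "hereditary TYPE('b)"
    and "basic TYPE('b)"
  shows "\<exists>(Q :: (nat, nat) pre_digraph) sv sa.
    ad_quiver Q sv sa \<and> isomorphic_to_fixed_point_algebra scale Q sv sa"
proof -
  interpret fd_algebra scale by fact
  obtain E :: "'b set" where E: "complete_primitive_orthogonal E"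
    "\<And>e f. e \<in> E \<Longrightarrow> f \<in> E \<Longrightarrow> e \<noteq> f \<Longrightarrow>
      \<not> left_ideals_isomorphic (principal_left_ideal e) (principal_left_ideal f)"
    using assms(3) unfolding basic_def by blast
  interpret basic_hereditary_algebra scale E
    using assms(2) E by unfold_locales
  obtain L idem fl where "dual_system scale E L idem fl"
    using dual_system_exists by blast
  then interpret dual_system scale E L idem fl .
  show ?thesis by (rule quiver_exists)
qed

end
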